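(* Let $\mathsf{A}=(A_1,\dots,A_N)$ be a tuple of $2\times2$ complex matrices. If the linear switched system defined by $\mathsf{A}$ is periodically asymptotically stable, then it is globally uniformly exponentially stable.
   Context: A trajectory of the linear switched system defined by $\mathsf{A}$ is an absolutely continuous $x\colon[0,\infty)\to\mathbb{C}^2$ with $\dot x(t)=\sum_{i=1}^N u_i(t)A_ix(t)$ a.e., where $u_i\colon[0,\infty)\to[0,1]$ are Lebesgue measurable with $\sum_iu_i=1$ a.e. (the switching law). The system is globally uniformly exponentially stable if there are $C,\kappa>0$ with $\|x(t)\|\le Ce^{-\kappa t}\|x(0)\|$ for all $t\ge0$ and all trajectories; periodically asymptotically stable if $x(t)\to0$ for every trajectory whose switching law is constant or periodic (i.e. for some $p>0$, $u_i(t+p)=u_i(t)$ a.e. for all $i$). *)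

theory Defs
  imports "HOL-Analysis.Analysis"
begin

definition abs_continuous_on_interval ::
  "real \<Rightarrow> real \<Rightarrow> (real \<Rightarrow> 'a::real_normed_vector) \<Rightarrow> bool" where
  "abs_continuous_on_interval a b x \<longleftrightarrow>
     (\<forall>\<epsilon>>0. \<exists>\<delta>>0. \<forall>D. finite D \<and> D \<subseteq> {(s, t). a \<le> s \<and> s \<le> t \<and> t \<le> b} \<and>
        (\<forall>p\<in>D. \<forall>q\<in>D. p \<noteq> q \<longrightarrow> {fst p<..<snd p} \<inter> {fst q<..<snd q} = {}) \<and>
        (\<Sum>p\<in>D. snd p - fst p) < \<delta>
        \<longrightarrow> (\<Sum>p\<in>D. norm (x (snd p) - x (fst p))) < \<epsilon>)"

definition abs_continuous_on_halfline :: "(real \<Rightarrow> 'a::real_normed_vector) \<Rightarrow> bool" where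
  "abs_continuous_on_halfline x \<longleftrightarrow> (\<forall>b\<ge>0. abs_continuous_on_interval 0 b x)"

definition switching_law :: "nat \<Rightarrow> (nat \<Rightarrow> real \<Rightarrow> real) \<Rightarrow> bool" where
  "switching_law N u \<longleftrightarrow>
     (\<forall>i<N. u i \<in> borel_measurable (restrict_space lebesgue {0..}) \<and>
            (\<forall>t\<ge>0. 0 \<le> u i t \<and> u i t \<le> 1)) \<and>
     (AE t in lebesgue. t \<ge> 0 \<longrightarrow> (\<Sum>i<N. u i t) = 1)"

definition trajectory_with ::
  "nat \<Rightarrow> (nat \<Rightarrow> complex^2^2) \<Rightarrow> (nat \<Rightarrow> real \<Rightarrow> real) \<Rightarrow> (real \<Rightarrow> complex^2) \<Rightarrow> bool" where
  "trajectory_with N A u x \<longleftrightarrow>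
     switching_law N u \<and> abs_continuous_on_halfline x \<and>
     (AE t in lebesgue. t \<ge> 0 \<longrightarrow>
        (x has_vector_derivative (\<Sum>i<N. u i t *\<^sub>R (A i *v x t))) (at t within {0..}))"

definition trajectory ::
  "nat \<Rightarrow> (nat \<Rightarrow> complex^2^2) \<Rightarrow> (real \<Rightarrow> complex^2) \<Rightarrow> bool" where
  "trajectory N A x \<longleftrightarrow> (\<exists>u. trajectory_with N A u x)"

definition GUES :: "nat \<Rightarrow> (nat \<Rightarrow> complex^2^2) \<Rightarrow> bool" where
  "GUES N A \<longleftrightarrow> (\<exists>C \<kappa>::real. C > 0 \<and> \<kappa> > 0 \<and>
     (\<forall>x. trajectory N A x \<longrightarrow> (\<forall>t\<ge>0. norm (x t) \<le> C * exp (- \<kappa> * t) * norm (x 0))))"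

definition constant_law :: "nat \<Rightarrow> (nat \<Rightarrow> real \<Rightarrow> real) \<Rightarrow> bool" where
  "constant_law N u \<longleftrightarrow> (\<forall>i<N. \<forall>t\<ge>0. u i t = u i 0)"

definition periodic_law :: "nat \<Rightarrow> (nat \<Rightarrow> real \<Rightarrow> real) \<Rightarrow> bool" where
  "periodic_law N u \<longleftrightarrow> (\<exists>p>0. \<forall>i<N. AE t in lebesgue. t \<ge> 0 \<longrightarrow> u i (t + p) = u i t)"

definition periodically_asymptotically_stable :: "nat \<Rightarrow> (nat \<Rightarrow> complex^2^2) \<Rightarrow> bool" where
  "periodically_asymptotically_stable N A \<longleftrightarrow>
     (\<forall>u x. trajectory_with N A u x \<and> (constant_law N u \<or> periodic_law N u)
        \<longrightarrow> (x \<longlongrightarrow> 0) at_top)"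

end

(* Suppose the system is not exponentially stable. If the A_i have a common eigenvector, then they are
   simultaneously triangular and constant laws already give a contradiction. Otherwise let rho >= 0 be
   the exponential growth rate. Limits of norms adapted to the Euler maps I + hA_i give a norm v and a
   trajectory x on the whole real line of the system shifted by rho with v(x(t)) = 1 for all t. By a
   minimality argument x may be taken recurrent. If x ever returns to its own complex line, repeating
   that piece is a periodic trajectory which does not decay. Otherwise the projection of x to the
   Riemann sphere is injective, and this is impossible, as in the Poincare-Bendixson theorem: near a
   recurrent point all such trajectories cross in one direction, because the velocities allowed by
   v = 1 lie in an open half plane (else some constant law would have an eigenvalue with nonnegative
   real part). The Jordan curve theorem is replaced by a parity count for a continuous argument of
   det(x(t), x(s)) on t < s: between two nearby passages whose chord is not hit in between, the
   velocity makes an odd number of full turns, and one finds three passages which pairwise have this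
   property. *)
theory Submission
  imports Defs "HOL-Complex_Analysis.Great_Picard"
begin

text \<open>The delicate point of the limit h -> 0 is that the adapted norms are normalised only
  from above, so their limit might be a mere seminorm. Its null space is invariant under all
  \<open>A i\<close>, hence a null line would be a common eigenvector. Norms are complex
  homogeneous: an arc that returns to its own complex line does so up to a unit scalar and can be
  repeated, and undoing the shift multiplies by exp (rho t) >= 1. Trajectories through a point are
  not unique, so there is no flow and no flow box; transversality is therefore proved for any two
  extremals through the same line and made uniform by compactness. Three passages suffice for
  parity: the numbers of turns for T0,T1 and T1,T2 add up to that for T0,T2, but odd plus odd is not
  odd. T0 is the recurrent point, T1 a closest return over a long time span, T2 the first later
  return that is at least as close; the curve misses the chords because in between it stays farther
  away.\<close>

section \<open>Absolutely continuous functions\<close>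

text \<open>In a gauge-fine division the intervals tagged in \<open>S\<close> have small total
  length, so absolute continuity bounds their share of the increment; all others obey the slope
  bound. The hypothesis straddles \<open>t\<close> because a tag may sit anywhere in its
  interval.\<close>

lemma AC_nonincreasing:
  fixes g :: "real \<Rightarrow> real"
  assumes ab: "a \<le> b" and AC: "abs_continuous_on_interval a b g" and S: "negligible S"
    and der: "\<And>t e. t \<in> {a..b} - S \<Longrightarrow> e > 0 \<Longrightarrow>
      \<exists>d>0. \<forall>s u. a \<le> s \<and> s \<le> t \<and> t \<le> u \<and> u \<le> b \<and> u - s < d \<longrightarrow> g u - g s \<le> e * (u - s)"
  shows "g b \<le> g a"
proof -
  have main: "g b - g a \<le> e * (b - a) + e" if e: "e > 0" for e
  proof -
    obtain \<delta> where \<delta>: "\<delta> > 0" and D: "\<And>D. finite D \<and> D \<subseteq> {(s, t). a \<le> s \<and> s \<le> t \<and> t \<le> b} \<and>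
        (\<forall>p\<in>D. \<forall>q\<in>D. p \<noteq> q \<longrightarrow> {fst p<..<snd p} \<inter> {fst q<..<snd q} = {}) \<and>
        (\<Sum>p\<in>D. snd p - fst p) < \<delta> \<Longrightarrow> (\<Sum>p\<in>D. norm (g (snd p) - g (fst p))) < e"
      using AC e unfolding abs_continuous_on_interval_def by blast
    \<comment> \<open>The indicator of \<open>S\<close> has integral 0, so a suitable gauge forces
      the intervals tagged in \<open>S\<close> to have total length below
      \<open>\<delta>\<close>.\<close>
    have "(indicat_real S has_integral 0) (cbox a b)"
      using S unfolding negligible_def by blast
    then obtain \<gamma>1 where g1: "gauge \<gamma>1"
      and \<gamma>1: "\<And>p. p tagged_division_of cbox a b \<Longrightarrow> \<gamma>1 fine p \<Longrightarrow>
          norm ((\<Sum>(x,K)\<in>p. measure lborel K *\<^sub>R indicat_real S x) - 0) < \<delta>"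
      using \<delta> unfolding has_integral by meson
    have "\<exists>d>0. \<forall>s u. a \<le> s \<and> s \<le> t \<and> t \<le> u \<and> u \<le> b \<and> u - s < d \<longrightarrow> g u - g s \<le> e * (u - s)"
      if "t \<in> {a..b} - S" for t using der that e by blast
    then obtain d where d: "\<And>t. t \<in> {a..b} - S \<Longrightarrow> d t > 0"
      "\<And>t s u. t \<in> {a..b} - S \<Longrightarrow> a \<le> s \<Longrightarrow> s \<le> t \<Longrightarrow> t \<le> u \<Longrightarrow> u \<le> b \<Longrightarrow> u - s < d t \<Longrightarrow> g u - g s \<le> e * (u - s)"
      by metis
    define \<gamma>2 where "\<gamma>2 t = ball t (if t \<in> {a..b} - S then d t / 2 else 1)" for t
    have g2: "gauge \<gamma>2" unfolding \<gamma>2_def using d(1) by (intro gauge_ball_dependent) auto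
    obtain p where p: "p tagged_division_of {a..b}" and fine: "(\<lambda>x. \<gamma>1 x \<inter> \<gamma>2 x) fine p"
      using fine_division_exists_real gauge_Int[OF g1 g2] by blast
    have fine1: "\<gamma>1 fine p" and fine2: "\<gamma>2 fine p" using fine by (auto simp: fine_def)
    have fin: "finite p" using p by auto
    have K: "\<exists>c d. K = {c..d} \<and> c \<le> d \<and> a \<le> c \<and> d \<le> b \<and> c \<le> x \<and> x \<le> d"
      if "(x,K) \<in> p" for x K
    proof -
      have "x \<in> K" "K \<subseteq> {a..b}" "\<exists>c d. K = cbox c d"
        using p that by (auto simp: tagged_division_of_def tagged_partial_division_of_def)
      then show ?thesis by auto
    qed
    define T where "T = {q\<in>p. fst q \<in> S}"
    define h where "h = (\<lambda>q::real \<times> real set. (Inf (snd q), Sup (snd q)))"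
    have finT: "finite T" using fin T_def by auto
    have disj: "interior K \<inter> interior K' = {}" if "(x,K) \<in> p" "(x',K') \<in> p" "(x,K) \<noteq> (x',K')" for x K x' K'
      using p that unfolding tagged_division_of_def tagged_partial_division_of_def by blast
    \<comment> \<open>Absolute continuity is tested on sets of endpoint pairs, where repetitions
      would be lost. Two members with the same nondegenerate interval would overlap, and a
      degenerate interval determines its tag.\<close>
    have inj: "inj_on h T"
    proof (rule inj_onI)
      fix q q' assume q: "q \<in> T" "q' \<in> T" "h q = h q'"
      obtain x K x' K' where qq: "q = (x,K)" "q' = (x',K')" by (meson surj_pair)
      have P: "(x,K) \<in> p" "(x',K') \<in> p" using q qq T_def by auto
      obtain c d where cd: "K = {c..d}" "c \<le> d" "c \<le> x" "x \<le> d" using K[OF P(1)] by auto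
      obtain c' d' where cd': "K' = {c'..d'}" "c' \<le> d'" "c' \<le> x'" "x' \<le> d'" using K[OF P(2)] by auto
      have "c = c'" "d = d'" using q(3) cd cd' by (auto simp: h_def qq)
      show "q = q'"
      proof (rule ccontr)
        assume "q \<noteq> q'"
        then have "interior K \<inter> interior K' = {}" using disj P qq by blast
        then have "{c<..<d} = {}" using cd cd' \<open>c = c'\<close> \<open>d = d'\<close> by auto
        then have "c = d" using cd(2) by (simp add: greaterThanLessThan_empty_iff)
        then show False using cd cd' \<open>c = c'\<close> \<open>d = d'\<close> \<open>q \<noteq> q'\<close> qq by auto
      qed
    qed
    have sT: "(\<Sum>p\<in>h ` T. norm (g (snd p) - g (fst p))) < e"
    proof (rule D, intro conjI)
      show "finite (h ` T)" using finT by auto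
      show "h ` T \<subseteq> {(s, t). a \<le> s \<and> s \<le> t \<and> t \<le> b}"
        using K by (fastforce simp: T_def h_def)
      show "\<forall>p\<in>h ` T. \<forall>q\<in>h ` T. p \<noteq> q \<longrightarrow> {fst p<..<snd p} \<inter> {fst q<..<snd q} = {}"
      proof (intro ballI impI)
        fix r r' assume r: "r \<in> h ` T" "r' \<in> h ` T" "r \<noteq> r'"
        then obtain x K x' K' where A: "(x,K) \<in> T" "(x',K') \<in> T" "r = h (x,K)" "r' = h (x',K')"
          by auto
        have P: "(x,K) \<in> p" "(x',K') \<in> p" using A T_def by auto
        obtain c d where cd: "K = {c..d}" "c \<le> d" using K[OF P(1)] by auto
        obtain c' d' where cd': "K' = {c'..d'}" "c' \<le> d'" using K[OF P(2)] by auto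
        have "interior K \<inter> interior K' = {}" using disj P A r(3) by metis
        then show "{fst r<..<snd r} \<inter> {fst r'<..<snd r'} = {}"
          using cd cd' A by (auto simp: h_def)
      qed
      have "(\<Sum>p\<in>h ` T. snd p - fst p) = (\<Sum>q\<in>T. Sup (snd q) - Inf (snd q))"
        by (subst sum.reindex[OF inj]) (simp add: h_def)
      also have "\<dots> = (\<Sum>q\<in>T. measure lborel (snd q) *\<^sub>R indicat_real S (fst q))"
      proof (rule sum.cong)
        fix q assume "q \<in> T"
        then obtain x K where q: "q = (x,K)" "(x,K) \<in> p" "x \<in> S" by (cases q) (auto simp: T_def)
        then show "Sup (snd q) - Inf (snd q) = measure lborel (snd q) *\<^sub>R indicat_real S (fst q)"
          using K[of x K] by auto
      qed auto
      also have "\<dots> = (\<Sum>q\<in>p. measure lborel (snd q) *\<^sub>R indicat_real S (fst q))"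
        by (rule sum.mono_neutral_left) (auto simp: T_def fin)
      finally show "(\<Sum>p\<in>h ` T. snd p - fst p) < \<delta>"
        using \<gamma>1[of p] p fine1 by (auto simp: case_prod_unfold)
    qed
    have "g b - g a = (\<Sum>q\<in>p. g (Sup (snd q)) - g (Inf (snd q)))"
      using additive_tagged_division_1[OF ab p, of g] by (simp add: case_prod_unfold)
    also have "\<dots> = (\<Sum>q\<in>T. g (Sup (snd q)) - g (Inf (snd q))) + (\<Sum>q\<in>p - T. g (Sup (snd q)) - g (Inf (snd q)))"
      using fin by (subst sum.subset_diff[of T p]) (auto simp: T_def)
    also have "(\<Sum>q\<in>T. g (Sup (snd q)) - g (Inf (snd q))) \<le> e"
    proof -
      have "(\<Sum>q\<in>T. g (Sup (snd q)) - g (Inf (snd q))) \<le> (\<Sum>q\<in>T. norm (g (Sup (snd q)) - g (Inf (snd q))))"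
        by (rule sum_mono) auto
      also have "\<dots> = (\<Sum>p\<in>h ` T. norm (g (snd p) - g (fst p)))"
        by (subst sum.reindex[OF inj]) (simp add: h_def)
      finally show ?thesis using sT by linarith
    qed
    also have "(\<Sum>q\<in>p - T. g (Sup (snd q)) - g (Inf (snd q))) \<le> (\<Sum>q\<in>p - T. e * (Sup (snd q) - Inf (snd q)))"
    proof (rule sum_mono)
      fix q assume "q \<in> p - T"
      then obtain x K where q: "q = (x,K)" "(x,K) \<in> p" "x \<notin> S" by (cases q) (auto simp: T_def)
      obtain c c' where c: "K = {c..c'}" "c \<le> c'" "a \<le> c" "c' \<le> b" "c \<le> x" "x \<le> c'" using K[OF q(2)] by auto
      have x: "x \<in> {a..b} - S" using c q by auto
      have "K \<subseteq> \<gamma>2 x" using fine2 q by (auto simp: fine_def)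
      then have "K \<subseteq> ball x (d x / 2)" using x by (simp add: \<gamma>2_def)
      moreover have "c \<in> K" "c' \<in> K" using c by auto
      ultimately have "c \<in> ball x (d x / 2)" "c' \<in> ball x (d x / 2)" by blast+
      then have "c' - c < d x" by (auto simp: dist_real_def abs_real_def split: if_splits)
      then show "g (Sup (snd q)) - g (Inf (snd q)) \<le> e * (Sup (snd q) - Inf (snd q))"
        using d(2)[OF x] c q by auto
    qed
    also have "\<dots> \<le> (\<Sum>q\<in>p. e * (Sup (snd q) - Inf (snd q)))"
    proof (rule sum_mono2)
      show "0 \<le> e * (Sup (snd q) - Inf (snd q))" if qp: "q \<in> p - (p - T)" for q
      proof -
        obtain x K where q: "q = (x,K)" "(x,K) \<in> p" using qp by (cases q) auto
        show ?thesis using K[OF q(2)] q e by auto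
      qed
    qed (use fin in auto)
    also have "\<dots> = e * (b - a)"
      unfolding sum_distrib_left[symmetric]
      using additive_tagged_division_1[OF ab p, of "\<lambda>x. x"] by (simp add: case_prod_unfold)
    finally show ?thesis by simp
  qed
  show ?thesis
  proof (rule field_le_epsilon)
    fix e :: real assume "e > 0"
    then have "g b - g a \<le> e / (b - a + 1) * (b - a) + e / (b - a + 1)" using main[of "e / (b - a + 1)"] ab by simp
    also have "\<dots> = e / (b - a + 1) * (b - a + 1)" by (simp only: distrib_left mult_1_right)
    also have "\<dots> = e" using ab by simp
    finally show "g b \<le> g a + e" by simp
  qed
qed

text \<open>Serves functions of time and \<open>x t\<close> that are Lipschitz in both and, with
  constant \<open>x\<close>, Lipschitz functions of time alone.\<close>

lemma AC_compose:
  fixes g :: "real \<Rightarrow> 'b::real_normed_vector"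
  assumes AC: "abs_continuous_on_interval a b x" and C: "C > 0"
    and g: "\<And>s t. a \<le> s \<Longrightarrow> s \<le> t \<Longrightarrow> t \<le> b \<Longrightarrow> norm (g t - g s) \<le> C * (norm (x t - x s) + (t - s))"
  shows "abs_continuous_on_interval a b g"
  unfolding abs_continuous_on_interval_def
proof (intro allI impI)
  fix e :: real assume e: "e > 0"
  have "e / (2 * C) > 0" using e C by simp
  then obtain \<delta> where \<delta>: "\<delta> > 0" and D: "\<And>D. finite D \<and> D \<subseteq> {(s, t). a \<le> s \<and> s \<le> t \<and> t \<le> b} \<and>
        (\<forall>p\<in>D. \<forall>q\<in>D. p \<noteq> q \<longrightarrow> {fst p<..<snd p} \<inter> {fst q<..<snd q} = {}) \<and>
        (\<Sum>p\<in>D. snd p - fst p) < \<delta> \<Longrightarrow> (\<Sum>p\<in>D. norm (x (snd p) - x (fst p))) < e / (2 * C)"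
    using AC unfolding abs_continuous_on_interval_def by blast
  show "\<exists>\<delta>>0. \<forall>D. finite D \<and> D \<subseteq> {(s, t). a \<le> s \<and> s \<le> t \<and> t \<le> b} \<and>
        (\<forall>p\<in>D. \<forall>q\<in>D. p \<noteq> q \<longrightarrow> {fst p<..<snd p} \<inter> {fst q<..<snd q} = {}) \<and>
        (\<Sum>p\<in>D. snd p - fst p) < \<delta> \<longrightarrow> (\<Sum>p\<in>D. norm (g (snd p) - g (fst p))) < e"
  proof (intro exI[of _ "min \<delta> (e / (2 * C))"] conjI allI impI)
    show "min \<delta> (e / (2 * C)) > 0" using \<delta> \<open>e / (2 * C) > 0\<close> by simp
    fix D assume H: "finite D \<and> D \<subseteq> {(s, t). a \<le> s \<and> s \<le> t \<and> t \<le> b} \<and>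
        (\<forall>p\<in>D. \<forall>q\<in>D. p \<noteq> q \<longrightarrow> {fst p<..<snd p} \<inter> {fst q<..<snd q} = {}) \<and>
        (\<Sum>p\<in>D. snd p - fst p) < min \<delta> (e / (2 * C))"
    have 1: "(\<Sum>p\<in>D. norm (x (snd p) - x (fst p))) < e / (2 * C)" using D[of D] H by auto
    have "(\<Sum>p\<in>D. norm (g (snd p) - g (fst p))) \<le> (\<Sum>p\<in>D. C * (norm (x (snd p) - x (fst p)) + (snd p - fst p)))"
      using H by (intro sum_mono g) auto
    also have "\<dots> = C * ((\<Sum>p\<in>D. norm (x (snd p) - x (fst p))) + (\<Sum>p\<in>D. snd p - fst p))"
      by (simp add: sum_distrib_left[symmetric] sum.distrib)
    also have "\<dots> < C * (e / (2 * C) + e / (2 * C))"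
      using 1 H C by (intro mult_strict_left_mono add_strict_mono) auto
    also have "\<dots> = e" using C by (simp add: field_simps)
    finally show "(\<Sum>p\<in>D. norm (g (snd p) - g (fst p))) < e" .
  qed
qed

lemma AC_of_Lipschitz:
  fixes g :: "real \<Rightarrow> 'b::real_normed_vector"
  assumes g: "\<And>s t. a \<le> s \<Longrightarrow> s \<le> t \<Longrightarrow> t \<le> b \<Longrightarrow> norm (g t - g s) \<le> C * (t - s)"
  shows "abs_continuous_on_interval a b g"
proof (rule AC_compose[where x = "\<lambda>_. 0::real" and C = "\<bar>C\<bar> + 1"])
  show "abs_continuous_on_interval a b (\<lambda>_. 0::real)"
    unfolding abs_continuous_on_interval_def by (auto intro: exI[of _ 1])
  fix s t assume st: "a \<le> s" "s \<le> t" "t \<le> b"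
  show "norm (g t - g s) \<le> (\<bar>C\<bar> + 1) * (norm (0 - 0::real) + (t - s))"
    using order_trans[OF g[OF st] mult_right_mono[of C "\<bar>C\<bar> + 1" "t - s"]] st by simp
qed auto

lemma AC_continuous:
  fixes g :: "real \<Rightarrow> 'b::real_normed_vector"
  assumes AC: "abs_continuous_on_interval a b g"
  shows "continuous_on {a..b} g"
  unfolding continuous_on_iff
proof (intro ballI allI impI)
  fix t e :: real assume t: "t \<in> {a..b}" and e: "e > 0"
  obtain \<delta> where \<delta>: "\<delta> > 0" and D: "\<And>D. finite D \<and> D \<subseteq> {(s, t). a \<le> s \<and> s \<le> t \<and> t \<le> b} \<and>
        (\<forall>p\<in>D. \<forall>q\<in>D. p \<noteq> q \<longrightarrow> {fst p<..<snd p} \<inter> {fst q<..<snd q} = {}) \<and>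
        (\<Sum>p\<in>D. snd p - fst p) < \<delta> \<Longrightarrow> (\<Sum>p\<in>D. norm (g (snd p) - g (fst p))) < e"
    using AC e unfolding abs_continuous_on_interval_def by blast
  show "\<exists>d>0. \<forall>x'\<in>{a..b}. dist x' t < d \<longrightarrow> dist (g x') (g t) < e"
  proof (intro exI[of _ \<delta>] conjI ballI impI \<delta>)
    fix s assume s: "s \<in> {a..b}" "dist s t < \<delta>"
    have "(\<Sum>p\<in>{(min s t, max s t)}. norm (g (snd p) - g (fst p))) < e"
      using s t by (intro D) (auto simp: dist_real_def)
    then show "dist (g s) (g t) < e"
      by (cases "s \<le> t") (auto simp: dist_norm norm_minus_commute min_def max_def)
  qed
qed

section \<open>Complex norms and a criterion for exponential stability\<close>

text \<open>Complex homogeneity makes the unit sphere invariant under phases; this is why curves can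
  be studied up to complex lines. Nonnegativity follows from the two axioms.\<close>

definition cseminorm :: "(complex^2 \<Rightarrow> real) \<Rightarrow> bool" where
  "cseminorm v \<longleftrightarrow> (\<forall>x y. v (x + y) \<le> v x + v y) \<and> (\<forall>c x. v (c *s x) = cmod c * v x)"

definition cnorm :: "(complex^2 \<Rightarrow> real) \<Rightarrow> bool" where
  "cnorm v \<longleftrightarrow> cseminorm v \<and> (\<forall>x. v x = 0 \<longrightarrow> x = 0)"

lemma scaleR_eq_smult: "r *\<^sub>R (x::complex^'n) = complex_of_real r *s x"
  by (simp add: vec_eq_iff scaleR_conv_of_real[where 'a=complex])

lemma cseminorm_triangle: "cseminorm v \<Longrightarrow> v (x + y) \<le> v x + v y"
  and cseminorm_smult: "cseminorm v \<Longrightarrow> v (c *s x) = cmod c * v x"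
  by (auto simp: cseminorm_def)

lemma cseminorm_scaleR: "cseminorm v \<Longrightarrow> v (r *\<^sub>R x) = \<bar>r\<bar> * v x"
  by (simp add: scaleR_eq_smult cseminorm_smult)

lemma cseminorm_0: "cseminorm v \<Longrightarrow> v 0 = 0"
  using cseminorm_scaleR[of v 0 0] by simp

lemma cseminorm_minus: "cseminorm v \<Longrightarrow> v (- x) = v x"
  using cseminorm_scaleR[of v "-1" x] by simp

lemma cseminorm_diff: "cseminorm v \<Longrightarrow> v (x - y) \<le> v x + v y"
  using cseminorm_triangle[of v x "- y"] by (simp add: cseminorm_minus)

lemma cseminorm_abs_diff: "cseminorm v \<Longrightarrow> \<bar>v x - v y\<bar> \<le> v (x - y)"
  using cseminorm_triangle[of v "x - y" y] cseminorm_triangle[of v "y - x" x] cseminorm_minus[of v "x - y"]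
  by simp

lemma cseminorm_nonneg: "cseminorm v \<Longrightarrow> 0 \<le> v x"
  using cseminorm_triangle[of v x "- x"] by (simp add: cseminorm_minus cseminorm_0)

lemma cseminorm_sum: "cseminorm v \<Longrightarrow> v (sum f I) \<le> (\<Sum>i\<in>I. v (f i))"
proof (induction I rule: infinite_finite_induct)
  case (insert i I)
  then show ?case using cseminorm_triangle[of v "f i" "sum f I"] by simp
qed (auto simp: cseminorm_0)

lemma cseminorm_convex:
  assumes v: "cseminorm v" and c: "\<And>i. i \<in> I \<Longrightarrow> 0 \<le> c i" and b: "\<And>i. i \<in> I \<Longrightarrow> v (f i) \<le> b"
    and s: "sum c I = 1"
  shows "v (\<Sum>i\<in>I. c i *\<^sub>R f i) \<le> b"
proof -
  have "v (\<Sum>i\<in>I. c i *\<^sub>R f i) \<le> (\<Sum>i\<in>I. v (c i *\<^sub>R f i))" by (rule cseminorm_sum[OF v])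
  also have "\<dots> \<le> (\<Sum>i\<in>I. c i * b)"
    using c b by (intro sum_mono) (simp add: cseminorm_scaleR[OF v] mult_left_mono)
  also have "\<dots> = b" using s by (simp add: sum_distrib_right[symmetric])
  finally show ?thesis .
qed

lemma vec2_expand: "(x::complex^2) = x$1 *s axis 1 1 + x$2 *s axis 2 1"
  by (simp add: vec_eq_iff forall_2 axis_def)

lemma cseminorm_bounded:
  assumes "cseminorm v" obtains L where "L > 0" "\<And>x. v x \<le> L * norm x"
proof
  let ?L = "v (axis 1 1) + v (axis 2 1) + 1"
  show "?L > 0" using cseminorm_nonneg[OF assms, of "axis 1 1"] cseminorm_nonneg[OF assms, of "axis 2 1"] by linarith
  fix x :: "complex^2"
  have "v x \<le> v (x$1 *s axis 1 1) + v (x$2 *s axis 2 1)"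
    using cseminorm_triangle[OF assms, of "x$1 *s axis 1 1" "x$2 *s axis 2 1"] vec2_expand[of x] by simp
  also have "\<dots> = cmod (x$1) * v (axis 1 1) + cmod (x$2) * v (axis 2 1)"
    by (simp add: cseminorm_smult[OF assms])
  also have "\<dots> \<le> norm x * v (axis 1 1) + norm x * v (axis 2 1)"
    by (intro add_mono mult_right_mono Finite_Cartesian_Product.norm_nth_le cseminorm_nonneg[OF assms])
  also have "\<dots> \<le> ?L * norm x" by (simp add: algebra_simps)
  finally show "v x \<le> ?L * norm x" .
qed

lemma cseminorm_continuous:
  assumes "cseminorm v" shows "continuous_on S v"
proof -
  obtain L where L: "L > 0" "\<And>x. v x \<le> L * norm x" using cseminorm_bounded[OF assms] by blast
  have "L-lipschitz_on S v"
    using L cseminorm_abs_diff[OF assms] by (intro lipschitz_onI) (auto simp: dist_norm intro: order_trans)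
  then show ?thesis by (rule lipschitz_on_continuous_on)
qed

lemma cnorm_lower:
  assumes "cnorm v" obtains c where "c > 0" "\<And>x. c * norm x \<le> v x"
proof -
  have v: "cseminorm v" and d: "\<And>x. v x = 0 \<Longrightarrow> x = 0" using assms by (auto simp: cnorm_def)
  have ne: "sphere (0::complex^2) 1 \<noteq> {}"
    by (simp add: sphere_empty)
  obtain x0 where x0: "x0 \<in> sphere 0 1" "\<And>x. x \<in> sphere 0 1 \<Longrightarrow> v x0 \<le> v x"
    using continuous_attains_inf[OF compact_sphere ne cseminorm_continuous[OF v]] by blast
  have "v x0 > 0" using d[of x0] x0(1) cseminorm_nonneg[OF v, of x0] by force
  moreover have "v x0 * norm x \<le> v x" for x
  proof (cases "x = 0")
    case False
    then have "v x0 \<le> v ((1 / norm x) *\<^sub>R x)" by (intro x0(2)) simp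
    then show ?thesis using False by (simp add: cseminorm_scaleR[OF v] field_simps)
  qed (simp add: cseminorm_0[OF v])
  ultimately show ?thesis using that by blast
qed

text \<open>Convexity of \<open>v\<close> extends the contraction from Euler steps of size
  \<open>h\<close> to all smaller steps and to all convex combinations of the \<open>A i\<close>.
  Hence \<open>exp (- r * t) * v (x t)\<close> has no positive slope almost everywhere and, being
  absolutely continuous, does not increase.\<close>

lemma GUES_criterion:
  assumes v: "cnorm v" and h: "h > 0" and r: "r < 0"
    and le: "\<And>i x. i < N \<Longrightarrow> v (x + h *\<^sub>R (A i *v x)) \<le> (1 + h * r) * v x"
  shows "GUES N A"
proof -
  have sv: "cseminorm v" using v by (simp add: cnorm_def)
  note tri = cseminorm_triangle[OF sv] and nn = cseminorm_nonneg[OF sv] and sR = cseminorm_scaleR[OF sv]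
  obtain L where L: "L > 0" "\<And>x. v x \<le> L * norm x" using cseminorm_bounded[OF sv] by blast
  obtain c where c: "c > 0" "\<And>x. c * norm x \<le> v x" using cnorm_lower[OF v] by blast
  have conv: "v (x + s *\<^sub>R (A i *v x)) \<le> (1 + s * r) * v x" if "i < N" "0 \<le> s" "s \<le> h" for i s x
  proof -
    have "x + s *\<^sub>R (A i *v x) = (1 - s / h) *\<^sub>R x + (s / h) *\<^sub>R (x + h *\<^sub>R (A i *v x))"
      using h by (simp add: algebra_simps)
    then have "v (x + s *\<^sub>R (A i *v x)) \<le> (1 - s / h) * v x + (s / h) * v (x + h *\<^sub>R (A i *v x))"
      using tri[of "(1 - s / h) *\<^sub>R x" "(s / h) *\<^sub>R (x + h *\<^sub>R (A i *v x))"] that h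
      by (simp add: sR divide_le_eq)
    also have "\<dots> \<le> (1 - s / h) * v x + (s / h) * ((1 + h * r) * v x)"
      using le[OF that(1)] that h by (intro add_left_mono mult_left_mono) auto
    also have "\<dots> = (1 + s * r) * v x" using h by (simp add: field_simps)
    finally show ?thesis .
  qed
  have convB: "v (x + s *\<^sub>R (\<Sum>i<N. w i *\<^sub>R (A i *v x))) \<le> (1 + s * r) * v x"
    if "0 \<le> s" "s \<le> h" "\<And>i. i < N \<Longrightarrow> 0 \<le> w i" "(\<Sum>i<N. w i) = 1" for s x w
  proof -
    have "x + s *\<^sub>R (\<Sum>i<N. w i *\<^sub>R (A i *v x)) = (\<Sum>i<N. w i *\<^sub>R (x + s *\<^sub>R (A i *v x)))"
      using that(4) by (simp add: scaleR_add_right sum.distrib scaleR_sum_right scaleR_left.sum[symmetric] mult.commute)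
    then show ?thesis
      using cseminorm_convex[OF sv, of "{..<N}" w "\<lambda>i. x + s *\<^sub>R (A i *v x)"] that conv by simp
  qed
  have main: "v (x b) \<le> exp (r * b) * v (x 0)" if tr: "trajectory_with N A u x" and b: "b \<ge> 0" for x u b
  proof -
    define g where "g t = exp (- r * t) * v (x t)" for t
    have ACx: "abs_continuous_on_interval 0 b x"
      using tr b by (auto simp: trajectory_with_def abs_continuous_on_halfline_def)
    have "bounded (x ` {0..b})"
      using compact_continuous_image[OF AC_continuous[OF ACx]] compact_imp_bounded by blast
    then obtain X where X: "X > 0" "\<And>t. t \<in> {0..b} \<Longrightarrow> norm (x t) \<le> X" by (auto simp: bounded_pos)
    define E where "E = exp (- r * b)"
    have E: "E > 0" by (simp add: E_def)
    have expLip: "\<bar>exp (- r * t) - exp (- r * s)\<bar> \<le> (- r * E) * (t - s)" if "0 \<le> s" "s \<le> t" "t \<le> b" for s t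
    proof (cases "s = t")
      case False
      have ex: "\<exists>z>s. z < t \<and> exp (- r * t) - exp (- r * s) = (t - s) * (- r * exp (- r * z))"
        using False that by (intro MVT2) (auto intro!: derivative_eq_intros)
      obtain z where z: "s < z" "z < t" "exp (- r * t) - exp (- r * s) = (t - s) * (- r * exp (- r * z))"
        using ex by blast
      have "exp (- r * z) \<le> E" using z that r by (simp add: E_def mult_left_mono_neg)
      then have "\<bar>exp (- r * t) - exp (- r * s)\<bar> \<le> (t - s) * (- r * E)"
        unfolding z(3) using that r by (simp add: abs_mult mult_left_mono)
      then show ?thesis by (simp add: mult.commute)
    qed auto
    have expE: "0 < exp (- r * t)" "exp (- r * t) \<le> E" if "t \<le> b" for t
      using that r by (auto simp: E_def mult_left_mono_neg)
    have vb: "v (x t) \<le> L * X" if "t \<in> {0..b}" for t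
      using L(2)[of "x t"] X(2)[OF that] L(1) by (meson mult_left_mono less_imp_le order_trans)
    have dv: "\<bar>v (x t) - v (x s)\<bar> \<le> L * norm (x t - x s)" for s t
      using cseminorm_abs_diff[OF sv] L(2) order_trans by blast
    have "abs_continuous_on_interval 0 b g"
    proof (rule AC_compose[OF ACx])
      show "0 < E * L + (- r * E) * (L * X)" using E L r X by (intro add_pos_pos mult_pos_pos) auto
      fix s t assume st: "0 \<le> s" "s \<le> t" "t \<le> b"
      have "g t - g s = exp (- r * t) * (v (x t) - v (x s)) + (exp (- r * t) - exp (- r * s)) * v (x s)"
        by (simp add: g_def algebra_simps)
      then have "norm (g t - g s) \<le> exp (- r * t) * \<bar>v (x t) - v (x s)\<bar> + \<bar>exp (- r * t) - exp (- r * s)\<bar> * v (x s)"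
        using abs_triangle_ineq[of "exp (- r * t) * (v (x t) - v (x s))" "(exp (- r * t) - exp (- r * s)) * v (x s)"]
          nn[of "x s"] by (simp add: abs_mult)
      also have "\<dots> \<le> E * (L * norm (x t - x s)) + ((- r * E) * (t - s)) * (L * X)"
        proof (rule add_mono)
        show "exp (- r * t) * \<bar>v (x t) - v (x s)\<bar> \<le> E * (L * norm (x t - x s))"
          using dv[of t s] expE(2)[OF st(3)] E by (intro mult_mono) auto
        have "0 \<le> - r * E * (t - s)" using expLip[OF st] by linarith
        then show "\<bar>exp (- r * t) - exp (- r * s)\<bar> * v (x s) \<le> - r * E * (t - s) * (L * X)"
          using expLip[OF st] vb[of s] nn[of "x s"] st by (intro mult_mono) auto
      qed
      also have "\<dots> \<le> (E * L + (- r * E) * (L * X)) * (norm (x t - x s) + (t - s))"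
      proof -
        have "0 \<le> E * L * (t - s)" "0 \<le> (- r * E) * (L * X) * norm (x t - x s)"
          using E L r X st by (auto intro!: mult_nonneg_nonneg simp: mult_nonpos_nonneg)
        then show ?thesis by (simp add: algebra_simps)
      qed
      finally show "norm (g t - g s) \<le> (E * L + (- r * E) * (L * X)) * (norm (x t - x s) + (t - s))" .
    qed
    moreover obtain S where S: "negligible S" and Sd: "\<And>t. t \<notin> S \<Longrightarrow> t \<ge> 0 \<Longrightarrow> (\<Sum>i<N. u i t) = 1 \<and>
        (x has_vector_derivative (\<Sum>i<N. u i t *\<^sub>R (A i *v x t))) (at t within {0..})"
    proof -
      have "AE t in lebesgue. t \<ge> 0 \<longrightarrow> (\<Sum>i<N. u i t) = 1 \<and>
        (x has_vector_derivative (\<Sum>i<N. u i t *\<^sub>R (A i *v x t))) (at t within {0..})"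
        using tr by (auto simp: trajectory_with_def switching_law_def elim: eventually_elim2)
      then obtain S where "S \<in> null_sets lebesgue" "{t. \<not> (t \<ge> 0 \<longrightarrow> (\<Sum>i<N. u i t) = 1 \<and>
        (x has_vector_derivative (\<Sum>i<N. u i t *\<^sub>R (A i *v x t))) (at t within {0..}))} \<subseteq> S"
        unfolding eventually_ae_filter by auto
      then show ?thesis using that[of S] by (auto simp: negligible_iff_null_sets)
    qed
    ultimately have "g b \<le> g 0"
    proof (intro AC_nonincreasing[OF b])
      fix t e :: real assume t: "t \<in> {0..b} - S" and e: "e > 0"
      have u: "\<And>i. i < N \<Longrightarrow> 0 \<le> u i t" "(\<Sum>i<N. u i t) = 1"
        using tr t Sd[of t] by (auto simp: trajectory_with_def switching_law_def)
      define y where "y = (\<Sum>i<N. u i t *\<^sub>R (A i *v x t))"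
      have y: "(x has_vector_derivative y) (at t within {0..})" using Sd[of t] t by (simp add: y_def)
      have EL: "E * L > 0" using E L by simp
      have "e / (2 * (E * L)) > 0" using e EL by simp
      then obtain d0 where d0: "d0 > 0" "\<And>w. w \<ge> 0 \<Longrightarrow> \<bar>w - t\<bar> < d0 \<Longrightarrow>
          norm (x w - x t - (w - t) *\<^sub>R y) \<le> e / (2 * (E * L)) * \<bar>w - t\<bar>"
        using y unfolding has_vector_derivative_def has_derivative_within_alt by auto
      have Vnn: "0 \<le> v (x t)" by (rule nn)
      \<comment> \<open>The four bounds serve, in this order, the remainder of the derivative,
        \<open>w \<le> 1\<close> in the exponential estimate, the range of \<open>convB\<close>, and
        the quadratic term \<open>w\<^sup>2 * v (x t)\<close>.\<close>
      define d where "d = min d0 (min (1 / (- r)) (min h (e / (2 * (E * v (x t) * r\<^sup>2 + 1)))))"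
      have "E * v (x t) * r\<^sup>2 \<ge> 0" using E Vnn by simp
      then have d: "d > 0" using d0 r e h by (auto simp: d_def intro!: divide_pos_pos)
      show "\<exists>d>0. \<forall>s u. 0 \<le> s \<and> s \<le> t \<and> t \<le> u \<and> u \<le> b \<and> u - s < d \<longrightarrow> g u - g s \<le> e * (u - s)"
      proof (intro exI[of _ d] conjI d allI impI, elim conjE)
        fix s q :: real assume sq: "0 \<le> s" "s \<le> t" "t \<le> q" "q \<le> b" "q - s < d"
        have rem: "v (x w - x t - (w - t) *\<^sub>R y) \<le> e / (2 * E) * \<bar>w - t\<bar>" if "s \<le> w" "w \<le> q" for w
        proof -
          have "v (x w - x t - (w - t) *\<^sub>R y) \<le> L * (e / (2 * (E * L)) * \<bar>w - t\<bar>)"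
            using d0(2)[of w] sq that L(1) by (intro order_trans[OF L(2)] mult_left_mono) (auto simp: d_def)
          then show ?thesis using L(1) by (simp add: field_simps)
        qed
        have "v (x q) \<le> v (x t + (q - t) *\<^sub>R y) + v (x q - x t - (q - t) *\<^sub>R y)"
          using tri[of "x t + (q - t) *\<^sub>R y" "x q - x t - (q - t) *\<^sub>R y"] by simp
        also have "v (x t + (q - t) *\<^sub>R y) \<le> (1 + (q - t) * r) * v (x t)"
          unfolding y_def using sq u by (intro convB) (auto simp: d_def)
        also have "(1 + (q - t) * r) * v (x t) \<le> exp (r * (q - t)) * v (x t)"
          using exp_ge_add_one_self[of "r * (q - t)"] Vnn by (intro mult_right_mono) (auto simp: mult.commute)
        finally have "v (x q) \<le> exp (r * (q - t)) * v (x t) + e / (2 * E) * (q - t)"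
          using rem[of q] sq by simp
        then have "g q \<le> exp (- r * q) * (exp (r * (q - t)) * v (x t) + e / (2 * E) * (q - t))"
          unfolding g_def by (intro mult_left_mono) auto
        also have "\<dots> = exp (- r * t) * v (x t) + exp (- r * q) * (e / (2 * E) * (q - t))"
        proof -
          have "exp (- r * q) * exp (r * (q - t)) = exp (- r * t)"
            unfolding exp_add[symmetric] by (simp add: algebra_simps)
          then show ?thesis by (simp add: distrib_left mult.assoc[symmetric])
        qed
        also have "\<dots> \<le> exp (- r * t) * v (x t) + E * (e / (2 * E) * (q - t))"
          using sq e E expE by (intro add_left_mono mult_right_mono) auto
        finally have up: "g q \<le> exp (- r * t) * v (x t) + e / 2 * (q - t)" using E by simp
        define w where "w = - r * (t - s)"
        have "t - s \<le> 1 / (- r)" using sq by (auto simp: d_def)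
        then have w: "0 \<le> w" "w \<le> 1" using sq r by (auto simp: w_def mult_nonpos_nonneg field_simps)
        \<comment> \<open>Going backwards there is no contraction estimate; instead
          \<open>x t\<close> is the midpoint of a forward and a backward step, and the forward one
          is already contracted.\<close>
        have "2 * v (x t) \<le> v (x t + (t - s) *\<^sub>R y) + v (x t - (t - s) *\<^sub>R y)"
          using tri[of "x t + (t - s) *\<^sub>R y" "x t - (t - s) *\<^sub>R y"] sR[of 2 "x t"] by (simp add: scaleR_2)
        moreover have "v (x t + (t - s) *\<^sub>R y) \<le> (1 + (t - s) * r) * v (x t)"
          unfolding y_def using sq u by (intro convB) (auto simp: d_def)
        moreover have "v (x t - (t - s) *\<^sub>R y) \<le> v (x s) + v (x s - x t - (s - t) *\<^sub>R y)"
        proof -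
          have "x t - (t - s) *\<^sub>R y = x s - (x s - x t - (s - t) *\<^sub>R y)" by (simp add: algebra_simps)
          then show ?thesis using cseminorm_diff[OF sv, of "x s" "x s - x t - (s - t) *\<^sub>R y"] by (simp only:)
        qed
        ultimately have "(1 + w) * v (x t) - e / (2 * E) * (t - s) \<le> v (x s)"
          using rem[of s] sq by (simp add: w_def algebra_simps)
        moreover have "exp w - w\<^sup>2 \<le> 1 + w" using exp_bound[OF w] by simp
        then have "(exp w - w\<^sup>2) * v (x t) \<le> (1 + w) * v (x t)" using Vnn by (rule mult_right_mono)
        ultimately have "(exp w - w\<^sup>2) * v (x t) - e / (2 * E) * (t - s) \<le> v (x s)" by linarith
        then have "exp (- r * s) * ((exp w - w\<^sup>2) * v (x t) - e / (2 * E) * (t - s)) \<le> g s"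
          unfolding g_def by (intro mult_left_mono) auto
        also have "exp (- r * s) * ((exp w - w\<^sup>2) * v (x t) - e / (2 * E) * (t - s)) =
            exp (- r * t) * v (x t) - exp (- r * s) * (w\<^sup>2 * v (x t) + e / (2 * E) * (t - s))"
        proof -
          have "exp (- r * s) * exp w = exp (- r * t)"
            unfolding exp_add[symmetric] w_def by (simp add: algebra_simps)
          then have "exp (- r * t) * v (x t) = exp (- r * s) * (exp w * v (x t))" by simp
          then show ?thesis unfolding \<open>exp (- r * t) * v (x t) = _\<close> by (simp only: algebra_simps)
        qed
        finally have "exp (- r * t) * v (x t) \<le> g s + exp (- r * s) * (w\<^sup>2 * v (x t) + e / (2 * E) * (t - s))" by simp
        also have "\<dots> \<le> g s + E * (w\<^sup>2 * v (x t) + e / (2 * E) * (t - s))"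
          using sq Vnn e E expE[of s] by (intro add_left_mono mult_right_mono) auto
        also have "\<dots> = g s + (E * v (x t) * r\<^sup>2 * (t - s)) * (t - s) + e / 2 * (t - s)"
          using E by (simp add: w_def field_simps power2_eq_square)
        also have "(E * v (x t) * r\<^sup>2 * (t - s)) * (t - s) \<le> e / 2 * (t - s)"
        proof (rule mult_right_mono)
          have nn: "E * v (x t) * r\<^sup>2 \<ge> 0" using E Vnn by simp
          have "t - s \<le> e / (2 * (E * v (x t) * r\<^sup>2 + 1))" using sq by (auto simp: d_def)
          then have "E * v (x t) * r\<^sup>2 * (t - s) \<le> (E * v (x t) * r\<^sup>2 + 1) * (e / (2 * (E * v (x t) * r\<^sup>2 + 1)))"
            using nn sq by (intro mult_mono) auto
          also have "\<dots> = e / 2" using nn by (simp add: field_simps)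
          finally show "E * v (x t) * r\<^sup>2 * (t - s) \<le> e / 2" .
        qed (use sq in auto)
        finally have "exp (- r * t) * v (x t) \<le> g s + e * (t - s)" by (simp add: field_simps)
        moreover have "e / 2 * (q - t) \<le> e * (q - t)" using sq e by (intro mult_right_mono) auto
        ultimately have "g q \<le> g s + (e * (t - s) + e * (q - t))" using up by linarith
        then show "g q - g s \<le> e * (q - s)" by (simp add: algebra_simps)
      qed
    qed (use S in auto)
    then have "exp (- r * b) * v (x b) \<le> v (x 0)" by (simp add: g_def)
    then show ?thesis by (simp add: exp_minus field_simps)
  qed
  have "norm (x t) \<le> (L / c) * exp (- (- r) * t) * norm (x 0)" if "trajectory N A x" "t \<ge> 0" for x t
  proof -
    have "\<exists>u. trajectory_with N A u x" using that(1) by (simp add: trajectory_def)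
    then obtain u where "trajectory_with N A u x" by blast
    from main[OF this that(2)] have "c * norm (x t) \<le> exp (r * t) * (L * norm (x 0))"
      using c(2)[of "x t"] L(2)[of "x 0"] by (meson exp_ge_zero mult_left_mono order_trans)
    then show ?thesis using c by (simp add: field_simps)
  qed
  moreover have "L / c > 0" using L c by simp
  ultimately show ?thesis unfolding GUES_def using r by (intro exI[of _ "L/c"] exI[of _ "-r"]) auto
qed

section \<open>Densities of Lipschitz monotone functions, constant laws\<close>

text \<open>Both \<open>U\<close> and \<open>t - U t\<close> are monotone, and the sum of their
  Stieltjes measures agrees with Lebesgue measure on intervals, hence everywhere.\<close>

lemma interval_measure_le_lborel:
  fixes U :: "real \<Rightarrow> real"
  assumes mono: "\<And>s t. s \<le> t \<Longrightarrow> U s \<le> U t" and lip: "\<And>s t. s \<le> t \<Longrightarrow> U t - U s \<le> t - s"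
    and A: "A \<in> sets borel"
  shows "emeasure (interval_measure U) A \<le> emeasure lborel A"
proof -
  define V where "V t = t - U t" for t
  have monoV: "V s \<le> V t" if "s \<le> t" for s t using lip[OF that] by (simp add: V_def)
  have "1-lipschitz_on UNIV U"
  proof (rule lipschitz_onI)
    show "dist (U s) (U t) \<le> 1 * dist s t" for s t
      using mono[of s t] mono[of t s] lip[of s t] lip[of t s] by (cases "s \<le> t") (auto simp: dist_real_def)
  qed simp
  then have cU: "continuous_on UNIV U" by (rule lipschitz_on_continuous_on)
  then have cV: "continuous_on UNIV V" unfolding V_def by (intro continuous_intros)
  have rc: "continuous (at_right a) U" "continuous (at_right a) V" for a
    using cU cV by (auto simp: continuous_on_eq_continuous_at continuous_at_imp_continuous_within)
  have ioo: "emeasure (interval_measure F) {l<..<u} = ennreal (F u - F l)"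
    if "l \<le> u" "\<And>s t. s \<le> t \<Longrightarrow> F s \<le> F t" "continuous_on UNIV F" "\<And>a. continuous (at_right a) F" for l u F
  proof (cases "l = u")
    case False
    then have lu: "l < u" using that by simp
    have 0: "emeasure (interval_measure F) {u} = 0"
      using emeasure_interval_measure_Icc[of u u F] that by simp
    have "emeasure (interval_measure F) {l<..u} = emeasure (interval_measure F) ({l<..<u} \<union> {u})"
      using lu by (intro arg_cong[where f="emeasure (interval_measure F)"]) auto
    also have "\<dots> = emeasure (interval_measure F) {l<..<u} + emeasure (interval_measure F) {u}"
      by (intro plus_emeasure[symmetric]) auto
    finally show ?thesis using emeasure_interval_measure_Ioc[of l u F] that 0 by simp
  qed simp
  define M where "M = measure_of UNIV (sets borel) (\<lambda>A. emeasure (interval_measure U) A + emeasure (interval_measure V) A)"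
  have sM: "sets M = sets borel" unfolding M_def using sets.sigma_sets_eq[of borel] by (simp add: sets_measure_of_conv)
  have eM: "emeasure M B = emeasure (interval_measure U) B + emeasure (interval_measure V) B"
    if "B \<in> sets borel" for B
    unfolding M_def
  proof (rule emeasure_measure_of_sigma)
    show "sigma_algebra UNIV (sets (borel::real measure))" using sets.sigma_algebra_axioms[of "borel::real measure"] by simp
    show "positive (sets borel) (\<lambda>A. emeasure (interval_measure U) A + emeasure (interval_measure V) A)"
      by (auto simp: positive_def)
    show "countably_additive (sets borel) (\<lambda>A. emeasure (interval_measure U) A + emeasure (interval_measure V) A)"
    proof (rule countably_additiveI)
      fix B :: "nat \<Rightarrow> real set" assume B: "range B \<subseteq> sets borel" "disjoint_family B"
      show "(\<Sum>i. emeasure (interval_measure U) (B i) + emeasure (interval_measure V) (B i)) =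
          emeasure (interval_measure U) (\<Union> (range B)) + emeasure (interval_measure V) (\<Union> (range B))"
        using B by (subst suminf_add[symmetric]) (auto intro!: arg_cong2[where f="(+)"] suminf_emeasure)
    qed
  qed (rule that)
  have "lborel = M"
  proof (rule lborel_eqI)
    fix l u :: real assume "\<And>b. b \<in> Basis \<Longrightarrow> l \<bullet> b \<le> u \<bullet> b"
    then have lu: "l \<le> u" by simp
    have "emeasure M (box l u) = ennreal (U u - U l) + ennreal (V u - V l)"
      using lu mono monoV cU cV rc by (simp add: eM ioo)
    also have "\<dots> = ennreal (u - l)"
      using lu mono[of l u] monoV[of l u] by (simp add: ennreal_plus[symmetric] V_def del: ennreal_plus)
    finally show "emeasure M (box l u) = ennreal (\<Prod>b\<in>Basis. (u - l) \<bullet> b)" by simp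
  qed (use sM in simp)
  then show ?thesis using eM[OF A] by simp
qed

text \<open>The derivative arises as a Radon-Nikodym density, which is a Borel function on the whole
  line; Lebesgue differentiation identifies it with the derivative off a null set. It recovers
  switching laws from integrated controls.\<close>

lemma Lipschitz_mono_derivative:
  fixes U :: "real \<Rightarrow> real"
  assumes mono: "\<And>s t. s \<le> t \<Longrightarrow> U s \<le> U t" and lip: "\<And>s t. s \<le> t \<Longrightarrow> U t - U s \<le> t - s"
  obtains w S where "w \<in> borel_measurable borel" "\<And>t. 0 \<le> w t" "\<And>t. w t \<le> 1" "negligible S"
    "\<And>t. t \<notin> S \<Longrightarrow> (U has_real_derivative w t) (at t)"
proof -
  have "1-lipschitz_on UNIV U"
  proof (rule lipschitz_onI)
    show "dist (U s) (U t) \<le> 1 * dist s t" for s t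
      using mono[of s t] mono[of t s] lip[of s t] lip[of t s] by (cases "s \<le> t") (auto simp: dist_real_def)
  qed simp
  then have cU: "continuous_on UNIV U" by (rule lipschitz_on_continuous_on)
  have rc: "continuous (at_right a) U" for a
    using cU by (auto simp: continuous_on_eq_continuous_at continuous_at_imp_continuous_within)
  let ?M = "interval_measure U"
  define f where "f = RN_deriv lborel ?M"
  have ac: "absolutely_continuous lborel ?M" unfolding absolutely_continuous_def
  proof
    fix A :: "real set" assume "A \<in> null_sets lborel"
    then have "A \<in> sets borel" "emeasure lborel A = 0" by auto
    then show "A \<in> null_sets ?M" using interval_measure_le_lborel[OF mono lip, of A] by (auto simp: null_sets_def)
  qed
  have fm: "f \<in> borel_measurable borel" unfolding f_def by simp
  have dens: "density lborel f = ?M" unfolding f_def by (rule sigma_finite_measure.density_RN_deriv[OF sigma_finite_lborel ac]) simp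
  have fin: "AE x in lborel. f x \<noteq> \<infinity>" unfolding f_def
    by (rule sigma_finite_measure.RN_deriv_finite[OF sigma_finite_lborel sigma_finite_interval_measure[OF mono rc] ac]) simp_all
  define w0 where "w0 x = enn2real (f x)" for x
  have w0: "w0 \<in> borel_measurable borel" "\<And>x. 0 \<le> w0 x" using fm unfolding w0_def[abs_def] by auto
  have int: "(w0 has_integral (U t - U s)) {s..t}" if st: "s \<le> t" for s t
  proof -
    have "emeasure ?M {s..t} = ennreal (U t - U s)"
      using emeasure_interval_measure_Icc[of s t U] st mono cU by simp
    moreover have "emeasure ?M {s..t} = (\<integral>\<^sup>+x. f x * indicator {s..t} x \<partial>lborel)"
      unfolding dens[symmetric] using fm by (subst emeasure_density) auto
    moreover have "\<dots> = (\<integral>\<^sup>+x. ennreal (w0 x * indicator {s..t} x) \<partial>lborel)"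
    proof (rule nn_integral_cong_AE)
      show "AE x in lborel. f x * indicator {s..t} x = ennreal (w0 x * indicator {s..t} x)"
        using fin by eventually_elim (auto simp: w0_def indicator_def less_top)
    qed
    ultimately have "((\<lambda>x. w0 x * indicator {s..t} x) has_integral (U t - U s)) UNIV"
      using w0 mono[OF st] by (intro nn_integral_has_integral) auto
    also have "(\<lambda>x. w0 x * indicator {s..t} x) = (\<lambda>x. if x \<in> {s..t} then w0 x else 0)" by auto
    finally show ?thesis by (simp only: has_integral_restrict_UNIV)
  qed
  have intble: "w0 integrable_on cbox a b" for a b
    using int[of a b] by (cases "a \<le> b") (auto simp: integrable_on_def)
  \<comment> \<open>The differentiation theorem applied below yields right-hand quotients only;
    reflecting the line supplies the left-hand ones.\<close>
  have int': "((\<lambda>x. w0 (- x)) has_integral (U (- s) - U (- t))) {s..t}" if st: "s \<le> t" for s t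
    using has_integral_reflect_real[where f = w0 and i = "U (- s) - U (- t)" and a = "- t" and b = "- s"] int[of "- t" "- s"] st by simp
  have intble': "(\<lambda>x. w0 (- x)) integrable_on cbox a b" for a b
    using int'[of a b] by (cases "a \<le> b") (auto simp: integrable_on_def)
  obtain S1 where S1: "negligible S1" "\<And>x e. x \<notin> S1 \<Longrightarrow> 0 < e \<Longrightarrow>
     \<exists>d>0. \<forall>h. 0 < h \<and> h < d \<longrightarrow> norm (integral (cbox x (x + h *\<^sub>R One)) w0 /\<^sub>R h ^ DIM(real) - w0 x) < e"
    using integrable_ccontinuous_explicit[of w0] intble by blast
  obtain S2 where S2: "negligible S2" "\<And>x e. x \<notin> S2 \<Longrightarrow> 0 < e \<Longrightarrow>
     \<exists>d>0. \<forall>h. 0 < h \<and> h < d \<longrightarrow> norm (integral (cbox x (x + h *\<^sub>R One)) (\<lambda>x. w0 (- x)) /\<^sub>R h ^ DIM(real) - w0 (- x)) < e"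
    using integrable_ccontinuous_explicit[of "\<lambda>x. w0 (- x)"] intble' by blast
  define S where "S = S1 \<union> uminus ` S2"
  have "negligible (uminus ` S2)"
  proof (rule negligible_locally_Lipschitz_image[OF _ S2(1)])
    show "\<exists>T B. open T \<and> x \<in> T \<and> (\<forall>y\<in>S2 \<inter> T. norm (- y - - x) \<le> B * norm (y - x))" for x
      by (rule exI[of _ UNIV], rule exI[of _ 1]) auto
  qed simp
  then have "negligible S" unfolding S_def using S1(1) by simp
  moreover have der: "(U has_real_derivative w0 t) (at t)" if t: "t \<notin> S" for t
    unfolding has_field_derivative_iff LIM_def
  proof (intro allI impI)
    fix e :: real assume e: "e > 0"
    have t1: "t \<notin> S1" and t2: "- t \<notin> S2" using t image_eqI[of t uminus "- t" S2] by (auto simp: S_def)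
    obtain d1 where d1: "d1 > 0" "\<And>h. 0 < h \<Longrightarrow> h < d1 \<Longrightarrow> norm (integral (cbox t (t + h *\<^sub>R One)) w0 /\<^sub>R h ^ DIM(real) - w0 t) < e"
      using S1(2)[OF t1 e] by blast
    obtain d2 where d2: "d2 > 0" "\<And>h. 0 < h \<Longrightarrow> h < d2 \<Longrightarrow>
        norm (integral (cbox (- t) (- t + h *\<^sub>R One)) (\<lambda>x. w0 (- x)) /\<^sub>R h ^ DIM(real) - w0 (- (- t))) < e"
      using S2(2)[OF t2 e] by blast
    show "\<exists>s>0. \<forall>x. x \<noteq> t \<and> dist x t < s \<longrightarrow> dist ((U x - U t) / (x - t)) (w0 t) < e"
    proof (intro exI[of _ "min d1 d2"] conjI allI impI)
      show "min d1 d2 > 0" using d1 d2 by simp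
      fix x assume x: "x \<noteq> t \<and> dist x t < min d1 d2"
      show "dist ((U x - U t) / (x - t)) (w0 t) < e"
      proof (cases "x > t")
        case True
        define h where "h = x - t"
        have h: "0 < h" "h < d1" using x True by (auto simp: h_def dist_real_def)
        have "integral {t..x} w0 = U x - U t" using int[of t x] True by (simp add: integral_unique)
        then have "integral (cbox t (t + h *\<^sub>R One)) w0 /\<^sub>R h ^ DIM(real) = (U x - U t) / (x - t)"
          by (simp add: h_def divide_inverse mult.commute)
        then show ?thesis using d1(2)[OF h] by (simp add: dist_real_def)
      next
        case False
        define h where "h = t - x"
        have h: "0 < h" "h < d2" using x False by (auto simp: h_def dist_real_def)
        have "integral {- t..- x} (\<lambda>x. w0 (- x)) = U t - U x" using int'[of "- t" "- x"] x False by (simp add: integral_unique)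
        then have "integral (cbox (- t) (- t + h *\<^sub>R One)) (\<lambda>x. w0 (- x)) /\<^sub>R h ^ DIM(real) = (U t - U x) / (t - x)"
          by (simp add: h_def divide_inverse mult.commute)
        moreover have "(U t - U x) / (t - x) = (U x - U t) / (x - t)"
          using minus_divide_divide[of "U x - U t" "x - t"] by simp
        ultimately show ?thesis using d2(2)[OF h] by (simp add: dist_real_def)
      qed
    qed
  qed
  moreover have w1: "w0 t \<le> 1" if t: "t \<notin> S" for t
  proof (rule tendsto_upperbound)
    show "((\<lambda>x. (U x - U t) / (x - t)) \<longlongrightarrow> w0 t) (at t)" using der[OF t] by (simp add: has_field_derivative_iff)
    have "(U x - U t) / (x - t) \<le> 1" if "x \<noteq> t" for x
      using lip[of x t] lip[of t x] that by (cases "x < t") (auto simp: divide_le_eq)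
    then show "\<forall>\<^sub>F x in at t. (U x - U t) / (x - t) \<le> 1" by (simp add: eventually_at_filter)
  qed simp
  ultimately show ?thesis
  \<comment> \<open>The density is at most 1 only off \<open>S\<close>, whereas a switching law
    takes values in [0,1] at every time; hence the truncation.\<close>
  proof (intro that[of "\<lambda>t. min 1 (w0 t)" S])
    show "(\<lambda>t. min 1 (w0 t)) \<in> borel_measurable borel" using w0 by simp
    show "(U has_real_derivative min 1 (w0 t)) (at t)" if "t \<notin> S" for t
      using der[OF that] w1[OF that] by (simp add: min_absorb2)
  qed (use w0 in auto)
qed

lemma Lipschitz_of_derivative:
  fixes x :: "real \<Rightarrow> 'a::real_normed_vector"
  assumes "\<And>t. t \<in> {a..b} \<Longrightarrow> (x has_vector_derivative x' t) (at t within {a..b})"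
    and C: "\<And>t. t \<in> {a..b} \<Longrightarrow> norm (x' t) \<le> C" and st: "a \<le> s" "s \<le> t" "t \<le> b"
  shows "norm (x t - x s) \<le> C * (t - s)"
proof -
  have "norm (x t - x s) \<le> C * norm (t - s)"
  proof (rule differentiable_bound[of "{a..b}" x "\<lambda>t h. h *\<^sub>R x' t"])
    show "onorm (\<lambda>h. h *\<^sub>R x' r) \<le> C" if "r \<in> {a..b}" for r
      using C[OF that] by (intro onorm_le) (simp add: mult.commute[of C] mult_left_mono)
  qed (use assms in \<open>auto simp: has_vector_derivative_def\<close>)
  then show ?thesis using st by simp
qed

section \<open>Complex scalars, real scalars and matrices on C^2\<close>

lemma bounded_linear_smult: "bounded_linear (\<lambda>c. c *s (x::complex^2))"
  unfolding linear_conv_bounded_linear[symmetric]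
  by (rule linearI) (simp_all add: vec_eq_iff algebra_simps)

lemma bounded_linear_matrix: "bounded_linear ((*v) (M::complex^2^2))"
  by (rule matrix_vector_mul_bounded_linear)

lemma matrix_smult: "(M::complex^2^2) *v (c *s x) = c *s (M *v x)"
  by (simp add: vector_scalar_commute)

lemma matrix_scaleR: "(M::complex^2^2) *v (r *\<^sub>R x) = r *\<^sub>R (M *v x)"
  by (simp add: scaleR_eq_smult matrix_smult)

lemma norm_smult: "norm (c *s (x::complex^2)) = cmod c * norm x"
  by (simp add: norm_vec_def norm_mult L2_set_right_distrib[symmetric] L2_set_def sum_distrib_left[symmetric]
      power_mult_distrib real_sqrt_mult)

text \<open>An eigenvector of a convex combination of the \<open>A i\<close> gives the explicit
  trajectory \<open>exp (t *\<^sub>R \<nu>) *s x0\<close> under a constant law, and its norm does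
  not decay if \<open>Re \<nu>\<close> is nonnegative.\<close>

lemma PAS_constant:
  assumes PAS: "periodically_asymptotically_stable N A"
    and c: "\<And>i. i < N \<Longrightarrow> 0 \<le> c i" "(\<Sum>i<N. c i) = 1"
    and x0: "x0 \<noteq> 0" "(\<Sum>i<N. c i *\<^sub>R (A i *v x0)) = \<nu> *s x0"
  shows "Re \<nu> < 0"
proof (rule ccontr)
  assume "\<not> Re \<nu> < 0"
  then have \<nu>: "Re \<nu> \<ge> 0" by simp
  define x where "x t = exp (t *\<^sub>R \<nu>) *s x0" for t :: real
  have der: "(x has_vector_derivative \<nu> *s x t) (at t within T)" for t T
    using bounded_linear.has_vector_derivative[OF bounded_linear_smult[of x0]
        exp_scaleR_has_vector_derivative_right[of \<nu> t T]]
    by (simp add: x_def[abs_def] mult.commute)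
  have nx: "norm (x t) = exp (t * Re \<nu>) * norm x0" for t
    by (simp add: x_def norm_smult)
  have "trajectory_with N A (\<lambda>i t. c i) x"
    unfolding trajectory_with_def
  proof (intro conjI)
    have "c i \<le> 1" if "i < N" for i
      using c member_le_sum[of i "{..<N}" c] that by simp
    then show "switching_law N (\<lambda>i t. c i)" using c by (simp add: switching_law_def)
    show "abs_continuous_on_halfline x" unfolding abs_continuous_on_halfline_def
    proof (intro allI impI AC_of_Lipschitz)
      fix b s t :: real assume b: "b \<ge> 0" and st: "0 \<le> s" "s \<le> t" "t \<le> b"
      show "norm (x t - x s) \<le> (cmod \<nu> * (exp (b * Re \<nu>) * norm x0)) * (t - s)"
      proof (rule Lipschitz_of_derivative[OF der _ st])
        fix t assume "t \<in> {0..b}"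
        then have "exp (t * Re \<nu>) \<le> exp (b * Re \<nu>)" using \<nu> by (simp add: mult_right_mono)
        then show "norm (\<nu> *s x t) \<le> cmod \<nu> * (exp (b * Re \<nu>) * norm x0)"
          unfolding norm_smult nx by (intro mult_left_mono mult_right_mono) auto
      qed
    qed
    have "(\<Sum>i<N. c i *\<^sub>R (A i *v x t)) = \<nu> *s x t" for t
    proof -
      have "(\<Sum>i<N. c i *\<^sub>R (A i *v x t)) = exp (t *\<^sub>R \<nu>) *s (\<Sum>i<N. c i *\<^sub>R (A i *v x0))"
        by (simp add: x_def matrix_smult vec.scale_sum_right scaleR_eq_smult vector_smult_assoc mult.commute)
      then show ?thesis by (simp add: x0 x_def vector_smult_assoc mult.commute)
    qed
    then show "AE t in lebesgue. t \<ge> 0 \<longrightarrow> (x has_vector_derivative (\<Sum>i<N. c i *\<^sub>R (A i *v x t))) (at t within {0..})"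
      using der by simp
  qed
  moreover have "constant_law N (\<lambda>i t. c i)" by (simp add: constant_law_def)
  ultimately have "(x \<longlongrightarrow> 0) at_top" using PAS unfolding periodically_asymptotically_stable_def by blast
  then have "\<forall>\<^sub>F t in at_top. norm (x t) < norm x0" using x0(1)
    by (auto simp: tendsto_iff)
  moreover have "\<forall>\<^sub>F t in at_top. (t::real) \<ge> 0" by (rule eventually_ge_at_top)
  ultimately have "\<forall>\<^sub>F t::real in at_top. False"
  proof eventually_elim
    case (elim t)
    have "1 * norm x0 \<le> norm (x t)" unfolding nx using elim \<nu> by (intro mult_right_mono) auto
    then show ?case using elim by simp
  qed
  then show False by simp
qed

section \<open>Extremal trajectories\<close>

(* U i is the integral of the i-th control. Working with integrated controls keeps the class of
   trajectories closed under pointwise limits; the controls themselves are recovered as densities. *)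
definition controls :: "nat \<Rightarrow> (nat \<Rightarrow> real \<Rightarrow> real) \<Rightarrow> bool" where
  "controls N U \<longleftrightarrow> (\<forall>i<N. \<forall>s t. s \<le> t \<longrightarrow> U i s \<le> U i t) \<and> (\<forall>s t. (\<Sum>i<N. U i t - U i s) = t - s)"

text \<open>A differential equation in expanded form: a quadratic remainder with one constant
  \<open>K\<close> for all times survives pointwise limits, and where all \<open>U i\<close> are
  differentiable it returns the equation itself.\<close>

definition driven :: "nat \<Rightarrow> (nat \<Rightarrow> complex^2^2) \<Rightarrow> real \<Rightarrow> (nat \<Rightarrow> real \<Rightarrow> real) \<Rightarrow> (real \<Rightarrow> complex^2) \<Rightarrow> bool" where
  "driven N B K U x \<longleftrightarrow> (\<forall>s t. s \<le> t \<longrightarrow>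
     norm (x t - x s - (\<Sum>i<N. (U i t - U i s) *\<^sub>R (B i *v x s))) \<le> K * (t - s)\<^sup>2)"

definition extremal :: "nat \<Rightarrow> (nat \<Rightarrow> complex^2^2) \<Rightarrow> real \<Rightarrow> (complex^2 \<Rightarrow> real) \<Rightarrow> (real \<Rightarrow> complex^2) \<Rightarrow> bool" where
  "extremal N B K v x \<longleftrightarrow> (\<forall>t. v (x t) = 1) \<and> (\<exists>U. controls N U \<and> driven N B K U x)"

lemma controls_mono: "controls N U \<Longrightarrow> i < N \<Longrightarrow> s \<le> t \<Longrightarrow> U i s \<le> U i t"
  and controls_sum: "controls N U \<Longrightarrow> (\<Sum>i<N. U i t - U i s) = t - s"
  by (auto simp: controls_def)

lemma controls_le:
  assumes "controls N U" "i < N" "s \<le> t" shows "U i t - U i s \<le> t - s"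
proof -
  have "U i t - U i s \<le> (\<Sum>i<N. U i t - U i s)"
    using assms by (intro member_le_sum) (auto simp: controls_def)
  then show ?thesis using controls_sum[OF assms(1)] by simp
qed

lemma matrices_bounded:
  fixes B :: "nat \<Rightarrow> complex^2^2"
  obtains R where "R > 0" "\<And>i y. i < N \<Longrightarrow> norm (B i *v y) \<le> R * norm y"
proof -
  have "\<exists>b>0. \<forall>y. norm (B i *v y) \<le> norm y * b" for i
    using bounded_linear.pos_bounded[OF bounded_linear_matrix[of "B i"]] by blast
  then obtain b where b: "\<And>i. b i > 0" "\<And>i y. norm (B i *v y) \<le> norm y * b i" by metis
  show ?thesis
  proof (rule that)
    show "(\<Sum>i<N. b i) + 1 > 0" using b(1) by (intro add_nonneg_pos sum_nonneg) (auto intro: less_imp_le)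
    fix i and y :: "complex^2" assume i: "i < N"
    have "b i \<le> (\<Sum>i<N. b i)" using b(1) i by (intro member_le_sum) (auto intro: less_imp_le)
    then have "norm y * b i \<le> norm y * ((\<Sum>i<N. b i) + 1)" by (intro mult_left_mono) auto
    then show "norm (B i *v y) \<le> ((\<Sum>i<N. b i) + 1) * norm y" using b(2)[of i y] by (simp add: mult.commute)
  qed
qed

lemma weighted_matrix_bound:
  fixes B :: "nat \<Rightarrow> complex^2^2"
  assumes R: "\<And>i y. i < N \<Longrightarrow> norm (B i *v y) \<le> R * norm y"
    and c: "\<And>i. i < N \<Longrightarrow> 0 \<le> c i"
  shows "norm (\<Sum>i<N. c i *\<^sub>R (B i *v y)) \<le> (\<Sum>i<N. c i) * (R * norm y)"
proof -
  have "norm (\<Sum>i<N. c i *\<^sub>R (B i *v y)) \<le> (\<Sum>i<N. c i * (R * norm y))"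
    using R c by (intro order_trans[OF norm_sum] sum_mono) (simp add: mult_left_mono)
  then show ?thesis by (simp add: sum_distrib_right)
qed

text \<open>The constants belong to the class and not to the single trajectory, which is what
  compactness needs.\<close>

lemma extremal_Lipschitz:
  assumes v: "cnorm v" and K: "K \<ge> 0"
  obtains C L where "C > 0" "L > 0" "\<And>x t. extremal N B K v x \<Longrightarrow> norm (x t) \<le> C"
    "\<And>x s t. extremal N B K v x \<Longrightarrow> norm (x t - x s) \<le> L * \<bar>t - s\<bar>"
proof -
  obtain c where c: "c > 0" "\<And>y. c * norm y \<le> v y" using cnorm_lower[OF v] by blast
  obtain R where R: "R > 0" "\<And>i y. i < N \<Longrightarrow> norm (B i *v y) \<le> R * norm y" using matrices_bounded by blast
  define C where "C = 1 / c"
  have C: "norm (x t) \<le> C" if "extremal N B K v x" for x t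
    using that c(2)[of "x t"] c(1) by (simp add: extremal_def C_def field_simps)
  \<comment> \<open>\<open>R * C + K\<close> serves time differences up to 1; for longer ones the
    quadratic remainder is useless and the bound \<open>2 * C\<close> on the diameter takes
    over.\<close>
  define L where "L = R * C + K + 2 * C"
  have Cpos: "C > 0" using c by (simp add: C_def)
  have le: "norm (x t - x s) \<le> L * (t - s)" if x: "extremal N B K v x" and st: "s \<le> t" for x s t
  proof (cases "t - s \<le> 1")
    case True
    obtain U where U: "controls N U" "driven N B K U x" using x by (auto simp: extremal_def)
    have "norm (\<Sum>i<N. (U i t - U i s) *\<^sub>R (B i *v x s)) \<le> (\<Sum>i<N. U i t - U i s) * (R * norm (x s))"
      using R(2) U(1) st by (intro weighted_matrix_bound) (auto simp: controls_def)
    also have "\<dots> \<le> (t - s) * (R * C)"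
      unfolding controls_sum[OF U(1)] using C[OF x, of s] R(1) st by (intro mult_left_mono) auto
    finally have "norm (\<Sum>i<N. (U i t - U i s) *\<^sub>R (B i *v x s)) \<le> (t - s) * (R * C)" .
    moreover have "norm (x t - x s - (\<Sum>i<N. (U i t - U i s) *\<^sub>R (B i *v x s))) \<le> K * (t - s)\<^sup>2"
      using U(2) st by (simp add: driven_def)
    ultimately have "norm (x t - x s) \<le> K * (t - s)\<^sup>2 + (t - s) * (R * C)"
      using norm_triangle_sub[of "x t - x s" "\<Sum>i<N. (U i t - U i s) *\<^sub>R (B i *v x s)"] by linarith
    also have "K * (t - s)\<^sup>2 \<le> K * (t - s)"
      using True st K mult_left_mono[of "t - s" 1 "t - s"] by (intro mult_left_mono) (auto simp: power2_eq_square)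
    finally have "norm (x t - x s) \<le> K * (t - s) + (t - s) * (R * C)" by simp
    also have "\<dots> \<le> L * (t - s)" using Cpos st by (simp add: L_def algebra_simps)
    finally show ?thesis .
  next
    case False
    have "norm (x t - x s) \<le> 2 * C" using C[OF x, of t] C[OF x, of s] norm_triangle_ineq4[of "x t" "x s"] by linarith
    also have "\<dots> \<le> 2 * C * (t - s)" using False Cpos by simp
    also have "\<dots> \<le> L * (t - s)" using Cpos st R(1) K by (intro mult_right_mono) (auto simp: L_def)
    finally show ?thesis .
  qed
  have "norm (x t - x s) \<le> L * \<bar>t - s\<bar>" if "extremal N B K v x" for x s t
    using le[OF that, of s t] le[OF that, of t s] by (cases "s \<le> t") (auto simp: norm_minus_commute)
  moreover have "L > 0" using Cpos R(1) K by (simp add: L_def add_nonneg_pos)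
  ultimately show ?thesis using that Cpos C by blast
qed

text \<open>For \<open>t < s\<close> the expansion is available at \<open>t\<close> only. Moving the
  base point to \<open>s\<close> changes the velocity term by at most
  \<open>R * L * (t - s)\<^sup>2\<close>.\<close>

lemma driven_two_sided:
  assumes R: "\<And>i y. i < N \<Longrightarrow> norm (B i *v y) \<le> R * norm y" "R \<ge> 0"
    and L: "\<And>s t. norm (x t - x s) \<le> L * \<bar>t - s\<bar>"
    and U: "controls N U" "driven N B K U x"
  shows "norm (x t - x s - (\<Sum>i<N. (U i t - U i s) *\<^sub>R (B i *v x s))) \<le> (K + R * L) * (t - s)\<^sup>2"
proof (cases "s \<le> t")
  case True
  have "0 \<le> L" using order_trans[OF norm_ge_zero L[of 1 0]] by simp
  then have "0 \<le> R * L * (t - s)\<^sup>2" using R(2) by simp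
  moreover have "norm (x t - x s - (\<Sum>i<N. (U i t - U i s) *\<^sub>R (B i *v x s))) \<le> K * (t - s)\<^sup>2"
    using U(2) True by (simp add: driven_def)
  ultimately show ?thesis unfolding distrib_right by linarith
next
  case False
  then have ts: "t \<le> s" by simp
  let ?d = "\<lambda>i. U i s - U i t"
  have e1: "(\<Sum>i<N. (U i t - U i s) *\<^sub>R (B i *v x s)) = - (\<Sum>i<N. ?d i *\<^sub>R (B i *v x s))"
    unfolding sum_negf[symmetric] by (rule sum.cong) (simp_all add: algebra_simps)
  have e2: "(\<Sum>i<N. ?d i *\<^sub>R (B i *v (x s - x t))) =
      (\<Sum>i<N. ?d i *\<^sub>R (B i *v x s)) - (\<Sum>i<N. ?d i *\<^sub>R (B i *v x t))"
    by (simp add: matrix_vector_mult_diff_distrib scaleR_diff_right sum_subtractf)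
  have "x t - x s - (\<Sum>i<N. (U i t - U i s) *\<^sub>R (B i *v x s)) =
      (\<Sum>i<N. ?d i *\<^sub>R (B i *v (x s - x t))) - (x s - x t - (\<Sum>i<N. ?d i *\<^sub>R (B i *v x t)))"
    unfolding e1 e2 by simp
  then have "norm (x t - x s - (\<Sum>i<N. (U i t - U i s) *\<^sub>R (B i *v x s))) \<le>
      norm (\<Sum>i<N. ?d i *\<^sub>R (B i *v (x s - x t))) + norm (x s - x t - (\<Sum>i<N. ?d i *\<^sub>R (B i *v x t)))"
    by (simp only: norm_triangle_ineq4)
  also have "norm (x s - x t - (\<Sum>i<N. ?d i *\<^sub>R (B i *v x t))) \<le> K * (s - t)\<^sup>2"
    using U(2) ts by (simp add: driven_def)
  also have "norm (\<Sum>i<N. ?d i *\<^sub>R (B i *v (x s - x t))) \<le> (s - t) * (R * norm (x s - x t))"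
    using weighted_matrix_bound[of N B R ?d "x s - x t"] R(1) U(1) ts controls_sum[OF U(1), of s t]
    by (simp add: controls_def)
  also have "\<dots> \<le> (s - t) * (R * (L * (s - t)))"
    using L[of s t] ts R(2) by (intro mult_left_mono) auto
  finally show ?thesis by (simp add: power2_eq_square algebra_simps)
qed

lemma has_vector_derivative_quadratic:
  fixes E :: "real \<Rightarrow> 'a::real_normed_vector"
  assumes "\<And>t. norm (E t) \<le> Q * (t - s)\<^sup>2"
  shows "(E has_vector_derivative 0) (at s)"
proof -
  have E0: "E s = 0" using assms[of s] by simp
  have "((\<lambda>t. norm (E t) / norm (t - s)) \<longlongrightarrow> 0) (at s)"
  proof (rule Lim_null_comparison)
    show "\<forall>\<^sub>F t in at s. norm (norm (E t) / norm (t - s)) \<le> Q * norm (t - s)"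
      unfolding eventually_at_filter
    proof (intro always_eventually allI impI)
      fix t assume "t \<noteq> s"
      then show "norm (norm (E t) / norm (t - s)) \<le> Q * norm (t - s)"
        using assms[of t] by (simp add: divide_le_eq power2_eq_square mult.assoc)
    qed
    have "((\<lambda>t. Q * norm (t - s)) \<longlongrightarrow> Q * norm (s - s)) (at s)" by (intro tendsto_intros)
    then show "((\<lambda>t. Q * norm (t - s)) \<longlongrightarrow> 0) (at s)" by simp
  qed
  then show ?thesis by (simp add: has_vector_derivative_def has_derivative_iff_norm E0)
qed

lemma driven_derivative:
  assumes R: "\<And>i y. i < N \<Longrightarrow> norm (B i *v y) \<le> R * norm y" "R \<ge> 0"
    and L: "\<And>s t. norm (x t - x s) \<le> L * \<bar>t - s\<bar>"
    and U: "controls N U" "driven N B K U x"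
    and w: "\<And>i. i < N \<Longrightarrow> (U i has_real_derivative w i) (at s)"
  shows "(x has_vector_derivative (\<Sum>i<N. w i *\<^sub>R (B i *v x s))) (at s)"
proof -
  define G where "G t = (\<Sum>i<N. (U i t - U i s) *\<^sub>R (B i *v x s))" for t
  have G: "(G has_vector_derivative (\<Sum>i<N. w i *\<^sub>R (B i *v x s))) (at s)"
    unfolding G_def
  proof (rule has_vector_derivative_sum)
    fix i assume "i \<in> {..<N}"
    then have "(U i has_real_derivative w i) (at s)" using w by simp
    then have "((\<lambda>t. U i t - U i s) has_real_derivative w i) (at s)" by (auto intro!: derivative_eq_intros)
    from has_vector_derivative_scaleR[OF this has_vector_derivative_const[where c = "B i *v x s"]]
    show "((\<lambda>t. (U i t - U i s) *\<^sub>R (B i *v x s)) has_vector_derivative w i *\<^sub>R (B i *v x s)) (at s)"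
      by simp
  qed
  have E: "((\<lambda>t. x t - x s - G t) has_vector_derivative 0) (at s)"
    unfolding G_def by (rule has_vector_derivative_quadratic[OF driven_two_sided[OF R L U]])
  have "((\<lambda>t. x s + (G t + (x t - x s - G t))) has_vector_derivative 0 + ((\<Sum>i<N. w i *\<^sub>R (B i *v x s)) + 0)) (at s)"
    by (intro has_vector_derivative_add G E has_vector_derivative_const)
  then show ?thesis by simp
qed

text \<open>The arc over [a,b] is repeated with one more factor \<open>l\<close> in each period, so
  that the pieces fit, and \<open>exp (\<rho> * t)\<close> undoes the shift. This trajectory of
  \<open>A\<close> has a periodic law, and its norm at multiples of the period never drops below the
  initial one.\<close>

lemma no_closed_extremal:
  assumes PAS: "periodically_asymptotically_stable N A" and \<rho>: "\<rho> \<ge> 0"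
    and shift: "\<And>i y. B i *v y = A i *v y - \<rho> *\<^sub>R y"
    and v: "cnorm v" and K: "K \<ge> 0" and ext: "extremal N B K v x"
    and ab: "a < b" and loop: "x b = l *s x a"
  shows False
proof -
  have sv: "cseminorm v" using v by (simp add: cnorm_def)
  obtain U where U: "controls N U" "driven N B K U x" and v1: "\<And>t. v (x t) = 1"
    using ext by (auto simp: extremal_def)
  obtain R where R: "R > 0" "\<And>i y. i < N \<Longrightarrow> norm (B i *v y) \<le> R * norm y" using matrices_bounded by blast
  obtain C L where CL: "C > 0" "L > 0" "\<And>t. norm (x t) \<le> C" "\<And>s t. norm (x t - x s) \<le> L * \<bar>t - s\<bar>"
    using extremal_Lipschitz[OF v K, of N B] ext by metis
  have l1: "cmod l = 1" using v1[of b] v1[of a] by (simp add: loop cseminorm_smult[OF sv])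
  have xa: "x a \<noteq> 0" using v1[of a] cseminorm_0[OF sv] by auto
  have "\<exists>w S. w \<in> borel_measurable borel \<and> (\<forall>t. 0 \<le> w t \<and> w t \<le> 1) \<and> negligible S \<and>
      (\<forall>t. t \<notin> S \<longrightarrow> (U i has_real_derivative w t) (at t))" if "i < N" for i
    using Lipschitz_mono_derivative[of "U i"] controls_mono[OF U(1) that] controls_le[OF U(1) that] by metis
  then obtain w S where w: "\<And>i. i < N \<Longrightarrow> w i \<in> borel_measurable borel"
      "\<And>i t. i < N \<Longrightarrow> 0 \<le> w i t" "\<And>i t. i < N \<Longrightarrow> w i t \<le> 1" "\<And>i. i < N \<Longrightarrow> negligible (S i)"
      "\<And>i t. i < N \<Longrightarrow> t \<notin> S i \<Longrightarrow> (U i has_real_derivative w i t) (at t)" by metis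
  define P where "P = b - a"
  have P: "P > 0" using ab by (simp add: P_def)
  define k where "k t = nat \<lfloor>t / P\<rfloor>" for t
  define \<tau> where "\<tau> t = a + t - of_int \<lfloor>t / P\<rfloor> * P" for t
  have k: "of_int \<lfloor>t / P\<rfloor> = real (k t)" if "t \<ge> 0" for t
    using that P by (simp add: k_def)
  have kb: "real (k t) * P \<le> t" "t < (real (k t) + 1) * P" if "t \<ge> 0" for t
    using floor_divide_lower[OF P, of t] floor_divide_upper[OF P, of t] k[OF that] by auto
  have k_eq: "k t = n" if "real n * P \<le> t" "t < (real n + 1) * P" for t n
  proof -
    have "\<lfloor>t / P\<rfloor> = int n" using that P by (intro floor_unique) (auto simp: field_simps)
    then show ?thesis by (simp add: k_def)
  qed
  have \<tau>: "\<tau> t = a + t - real (k t) * P" if "t \<ge> 0" for t using k[OF that] by (simp add: \<tau>_def)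
  define Y where "Y t = l ^ k t *s x (\<tau> t)" for t
  have nl: "cmod (l ^ n) = 1" for n using l1 by (simp add: norm_power)
  have YC: "norm (Y t) \<le> C" for t using CL(3) by (simp add: Y_def norm_smult nl)
  \<comment> \<open>Induction on the number of period ends between \<open>s\<close> and
    \<open>t\<close>; at each of them the two pieces agree because
    \<open>x b = l *s x a\<close>.\<close>
  have Ylip: "norm (Y t - Y s) \<le> L * (t - s)" if "0 \<le> s" "s \<le> t" for s t
    using that
  proof (induction "k t - k s" arbitrary: s rule: less_induct)
    case less
    have t0: "0 \<le> t" using less.prems by simp
    show ?case
    proof (cases "t < (real (k s) + 1) * P")
      case True
      then have kk: "k t = k s" using kb(1)[OF less.prems(1)] less.prems by (intro k_eq) auto
      have "Y t - Y s = l ^ k s *s (x (\<tau> t) - x (\<tau> s))" by (simp add: Y_def kk vector_ssub_ldistrib)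
      then have "norm (Y t - Y s) = norm (x (\<tau> t) - x (\<tau> s))" by (simp only: norm_smult nl mult_1_left)
      then have "norm (Y t - Y s) \<le> L * \<bar>\<tau> t - \<tau> s\<bar>" using CL(4) by (simp only:)
      then show ?thesis using less.prems t0 by (simp add: \<tau> kk)
    next
      case False
      define m where "m = (real (k s) + 1) * P"
      have m: "s < m" "m \<le> t" "0 \<le> m" using kb(2)[OF less.prems(1)] False less.prems by (auto simp: m_def)
      have km: "k m = Suc (k s)" using P by (intro k_eq) (auto simp: m_def)
      have "Suc (k s) \<le> k t"
      proof (rule ccontr)
        assume "\<not> Suc (k s) \<le> k t"
        then have "k t + 1 \<le> k s + 1" by simp
        then have "(real (k t) + 1) * P \<le> m" unfolding m_def using P by (intro mult_right_mono) auto
        then show False using kb(2)[OF t0] m by simp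
      qed
      then have "norm (Y t - Y m) \<le> L * (t - m)" using m km by (intro less.hyps) auto
      moreover have "norm (Y m - Y s) \<le> L * (m - s)"
      proof -
        have "\<tau> m = a" using m km by (simp add: \<tau> m_def)
        then have "Y m = l ^ k s *s x b" by (simp add: Y_def km loop vector_smult_assoc mult.commute)
        then have "Y m - Y s = l ^ k s *s (x b - x (\<tau> s))" by (simp add: Y_def vector_ssub_ldistrib)
        then have "norm (Y m - Y s) = norm (x b - x (\<tau> s))" by (simp only: norm_smult nl mult_1_left)
        then have "norm (Y m - Y s) \<le> L * \<bar>b - \<tau> s\<bar>" using CL(4) by (simp only:)
        moreover have "b - \<tau> s = m - s" using less.prems by (simp add: \<tau> m_def P_def algebra_simps)
        ultimately show ?thesis using m by simp
      qed
      moreover have "norm (Y t - Y s) \<le> norm (Y t - Y m) + norm (Y m - Y s)"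
        using norm_triangle_ineq[of "Y t - Y m" "Y m - Y s"] by simp
      ultimately show ?thesis by (simp add: algebra_simps)
    qed
  qed
  define X where "X t = exp (\<rho> * t) *\<^sub>R Y t" for t
  have exp_der: "((\<lambda>t. exp (\<rho> * t)) has_vector_derivative \<rho> * exp (\<rho> * t)) (at t within T)" for t T
    by (auto intro!: derivative_eq_intros simp: has_real_derivative_iff_has_vector_derivative[symmetric])
  have ACX: "abs_continuous_on_halfline X" unfolding abs_continuous_on_halfline_def
  proof (intro allI impI AC_of_Lipschitz)
    fix c s t :: real assume c: "c \<ge> 0" and st: "0 \<le> s" "s \<le> t" "t \<le> c"
    have e1: "\<bar>exp (\<rho> * t) - exp (\<rho> * s)\<bar> \<le> (\<rho> * exp (\<rho> * c)) * (t - s)"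
      using Lipschitz_of_derivative[of 0 c "\<lambda>t. exp (\<rho> * t)" "\<lambda>t. \<rho> * exp (\<rho> * t)" "\<rho> * exp (\<rho> * c)" s t]
        exp_der \<rho> st by (simp add: mult_left_mono)
    have e2: "exp (\<rho> * t) \<le> exp (\<rho> * c)" using \<rho> st by (simp add: mult_left_mono)
    have "X t - X s = exp (\<rho> * t) *\<^sub>R (Y t - Y s) + (exp (\<rho> * t) - exp (\<rho> * s)) *\<^sub>R Y s"
      by (simp add: X_def algebra_simps)
    then have "norm (X t - X s) \<le> exp (\<rho> * t) * norm (Y t - Y s) + \<bar>exp (\<rho> * t) - exp (\<rho> * s)\<bar> * norm (Y s)"
      using norm_triangle_ineq[of "exp (\<rho> * t) *\<^sub>R (Y t - Y s)" "(exp (\<rho> * t) - exp (\<rho> * s)) *\<^sub>R Y s"] by simp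
    also have "\<dots> \<le> exp (\<rho> * c) * (L * (t - s)) + ((\<rho> * exp (\<rho> * c)) * (t - s)) * C"
      using e1 e2 Ylip st YC \<rho> by (intro add_mono mult_mono) auto
    finally show "norm (X t - X s) \<le> (exp (\<rho> * c) * L + \<rho> * exp (\<rho> * c) * C) * (t - s)"
      by (simp add: algebra_simps)
  qed
  define u where "u i t = w i (\<tau> t)" for i t
  define Z where "Z = (\<Union>i\<in>{..<N}. S i)"
  have negZ: "negligible Z" unfolding Z_def using w(4) by (intro negligible_Union) auto
  \<comment> \<open>The joints of the periodic extension together with the copies in all periods of
    the times where some \<open>U i\<close> might not be differentiable.\<close>
  define Q where "Q = (\<Union>n::nat. insert (real n * P) ((+) (real n * P - a) ` Z))"
  have negQ: "negligible Q" unfolding Q_def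
    by (intro negligible_countable_Union) (auto intro!: negligible_translation negZ simp: negligible_insert)
  have wsum: "(\<Sum>i<N. w i t) = 1" if "t \<notin> Z" for t
  proof -
    have "((\<lambda>s. \<Sum>i<N. U i s - U i t) has_real_derivative (\<Sum>i<N. w i t)) (at t)"
      using w(5) that by (intro DERIV_sum) (auto intro!: derivative_eq_intros simp: Z_def)
    moreover have "((\<lambda>s. \<Sum>i<N. U i s - U i t) has_real_derivative 1) (at t)"
      unfolding controls_sum[OF U(1)] by (auto intro!: derivative_eq_intros)
    ultimately show ?thesis by (rule DERIV_unique)
  qed
  have good: "(\<Sum>i<N. u i t) = 1 \<and> (X has_vector_derivative (\<Sum>i<N. u i t *\<^sub>R (A i *v X t))) (at t within {0..})"
    if t: "t \<ge> 0" "t \<notin> Q" for t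
  proof -
    let ?n = "k t"
    have "t \<noteq> real ?n * P" using t(2) by (auto simp: Q_def)
    then have tn: "real ?n * P < t" "t < (real ?n + 1) * P"
      using kb[OF t(1)] by auto
    have \<tau>Z: "\<tau> t \<notin> Z"
    proof
      assume "\<tau> t \<in> Z"
      then have "(real ?n * P - a) + \<tau> t \<in> Q" unfolding Q_def by blast
      then show False using t by (simp add: \<tau>)
    qed
    have s1: "(\<Sum>i<N. u i t) = 1" using wsum[OF \<tau>Z] by (simp add: u_def)
    let ?y = "\<Sum>i<N. w i (\<tau> t) *\<^sub>R (B i *v x (\<tau> t))"
    have "(x has_vector_derivative ?y) (at (\<tau> t))"
      using w(5) \<tau>Z R CL(4) U by (intro driven_derivative[where R=R and L=L and K=K and U=U]) (auto simp: Z_def)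
    then have "((\<lambda>s. x (s + (a - real ?n * P))) has_vector_derivative ?y) (at t)"
    proof -
      assume "(x has_vector_derivative ?y) (at (\<tau> t))"
      moreover have "\<tau> t = t + (a - real ?n * P)" using t by (simp add: \<tau>)
      moreover have "((\<lambda>s. s + (a - real ?n * P)) has_vector_derivative 1) (at t)"
        by (auto intro!: derivative_eq_intros)
      ultimately show ?thesis
        using vector_diff_chain_at[of "\<lambda>s. s + (a - real ?n * P)" 1 t x ?y] by (simp add: o_def)
    qed
    then have "((\<lambda>s. l ^ ?n *s x (s + (a - real ?n * P))) has_vector_derivative l ^ ?n *s ?y) (at t)"
      by (intro bounded_linear.has_vector_derivative[of "\<lambda>y. l ^ ?n *s y"])
         (auto simp: linear_conv_bounded_linear[symmetric] vec_eq_iff algebra_simps intro!: linearI)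
    from has_vector_derivative_scaleR[OF exp_der[unfolded has_real_derivative_iff_has_vector_derivative[symmetric]] this]
    have "((\<lambda>s. exp (\<rho> * s) *\<^sub>R (l ^ ?n *s x (s + (a - real ?n * P)))) has_vector_derivative
        exp (\<rho> * t) *\<^sub>R (l ^ ?n *s ?y) + (\<rho> * exp (\<rho> * t)) *\<^sub>R (l ^ ?n *s x (t + (a - real ?n * P)))) (at t)" .
    then have "(X has_vector_derivative
        exp (\<rho> * t) *\<^sub>R (l ^ ?n *s ?y) + (\<rho> * exp (\<rho> * t)) *\<^sub>R (l ^ ?n *s x (t + (a - real ?n * P)))) (at t)"
    proof (rule has_vector_derivative_transform_within_open[where S = "{real ?n * P<..<(real ?n + 1) * P}"])
      fix s assume s: "s \<in> {real ?n * P<..<(real ?n + 1) * P}"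
      have "0 \<le> real ?n * P" using P by simp
      then have s0: "0 \<le> s" using s by auto
      have "k s = ?n" using s by (intro k_eq) auto
      then show "exp (\<rho> * s) *\<^sub>R (l ^ ?n *s x (s + (a - real ?n * P))) = X s"
        using s0 by (simp add: X_def Y_def \<tau> algebra_simps)
    qed (use tn in auto)
    moreover have "exp (\<rho> * t) *\<^sub>R (l ^ ?n *s ?y) + (\<rho> * exp (\<rho> * t)) *\<^sub>R (l ^ ?n *s x (t + (a - real ?n * P)))
        = (\<Sum>i<N. u i t *\<^sub>R (A i *v X t))"
    proof -
      have xt: "x (t + (a - real ?n * P)) = x (\<tau> t)" using t by (simp add: \<tau> algebra_simps)
      have "?y = (\<Sum>i<N. u i t *\<^sub>R (A i *v x (\<tau> t))) - (\<Sum>i<N. u i t) *\<^sub>R (\<rho> *\<^sub>R x (\<tau> t))"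
        unfolding scaleR_sum_left sum_subtractf[symmetric] by (simp add: shift u_def scaleR_diff_right)
      then have y: "?y = (\<Sum>i<N. u i t *\<^sub>R (A i *v x (\<tau> t))) - \<rho> *\<^sub>R x (\<tau> t)" using s1 by simp
      have "(\<Sum>i<N. u i t *\<^sub>R (A i *v X t)) = exp (\<rho> * t) *\<^sub>R (l ^ ?n *s (\<Sum>i<N. u i t *\<^sub>R (A i *v x (\<tau> t))))"
        by (simp add: X_def Y_def matrix_scaleR matrix_smult vec.scale_sum_right scaleR_eq_smult vector_smult_assoc mult_ac)
      then show ?thesis unfolding y xt
        by (simp add: vector_ssub_ldistrib scaleR_diff_right scaleR_eq_smult vector_smult_assoc mult_ac)
    qed
    ultimately show ?thesis using s1 by (auto intro: has_vector_derivative_at_within)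
  qed
  have AEQ: "AE t in lebesgue. t \<notin> Q"
    using negQ AE_not_in[of Q lebesgue] by (auto simp: negligible_iff_null_sets)
  have "trajectory_with N A u X" unfolding trajectory_with_def
  proof (intro conjI ACX)
    show "switching_law N u" unfolding switching_law_def
    proof (intro conjI allI impI)
      fix i assume i: "i < N"
      have "\<tau> \<in> borel_measurable borel" unfolding \<tau>_def by measurable
      then have "u i \<in> borel_measurable borel" using w(1)[OF i] unfolding u_def by measurable
      then show "u i \<in> borel_measurable (restrict_space lebesgue {0..})"
        by (intro measurable_restrict_space1 measurable_completion) simp
    next
      show "AE t in lebesgue. 0 \<le> t \<longrightarrow> (\<Sum>i<N. u i t) = 1"
        using AEQ by eventually_elim (use good in auto)
    qed (use w in \<open>auto simp: u_def\<close>)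
    show "AE t in lebesgue. t \<ge> 0 \<longrightarrow> (X has_vector_derivative (\<Sum>i<N. u i t *\<^sub>R (A i *v X t))) (at t within {0..})"
      using AEQ by eventually_elim (use good in auto)
  qed
  moreover have "periodic_law N u" unfolding periodic_law_def
  proof (intro exI[of _ P] conjI P allI impI always_eventually)
    fix i t
    have "(t + P) / P = t / P + 1" using P by (simp add: field_simps)
    then show "u i (t + P) = u i t" by (simp add: u_def \<tau>_def algebra_simps)
  qed
  ultimately have "(X \<longlongrightarrow> 0) at_top" using PAS unfolding periodically_asymptotically_stable_def by blast
  then have "\<forall>\<^sub>F t in at_top. norm (X t) < norm (x a)" using xa by (auto simp: tendsto_iff)
  then obtain T where T: "\<And>t. t \<ge> T \<Longrightarrow> norm (X t) < norm (x a)" by (auto simp: eventually_at_top_linorder)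
  obtain n :: nat where "T / P < real n" using reals_Archimedean2 by blast
  then have "real n * P \<ge> T" using P by (simp add: field_simps)
  then have "norm (X (real n * P)) < norm (x a)" by (rule T)
  moreover have "norm (X (real n * P)) \<ge> norm (x a)"
  proof -
    have "k (real n * P) = n" using P by (intro k_eq) auto
    then have "X (real n * P) = exp (\<rho> * (real n * P)) *\<^sub>R (l ^ n *s x a)" using P by (simp add: X_def Y_def \<tau>)
    moreover have "1 * norm (x a) \<le> exp (\<rho> * (real n * P)) * norm (x a)" using \<rho> P by (intro mult_right_mono) auto
    ultimately show ?thesis by (simp add: norm_smult nl)
  qed
  ultimately show False by simp
qed

section \<open>Common eigenvectors and discrete growth rates\<close>

text \<open>The determinant with columns \<open>x\<close> and \<open>y\<close>. For nonzero vectors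
  it vanishes exactly when they span the same complex line, so it acts as a difference on the
  projective line.\<close>

definition dt :: "complex^2 \<Rightarrow> complex^2 \<Rightarrow> complex" where
  "dt x y = x$1 * y$2 - x$2 * y$1"

lemma dt_simps:
  "dt (x + y) z = dt x z + dt y z" "dt z (x + y) = dt z x + dt z y"
  "dt (x - y) z = dt x z - dt y z" "dt z (x - y) = dt z x - dt z y"
  "dt (c *s x) z = c * dt x z" "dt z (c *s x) = c * dt z x" "dt x x = 0"
  by (simp_all add: dt_def algebra_simps)

lemma dt_scaleR: "dt (r *\<^sub>R x) z = r *\<^sub>R dt x z" "dt z (r *\<^sub>R x) = r *\<^sub>R dt z x"
  by (simp_all add: scaleR_eq_smult dt_simps scaleR_conv_of_real)

lemma dt_complement:
  assumes "e \<noteq> 0" obtains f where "dt e f = 1"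
proof (cases "e$1 = 0")
  case True
  then have "e$2 \<noteq> 0" using assms by (auto simp: vec_eq_iff forall_2)
  then show ?thesis using True by (intro that[of "(- 1 / e$2) *s axis 1 1"]) (simp add: dt_def axis_def)
next
  case False
  then show ?thesis by (intro that[of "(1 / e$1) *s axis 2 1"]) (simp add: dt_def axis_def)
qed

text \<open>Cramer's rule in a basis of determinant 1.\<close>

lemma dt_expand:
  assumes "dt e f = 1" shows "x = dt x f *s e + dt e x *s f"
proof -
  have 1: "e$1 * f$2 - e$2 * f$1 = 1" using assms by (simp add: dt_def)
  have "dt x f * e$1 + dt e x * f$1 = x$1 * (e$1 * f$2 - e$2 * f$1)"
    "dt x f * e$2 + dt e x * f$2 = x$2 * (e$1 * f$2 - e$2 * f$1)"
    by (simp_all add: dt_def algebra_simps)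
  then show ?thesis by (simp add: vec_eq_iff forall_2 1)
qed

lemma dt_eq_0_parallel:
  assumes "e \<noteq> 0" "dt e x = 0" obtains c where "x = c *s e"
proof -
  obtain f where "dt e f = 1" using dt_complement[OF assms(1)] by blast
  from dt_expand[OF this, of x] assms(2) have "x = dt x f *s e" by simp
  then show ?thesis using that by blast
qed

section \<open>Simultaneously triangular systems\<close>

lemma finite_pos_lower:
  fixes f :: "nat \<Rightarrow> real"
  assumes "\<And>i. i < N \<Longrightarrow> f i > 0" obtains k where "k > 0" "\<And>i. i < N \<Longrightarrow> k \<le> f i"
  using assms
proof (induction N arbitrary: thesis)
  case 0
  show ?case by (rule 0(1)[of 1]) auto
next
  case (Suc N)
  obtain k where k: "k > 0" "\<And>i. i < N \<Longrightarrow> k \<le> f i" using Suc.IH Suc.prems(2) by (metis less_SucI)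
  show ?case
  proof (rule Suc.prems(1))
    show "min k (f N) > 0" using k Suc.prems(2)[of N] by simp
    show "min k (f N) \<le> f i" if "i < Suc N" for i using that k(2)[of i] by (cases "i = N") auto
  qed
qed

lemma finite_upper:
  fixes f :: "nat \<Rightarrow> real"
  obtains k where "k > 0" "\<And>i. i < N \<Longrightarrow> f i \<le> k"
proof
  show "(\<Sum>i<N. \<bar>f i\<bar>) + 1 > 0" by (intro add_nonneg_pos sum_nonneg) auto
  show "f i \<le> (\<Sum>i<N. \<bar>f i\<bar>) + 1" if "i < N" for i
    using member_le_sum[of i "{..<N}" "\<lambda>i. \<bar>f i\<bar>"] that by simp
qed

text \<open>In \<open>|1 + h \<alpha>|^2 = 1 + 2 h Re \<alpha> + h^2 |\<alpha>|^2\<close> half of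
  the linear decay absorbs the quadratic term; this is the reason for the factor 2 in the first
  bound on \<open>\<alpha>\<close>.\<close>

lemma contraction_bound:
  assumes \<kappa>: "\<kappa> > 0" and a: "Re \<alpha> \<le> - 2 * \<kappa>" "cmod \<alpha> \<le> M" and h: "0 \<le> h" "h * \<kappa> \<le> 1" "h * M\<^sup>2 \<le> 2 * \<kappa>"
  shows "cmod (1 + of_real h * \<alpha>) \<le> 1 - h * \<kappa>"
proof -
  have eq: "(cmod (1 + of_real h * \<alpha>))\<^sup>2 = 1 + 2 * h * Re \<alpha> + h\<^sup>2 * (cmod \<alpha>)\<^sup>2"
    unfolding cmod_power2 by (simp add: power2_eq_square algebra_simps)
  have "(cmod \<alpha>)\<^sup>2 \<le> M\<^sup>2" using a(2) by (intro power_mono) auto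
  then have "h\<^sup>2 * (cmod \<alpha>)\<^sup>2 \<le> h\<^sup>2 * M\<^sup>2" by (intro mult_left_mono) auto
  also have "\<dots> \<le> h * (2 * \<kappa>)" using mult_left_mono[OF h(3,1)] by (simp add: power2_eq_square mult_ac)
  finally have "h\<^sup>2 * (cmod \<alpha>)\<^sup>2 \<le> 2 * (h * \<kappa>)" by simp
  moreover have "h * Re \<alpha> \<le> - 2 * (h * \<kappa>)" using mult_left_mono[OF a(1) h(1)] by simp
  moreover have "(1 - h * \<kappa>)\<^sup>2 = 1 - 2 * (h * \<kappa>) + (h * \<kappa>)\<^sup>2" by (simp add: power2_eq_square algebra_simps)
  ultimately have "(cmod (1 + of_real h * \<alpha>))\<^sup>2 \<le> (1 - h * \<kappa>)\<^sup>2"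
    unfolding eq using zero_le_power2[of "h * \<kappa>"] by linarith
  then show ?thesis by (rule power2_le_imp_le) (use h(2) in simp)
qed

text \<open>In a basis \<open>e\<close>, \<open>f\<close> all \<open>A i\<close> are triangular.
  Their diagonal entries are eigenvalues, which the constant laws using one matrix force into the
  left half plane; a norm that weights the second coordinate heavily absorbs the off-diagonal
  entries.\<close>

lemma reducible_GUES:
  assumes PAS: "periodically_asymptotically_stable N A" and e: "e \<noteq> 0"
    and eig: "\<And>i. i < N \<Longrightarrow> \<exists>\<alpha>. A i *v e = \<alpha> *s e"
  shows "GUES N A"
proof -
  have single: "Re \<nu> < 0" if "i < N" "x0 \<noteq> 0" "A i *v x0 = \<nu> *s x0" for i \<nu> x0
  proof (rule PAS_constant[OF PAS, of "\<lambda>j. if j = i then 1 else 0"])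
    have "(\<Sum>j<N. (if j = i then 1 else 0 :: real) *\<^sub>R (A j *v x0)) = (\<Sum>j<N. if j = i then A j *v x0 else 0)"
      by (rule sum.cong) auto
    then show "(\<Sum>j<N. (if j = i then 1 else 0 :: real) *\<^sub>R (A j *v x0)) = \<nu> *s x0" using that by simp
  qed (use that in auto)
  obtain f where f: "dt e f = 1" using dt_complement[OF e] by blast
  obtain \<alpha> where \<alpha>: "\<And>i. i < N \<Longrightarrow> A i *v e = \<alpha> i *s e" using eig by metis
  define \<beta> where "\<beta> i = dt e (A i *v f)" for i
  define \<gamma> where "\<gamma> i = dt (A i *v f) f" for i
  have Af: "A i *v f = \<gamma> i *s e + \<beta> i *s f" for i unfolding \<beta>_def \<gamma>_def by (rule dt_expand[OF f])
  have Re\<alpha>: "Re (\<alpha> i) < 0" if "i < N" for i using single[OF that e \<alpha>[OF that]] .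
  have Re\<beta>: "Re (\<beta> i) < 0" if i: "i < N" for i
  proof (cases "\<beta> i = \<alpha> i")
    case False
    \<comment> \<open>For distinct diagonal entries this is the eigenvector for the lower one,
      \<open>\<beta> i\<close>.\<close>
    define y where "y = f + (\<gamma> i / (\<beta> i - \<alpha> i)) *s e"
    have "dt e y = 1" by (simp add: y_def dt_simps f)
    then have "y \<noteq> 0" by (auto simp: dt_def)
    moreover have "A i *v y = \<beta> i *s y"
    proof -
      have "\<gamma> i + \<gamma> i / (\<beta> i - \<alpha> i) * \<alpha> i = \<beta> i * (\<gamma> i / (\<beta> i - \<alpha> i))" using False by (simp add: field_simps)
      then have "\<gamma> i *s e + (\<gamma> i / (\<beta> i - \<alpha> i) * \<alpha> i) *s e = (\<beta> i * (\<gamma> i / (\<beta> i - \<alpha> i))) *s e"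
        by (metis vector_sadd_rdistrib)
      then show ?thesis
        by (simp add: y_def matrix_vector_right_distrib matrix_smult \<alpha>[OF i] Af vector_smult_assoc vector_add_ldistrib algebra_simps)
    qed
    ultimately show ?thesis by (rule single[OF i])
  qed (use Re\<alpha> i in simp)
  obtain \<kappa> where \<kappa>: "\<kappa> > 0" "\<And>i. i < N \<Longrightarrow> \<kappa> \<le> min (- Re (\<alpha> i)) (- Re (\<beta> i)) / 2"
    using finite_pos_lower[of N "\<lambda>i. min (- Re (\<alpha> i)) (- Re (\<beta> i)) / 2"] Re\<alpha> Re\<beta> by auto
  obtain M where M: "M > 0" "\<And>i. i < N \<Longrightarrow> max (cmod (\<alpha> i)) (cmod (\<beta> i)) \<le> M"
    using finite_upper[of N "\<lambda>i. max (cmod (\<alpha> i)) (cmod (\<beta> i))"] by blast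
  obtain G where G: "G > 0" "\<And>i. i < N \<Longrightarrow> cmod (\<gamma> i) \<le> G" using finite_upper[of N "\<lambda>i. cmod (\<gamma> i)"] by blast
  define h where "h = min (1 / \<kappa>) (2 * \<kappa> / M\<^sup>2)"
  have h: "h > 0" using \<kappa> M by (simp add: h_def)
  have h1: "h * \<kappa> \<le> 1" using \<kappa> by (simp add: h_def min_def field_simps)
  have h2: "h * M\<^sup>2 \<le> 2 * \<kappa>"
  proof -
    have "h \<le> 2 * \<kappa> / M\<^sup>2" by (simp add: h_def)
    then show ?thesis using M(1) by (simp add: field_simps)
  qed
  have cb: "cmod (1 + of_real h * \<alpha> i) \<le> 1 - h * \<kappa>" "cmod (1 + of_real h * \<beta> i) \<le> 1 - h * \<kappa>" if "i < N" for i
    using \<kappa>(2)[OF that] M(2)[OF that] h h1 h2 \<kappa>(1) by (auto intro!: contraction_bound[where M=M])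
  \<comment> \<open>With this weight the coupling term \<open>h * G * cmod q\<close> equals half of
    the decay \<open>W * (h * \<kappa>) * cmod q\<close> of the second coordinate.\<close>
  define W where "W = 2 * G / \<kappa>"
  have W: "W > 0" using G \<kappa> by (simp add: W_def)
  define v where "v x = cmod (dt x f) + W * cmod (dt e x)" for x
  have "cnorm v" unfolding cnorm_def cseminorm_def
  proof (intro conjI allI impI)
    fix x y
    have "W * cmod (dt e x + dt e y) \<le> W * (cmod (dt e x) + cmod (dt e y))"
      using W by (intro mult_left_mono norm_triangle_ineq) auto
    then show "v (x + y) \<le> v x + v y"
      using norm_triangle_ineq[of "dt x f" "dt y f"] by (simp add: v_def dt_simps algebra_simps)
    show "v (c *s x) = cmod c * v x" for c by (simp add: v_def dt_simps norm_mult algebra_simps)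
    assume "v x = 0"
    then have "dt x f = 0" "dt e x = 0" using W by (auto simp: v_def add_nonneg_eq_0_iff)
    then show "x = 0" using dt_expand[OF f, of x] by simp
  qed
  then show ?thesis
  proof (rule GUES_criterion[where h = h and r = "- \<kappa> / 2"])
    fix i x assume i: "i < N"
    define p q where "p = dt x f" "q = dt e x"
    have x: "x = p *s e + q *s f" unfolding p_q_def by (rule dt_expand[OF f])
    have "A i *v x = (p * \<alpha> i + q * \<gamma> i) *s e + (q * \<beta> i) *s f"
      by (subst x) (simp add: matrix_vector_right_distrib matrix_smult \<alpha>[OF i] Af vector_smult_assoc vector_add_ldistrib vector_sadd_rdistrib)
    then have d: "dt (A i *v x) f = p * \<alpha> i + q * \<gamma> i" "dt e (A i *v x) = q * \<beta> i"
      using f by (simp_all add: dt_simps)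
    have eq: "dt (x + h *\<^sub>R (A i *v x)) f = (1 + of_real h * \<alpha> i) * p + of_real h * \<gamma> i * q"
      "dt e (x + h *\<^sub>R (A i *v x)) = (1 + of_real h * \<beta> i) * q"
      unfolding dt_simps(1,2) dt_scaleR d p_q_def[symmetric] by (simp_all add: scaleR_conv_of_real algebra_simps)
    have "v (x + h *\<^sub>R (A i *v x)) \<le> (cmod (1 + of_real h * \<alpha> i) * cmod p + h * cmod (\<gamma> i) * cmod q)
        + W * (cmod (1 + of_real h * \<beta> i) * cmod q)"
      using norm_triangle_ineq[of "(1 + of_real h * \<alpha> i) * p" "of_real h * \<gamma> i * q"] h
      by (simp add: v_def eq norm_mult)
    also have "\<dots> \<le> ((1 - h * \<kappa>) * cmod p + h * G * cmod q) + W * ((1 - h * \<kappa>) * cmod q)"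
      using cb[OF i] G(2)[OF i] h W by (intro add_mono mult_right_mono mult_left_mono) auto
    also have "h * G * cmod q = W * (h * \<kappa> / 2 * cmod q)" using \<kappa>(1) by (simp add: W_def field_simps)
    also have "((1 - h * \<kappa>) * cmod p + W * (h * \<kappa> / 2 * cmod q)) + W * ((1 - h * \<kappa>) * cmod q)
        = (1 - h * \<kappa>) * cmod p + (1 - h * \<kappa> / 2) * (W * cmod q)" by (simp add: algebra_simps)
    also have "\<dots> \<le> (1 - h * \<kappa> / 2) * cmod p + (1 - h * \<kappa> / 2) * (W * cmod q)"
      using h \<kappa>(1) by (intro add_right_mono mult_right_mono) auto
    also have "\<dots> = (1 + h * (- \<kappa> / 2)) * v x" by (simp add: v_def p_q_def algebra_simps)
    finally show "v (x + h *\<^sub>R (A i *v x)) \<le> (1 + h * (- \<kappa> / 2)) * v x" .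
  qed (use h \<kappa> in auto)
qed

section \<open>Optimal growth rates of matrix products\<close>

definition dominated :: "nat \<Rightarrow> (nat \<Rightarrow> complex^2^2) \<Rightarrow> real \<Rightarrow> (complex^2 \<Rightarrow> real) \<Rightarrow> bool" where
  "dominated N M l v \<longleftrightarrow> (\<forall>i<N. \<forall>x. v (M i *v x) \<le> l * v x)"

definition word_app :: "(nat \<Rightarrow> complex^2^2) \<Rightarrow> nat list \<Rightarrow> complex^2 \<Rightarrow> complex^2" where
  "word_app M ws x = fold (\<lambda>i y. M i *v y) ws x"

lemma word_app_simps [simp]:
  "word_app M [] x = x" "word_app M (i # ws) x = word_app M ws (M i *v x)"
  by (simp_all add: word_app_def)

lemma word_app_add: "word_app M ws (x + y) = word_app M ws x + word_app M ws y"
  by (induction ws arbitrary: x y) (simp_all add: matrix_vector_right_distrib)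

lemma word_app_smult: "word_app M ws (c *s x) = c *s word_app M ws x"
  by (induction ws arbitrary: x) (simp_all add: matrix_smult)

lemma cnorm_norm: "cnorm norm"
  by (simp add: cnorm_def cseminorm_def norm_triangle_ineq norm_smult)

(* If every word of length T contracted v by more than l ^ T, the maximum of v over shorter words,
   suitably weighted, would be a norm with rate below the infimum. *)
lemma near_extremal_word:
  assumes m: "m > 0" and lower: "\<And>l v. cnorm v \<Longrightarrow> dominated N M l v \<Longrightarrow> m \<le> l"
    and upper: "dominated N M u norm"
    and T: "T > 0" and \<delta>: "0 < \<delta>" "\<delta> < 1" and \<epsilon>: "\<epsilon> > 0"
  obtains v l ws x where "cnorm v" "dominated N M l v" "m \<le> l" "l \<le> u + \<epsilon>"
    "length ws = T" "set ws \<subseteq> {..<N}" "(1 - \<delta>) * l ^ T * v x < v (word_app M ws x)"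
proof -
  define G where "G = {l. \<exists>v. cnorm v \<and> dominated N M l v}"
  have uG: "u \<in> G" using upper cnorm_norm by (auto simp: G_def)
  have bdd: "bdd_below G" using lower by (intro bdd_belowI[of _ m]) (auto simp: G_def)
  \<comment> \<open>The infimum is the joint spectral radius. It need not be attained by a norm, so
    \<open>l\<close> is taken slightly above it.\<close>
  define \<Lambda> where "\<Lambda> = Inf G"
  have \<Lambda>: "m \<le> \<Lambda>" "\<Lambda> \<le> u" unfolding \<Lambda>_def using uG bdd lower
    by (auto intro!: cInf_greatest cInf_lower simp: G_def)
  \<comment> \<open>Contraction of all words of length \<open>T\<close> by
    \<open>(1 - \<delta>) * l ^ T\<close> amounts to the rate \<open>\<theta> * l\<close> per
    letter, and \<open>l < \<Lambda> / \<theta>\<close> puts this rate below the infimum.\<close>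
  define \<theta> where "\<theta> = root T (1 - \<delta>)"
  have \<theta>: "0 < \<theta>" "\<theta> < 1" "\<theta> ^ T = 1 - \<delta>" using T \<delta> by (auto simp: \<theta>_def)
  have "\<Lambda> < min (\<Lambda> / \<theta>) (\<Lambda> + \<epsilon>)" using \<theta> \<epsilon> \<Lambda>(1) m by (simp add: field_simps)
  then obtain l where l: "l \<in> G" "l < \<Lambda> / \<theta>" "l < \<Lambda> + \<epsilon>"
    using cInf_lessD[of G "min (\<Lambda> / \<theta>) (\<Lambda> + \<epsilon>)"] uG unfolding \<Lambda>_def by auto
  obtain v where v: "cnorm v" "dominated N M l v" using l(1) by (auto simp: G_def)
  have ml: "m \<le> l" by (rule lower[OF v])
  have sv: "cseminorm v" and dv: "\<And>x. v x = 0 \<Longrightarrow> x = 0" using v(1) by (auto simp: cnorm_def)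
  have "\<exists>ws x. length ws = T \<and> set ws \<subseteq> {..<N} \<and> (1 - \<delta>) * l ^ T * v x < v (word_app M ws x)"
  proof (rule ccontr)
    assume "\<nexists>ws x. length ws = T \<and> set ws \<subseteq> {..<N} \<and> (1 - \<delta>) * l ^ T * v x < v (word_app M ws x)"
    then have "\<not> (1 - \<delta>) * l ^ T * v x < v (word_app M ws x)" if "length ws = T" "set ws \<subseteq> {..<N}" for ws x
      using that by blast
    then have le: "v (word_app M ws x) \<le> (1 - \<delta>) * l ^ T * v x" if "length ws = T" "set ws \<subseteq> {..<N}" for ws x
      using that by (simp only: not_less)
    define \<mu> where "\<mu> = \<theta> * l"
    have \<mu>: "\<mu> > 0" "\<mu> < \<Lambda>" using \<theta> ml m l(2) by (auto simp: \<mu>_def field_simps)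
    have \<mu>T: "\<mu> ^ T = (1 - \<delta>) * l ^ T" by (simp add: \<mu>_def power_mult_distrib \<theta>)
    \<comment> \<open>The lengths stop at \<open>T - 1\<close>: a further letter in front of a
      longest word gives length \<open>T\<close>, and such a word is estimated through the empty
      one.\<close>
    define W where "W = {ws. set ws \<subseteq> {..<N} \<and> length ws \<le> T - 1}"
    have finW: "finite W" unfolding W_def by (rule finite_lists_length_le) simp
    define g where "g x ws = v (word_app M ws x) / \<mu> ^ length ws" for x ws
    define v' where "v' x = Max (g x ` W)" for x
    have nil: "[] \<in> W" by (simp add: W_def)
    have ge: "g x ws \<le> v' x" if "ws \<in> W" for x ws unfolding v'_def using finW that by (intro Max_ge) auto
    have leI: "v' x \<le> b" if "\<And>ws. ws \<in> W \<Longrightarrow> g x ws \<le> b" for x b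
      unfolding v'_def using finW nil that by (subst Max_le_iff) auto
    have gs: "g (c *s x) ws = cmod c * g x ws" for c x ws
      by (simp add: g_def word_app_smult cseminorm_smult[OF sv])
    have v0: "v x \<le> v' x" for x using ge[OF nil, of x] by (simp add: g_def)
    have v'nn: "0 \<le> v' x" for x using v0[of x] cseminorm_nonneg[OF sv, of x] by simp
    have "cnorm v'" unfolding cnorm_def cseminorm_def
    proof (intro conjI allI impI)
      fix x y c
      show "v' (x + y) \<le> v' x + v' y"
      proof (rule leI)
        fix ws assume ws: "ws \<in> W"
        have "g (x + y) ws \<le> g x ws + g y ws"
          using cseminorm_triangle[OF sv] \<mu>(1) by (simp add: g_def word_app_add add_divide_distrib[symmetric] divide_right_mono)
        then show "g (x + y) ws \<le> v' x + v' y" using ge[OF ws, of x] ge[OF ws, of y] by simp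
      qed
      show "v' (c *s x) = cmod c * v' x"
      proof (rule antisym)
        show "v' (c *s x) \<le> cmod c * v' x" using ge by (intro leI) (simp add: gs mult_left_mono)
        have "v' x \<in> g x ` W" unfolding v'_def using finW nil by (intro Max_in) auto
        then obtain ws where "ws \<in> W" "v' x = g x ws" by auto
        then show "cmod c * v' x \<le> v' (c *s x)" using ge[of ws "c *s x"] by (simp add: gs)
      qed
      assume "v' x = 0"
      then show "x = 0" using v0[of x] cseminorm_nonneg[OF sv, of x] dv by simp
    qed
    moreover have "dominated N M \<mu> v'" unfolding dominated_def
    proof (intro allI impI leI)
      fix i x ws assume i: "i < N" and ws: "ws \<in> W"
      have eq: "g (M i *v x) ws = \<mu> * (v (word_app M (i # ws) x) / \<mu> ^ length (i # ws))"
        using \<mu>(1) by (simp add: g_def)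
      have "v (word_app M (i # ws) x) / \<mu> ^ length (i # ws) \<le> v' x"
      proof (cases "length (i # ws) = T")
        case True
        then have "v (word_app M (i # ws) x) \<le> \<mu> ^ T * v x"
          using le[of "i # ws" x] i ws by (auto simp: W_def \<mu>T)
        then have "v (word_app M (i # ws) x) / \<mu> ^ length (i # ws) \<le> v x"
          unfolding True using \<mu>(1) by (simp add: divide_le_eq mult.commute)
        then show ?thesis using v0[of x] by simp
      next
        case False
        then have "i # ws \<in> W" using i ws T by (auto simp: W_def)
        then show ?thesis using ge[of "i # ws" x] by (simp add: g_def)
      qed
      then show "g (M i *v x) ws \<le> \<mu> * v' x" unfolding eq using \<mu>(1) by (intro mult_left_mono) auto
    qed
    ultimately have "\<mu> \<in> G" by (auto simp: G_def)
    then have "\<Lambda> \<le> \<mu>" unfolding \<Lambda>_def using bdd by (rule cInf_lower)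
    then show False using \<mu> by simp
  qed
  then show ?thesis using that v ml l(3) \<Lambda>(2) by fastforce
qed

section \<open>Compactness\<close>

lemma eventually_subseq: "strict_mono k \<Longrightarrow> eventually P sequentially \<Longrightarrow> \<forall>\<^sub>F n in sequentially. P (k n)"
  using filterlim_subseq[of k] by (simp add: filterlim_iff)

text \<open>Arzela-Ascoli by a diagonal sequence on a countable dense set. Equicontinuity is asked
  only for large \<open>n\<close> and up to an error \<open>\<epsilon> n\<close>, because the
  discrete trajectories will be step functions of time.\<close>

lemma pointwise_subsequence:
  fixes F :: "nat \<Rightarrow> 'i::countable \<Rightarrow> 'a::{metric_space,second_countable_topology} \<Rightarrow> 'b::{real_normed_vector,heine_borel}"
  assumes bnd: "\<And>n i a. norm (F n i a) \<le> M i a"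
    and equi: "\<And>i a b. \<forall>\<^sub>F n in sequentially. norm (F n i a - F n i b) \<le> L * dist a b + \<epsilon> n * c a b"
    and \<epsilon>: "\<epsilon> \<longlonglongrightarrow> 0" and L: "L \<ge> 0"
  obtains k where "strict_mono (k :: nat \<Rightarrow> nat)" "\<And>i a. \<exists>l. (\<lambda>n. F (k n) i a) \<longlonglongrightarrow> l"
proof -
  obtain D :: "'a set" where D: "countable D" "\<And>X. open X \<Longrightarrow> X \<noteq> {} \<Longrightarrow> \<exists>d\<in>D. d \<in> X"
    using countable_dense_exists by blast
  have M0: "0 \<le> M i a" for i a using order_trans[OF norm_ge_zero bnd[of 0 i a]] .
  \<comment> \<open>The selection theorem wants one bound at all points of the countable set;
    dividing by \<open>1 + M\<close> makes that bound 1.\<close>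
  obtain k where k: "strict_mono (k::nat\<Rightarrow>nat)"
    "\<And>q. q \<in> UNIV \<times> D \<Longrightarrow> \<exists>l. (\<lambda>n. F (k n) (fst q) (snd q) /\<^sub>R (1 + M (fst q) (snd q))) \<longlonglongrightarrow> l"
  proof (rule function_convergent_subsequence[of "UNIV \<times> D" "\<lambda>n q. F n (fst q) (snd q) /\<^sub>R (1 + M (fst q) (snd q))" 1])
    show "countable ((UNIV::'i set) \<times> D)" using D(1) by simp
    show "norm (F n (fst q) (snd q) /\<^sub>R (1 + M (fst q) (snd q))) \<le> 1" for n q
      using bnd[of n "fst q" "snd q"] M0[of "fst q" "snd q"] by (simp add: divide_inverse[symmetric] divide_le_eq mult.commute)
  qed blast
  have "\<exists>l. (\<lambda>n. F (k n) i a) \<longlonglongrightarrow> l" for i a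
  proof -
    have "Cauchy (\<lambda>n. F (k n) i a)"
    proof (rule metric_CauchyI)
      fix e :: real assume e: "e > 0"
      define \<delta> where "\<delta> = e / (8 * (L + 1))"
      have \<delta>: "\<delta> > 0" "L * \<delta> \<le> e / 8" using e L by (auto simp: \<delta>_def field_simps)
      obtain d where d: "d \<in> D" "d \<in> ball a \<delta>" using D(2)[of "ball a \<delta>"] \<delta> by auto
      obtain l where l: "(\<lambda>n. F (k n) i d /\<^sub>R (1 + M i d)) \<longlonglongrightarrow> l" using k(2)[of "(i,d)"] d(1) by auto
      have "(\<lambda>n. (1 + M i d) *\<^sub>R (F (k n) i d /\<^sub>R (1 + M i d))) \<longlonglongrightarrow> (1 + M i d) *\<^sub>R l"
        by (intro tendsto_intros l)
      then have "Cauchy (\<lambda>n. F (k n) i d)" using M0[of i d] by (intro LIMSEQ_imp_Cauchy) (simp add: add_nonneg_eq_0_iff)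
      then obtain n1 where n1: "\<And>m n. m \<ge> n1 \<Longrightarrow> n \<ge> n1 \<Longrightarrow> dist (F (k m) i d) (F (k n) i d) < e / 4"
        using metric_CauchyD[of _ "e/4"] e by (metis divide_pos_pos zero_less_numeral)
      have "(\<lambda>n. \<epsilon> n * c a d) \<longlonglongrightarrow> 0 * c a d" by (intro tendsto_intros \<epsilon>)
      then have "\<forall>\<^sub>F n in sequentially. \<epsilon> n * c a d < e / 8" using e by (intro order_tendstoD(2)) auto
      then have "\<forall>\<^sub>F n in sequentially. norm (F n i a - F n i d) \<le> e / 4"
        using equi[of i a d]
      proof eventually_elim
        case (elim n)
        have "L * dist a d \<le> L * \<delta>" using d(2) L by (intro mult_left_mono) auto
        then show ?case using elim \<delta>(2) by linarith
      qed
      then have "\<forall>\<^sub>F n in sequentially. norm (F (k n) i a - F (k n) i d) \<le> e / 4"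
        by (rule eventually_subseq[OF k(1)])
      then obtain n2 where n2: "\<And>n. n \<ge> n2 \<Longrightarrow> norm (F (k n) i a - F (k n) i d) \<le> e / 4"
        by (auto simp: eventually_sequentially)
      show "\<exists>M. \<forall>m\<ge>M. \<forall>n\<ge>M. dist (F (k m) i a) (F (k n) i a) < e"
      proof (intro exI[of _ "max n1 n2"] allI impI)
        fix m n assume mn: "max n1 n2 \<le> m" "max n1 n2 \<le> n"
        have "dist (F (k m) i a) (F (k n) i a) \<le> dist (F (k m) i a) (F (k m) i d) + dist (F (k m) i d) (F (k n) i d)
            + dist (F (k n) i d) (F (k n) i a)"
          using dist_triangle[of "F (k m) i a" "F (k n) i a" "F (k m) i d"] dist_triangle[of "F (k m) i d" "F (k n) i a" "F (k n) i d"] by linarith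
        moreover have "dist (F (k m) i a) (F (k m) i d) \<le> e/4" using n2[of m] mn by (simp add: dist_norm)
        moreover have "dist (F (k n) i d) (F (k n) i a) \<le> e/4" using n2[of n] mn by (simp add: dist_norm norm_minus_commute)
        moreover have "dist (F (k m) i d) (F (k n) i d) < e/4" using n1[of m n] mn by simp
        ultimately show "dist (F (k m) i a) (F (k n) i a) < e" using e by linarith
      qed
    qed
    then show ?thesis using Cauchy_convergent_iff convergent_def by blast
  qed
  then show ?thesis using that k(1) by blast
qed

text \<open>One limit passage for two purposes: with zero errors it gives compactness of the
  extremal trajectories, with errors of the grid size it takes discrete trajectories to continuous
  ones. The rates \<open>r n\<close> may vary as long as they converge.\<close>

lemma limit_driven:
  assumes C: "\<And>n t. norm (x n t) \<le> C"
    and Ub: "\<And>n i t. i < N \<Longrightarrow> \<bar>U n i t\<bar> \<le> \<bar>t\<bar> + 1"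
    and L: "L \<ge> 0" and \<epsilon>: "\<epsilon> \<longlonglongrightarrow> 0" and r: "r \<longlonglongrightarrow> \<rho>"
    and lip: "\<And>s t. s \<le> t \<Longrightarrow> \<forall>\<^sub>F n in sequentially. norm (x n t - x n s) \<le> L * (t - s) + \<epsilon> n * (1 + (t - s))"
    and mono: "\<And>s t. s \<le> t \<Longrightarrow> \<forall>\<^sub>F n in sequentially. \<forall>i<N. U n i s \<le> U n i t \<and> U n i t - U n i s \<le> (t - s) + \<epsilon> n * (1 + (t - s))"
    and sum: "\<And>s t. s \<le> t \<Longrightarrow> \<forall>\<^sub>F n in sequentially. \<bar>(\<Sum>i<N. U n i t - U n i s) - (t - s)\<bar> \<le> \<epsilon> n * (1 + (t - s))"
    and drv: "\<And>s t. s \<le> t \<Longrightarrow> \<forall>\<^sub>F n in sequentially.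
      norm (x n t - x n s - (\<Sum>i<N. (U n i t - U n i s) *\<^sub>R (A i *v x n s - r n *\<^sub>R x n s))) \<le> K * (t - s)\<^sup>2 + \<epsilon> n * (1 + (t - s))"
    and shift: "\<And>i y. B i *v y = A i *v y - \<rho> *\<^sub>R y"
  obtains k y V where "strict_mono (k::nat\<Rightarrow>nat)" "\<And>t. (\<lambda>n. x (k n) t) \<longlonglongrightarrow> y t" "controls N V" "driven N B K V y"
proof -
  obtain k1 where k1: "strict_mono (k1::nat\<Rightarrow>nat)" "\<And>i::unit. \<And>t. \<exists>l. (\<lambda>n. x (k1 n) t) \<longlonglongrightarrow> l"
  proof (rule pointwise_subsequence[of "\<lambda>n (i::unit) t. x n t" "\<lambda>i t. C" L \<epsilon> "\<lambda>s t. 1 + \<bar>t - s\<bar>"])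
    fix i :: unit and a b :: real
    show "\<forall>\<^sub>F n in sequentially. norm (x n a - x n b) \<le> L * dist a b + \<epsilon> n * (1 + \<bar>b - a\<bar>)"
      using lip[of a b] lip[of b a]
      by (cases "a \<le> b") (auto simp: dist_real_def norm_minus_commute abs_minus_commute)
  qed (use C L \<epsilon> in auto)
  define W where "W n i t = (if i < N then U (k1 n) i t else 0)" for n i t
  have \<epsilon>1: "(\<lambda>n. \<epsilon> (k1 n)) \<longlonglongrightarrow> 0" using LIMSEQ_subseq_LIMSEQ[OF \<epsilon> k1(1)] by (simp add: o_def)
  obtain k2 where k2: "strict_mono (k2::nat\<Rightarrow>nat)" "\<And>i t. \<exists>l. (\<lambda>n. W (k2 n) i t) \<longlonglongrightarrow> l"
  proof (rule pointwise_subsequence[of W "\<lambda>i t. \<bar>t\<bar> + 1" 1 "\<lambda>n. \<epsilon> (k1 n)" "\<lambda>s t. 1 + \<bar>t - s\<bar>"])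
    fix i :: nat and a b :: real
    show "\<forall>\<^sub>F n in sequentially. norm (W n i a - W n i b) \<le> 1 * dist a b + \<epsilon> (k1 n) * (1 + \<bar>b - a\<bar>)"
    proof (cases "i < N")
      case True
      have "\<forall>\<^sub>F n in sequentially. \<bar>U n i b - U n i a\<bar> \<le> \<bar>b - a\<bar> + \<epsilon> n * (1 + \<bar>b - a\<bar>)"
      proof (cases "a \<le> b")
        case True
        from mono[OF True] show ?thesis by eventually_elim (use \<open>i < N\<close> True in auto)
      next
        case False
        then have "b \<le> a" by simp
        from mono[OF this] show ?thesis
          by eventually_elim (use \<open>i < N\<close> \<open>b \<le> a\<close> in \<open>auto simp: abs_minus_commute\<close>)
      qed
      from eventually_subseq[OF k1(1) this] show ?thesis
        using True by (simp add: W_def dist_real_def abs_minus_commute)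
    next
      case False
      \<comment> \<open>For indices beyond \<open>N\<close> only nonnegativity of the error term is
        at stake; it follows from \<open>sum\<close>, where the term bounds an absolute
        value.\<close>
      have "\<forall>\<^sub>F n in sequentially. \<bar>(\<Sum>i<N. U n i (max a b) - U n i (min a b)) - (max a b - min a b)\<bar> \<le> \<epsilon> n * (1 + (max a b - min a b))"
        by (rule sum) simp
      then have "\<forall>\<^sub>F n in sequentially. 0 \<le> \<epsilon> n * (1 + (max a b - min a b))" by eventually_elim linarith
      moreover have "max a b - min a b = \<bar>b - a\<bar>" by (auto simp: max_def min_def)
      ultimately have "\<forall>\<^sub>F n in sequentially. 0 \<le> \<epsilon> n * (1 + \<bar>b - a\<bar>)" by simp
      from eventually_subseq[OF k1(1) this] show ?thesis
        by eventually_elim (use False in \<open>auto simp: W_def\<close>)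
    qed
  qed (use Ub \<epsilon>1 in \<open>auto simp: W_def\<close>)
  define k where "k = k1 \<circ> k2"
  have k: "strict_mono k" using strict_mono_o[OF k1(1) k2(1)] by (simp add: k_def)
  have \<epsilon>k: "(\<lambda>n. \<epsilon> (k n) * c) \<longlonglongrightarrow> 0" for c
    using tendsto_mult_right[OF LIMSEQ_subseq_LIMSEQ[OF \<epsilon> k], of c] by (simp add: o_def)
  have rk: "(\<lambda>n. r (k n)) \<longlonglongrightarrow> \<rho>" using LIMSEQ_subseq_LIMSEQ[OF r k] by (simp add: o_def)
  have "\<exists>l. (\<lambda>n. x (k n) t) \<longlonglongrightarrow> l" for t
    using k1(2)[of t] LIMSEQ_subseq_LIMSEQ[OF _ k2(1), of "\<lambda>n. x (k1 n) t"] by (auto simp: k_def o_def)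
  then obtain y where y: "\<And>t. (\<lambda>n. x (k n) t) \<longlonglongrightarrow> y t" by metis
  obtain V where V0: "\<And>i t. (\<lambda>n. W (k2 n) i t) \<longlonglongrightarrow> V i t" using k2(2) by metis
  have V: "(\<lambda>n. U (k n) i t) \<longlonglongrightarrow> V i t" if "i < N" for i t
    using V0[of i t] that by (simp add: W_def k_def)
  have "controls N V" unfolding controls_def
  proof (intro conjI allI impI)
    fix i s t assume i: "i < N" and st: "(s::real) \<le> t"
    from eventually_subseq[OF k mono[OF st]] have "\<forall>\<^sub>F n in sequentially. U (k n) i s \<le> U (k n) i t"
      by eventually_elim (use i in auto)
    then show "V i s \<le> V i t" using V[OF i] by (intro tendsto_le[OF sequentially_bot V[OF i] V[OF i]])
  next
    fix s t :: real
    have le: "(\<Sum>i<N. V i t - V i s) = t - s" if st: "s \<le> t" for s t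
    proof -
      have "(\<lambda>n. \<bar>(\<Sum>i<N. U (k n) i t - U (k n) i s) - (t - s)\<bar>) \<longlonglongrightarrow> \<bar>(\<Sum>i<N. V i t - V i s) - (t - s)\<bar>"
        by (intro tendsto_intros V) auto
      from tendsto_le[OF sequentially_bot \<epsilon>k this eventually_subseq[OF k sum[OF st]]]
      show ?thesis by simp
    qed
    show "(\<Sum>i<N. V i t - V i s) = t - s"
    proof (cases "s \<le> t")
      case False
      then have "(\<Sum>i<N. V i s - V i t) = s - t" using le[of t s] by simp
      then show ?thesis by (simp add: sum_subtractf)
    qed (rule le)
  qed
  moreover have "driven N B K V y" unfolding driven_def
  proof (intro allI impI)
    fix s t :: real assume st: "s \<le> t"
    have 1: "(\<lambda>n. norm (x (k n) t - x (k n) s - (\<Sum>i<N. (U (k n) i t - U (k n) i s) *\<^sub>R (A i *v x (k n) s - r (k n) *\<^sub>R x (k n) s))))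
      \<longlonglongrightarrow> norm (y t - y s - (\<Sum>i<N. (V i t - V i s) *\<^sub>R (A i *v y s - \<rho> *\<^sub>R y s)))"
      by (intro tendsto_intros V y rk bounded_linear.tendsto[OF bounded_linear_matrix]) auto
    have "(\<lambda>n. K * (t - s)\<^sup>2 + \<epsilon> (k n) * (1 + (t - s))) \<longlonglongrightarrow> K * (t - s)\<^sup>2 + 0"
      by (intro tendsto_intros \<epsilon>k)
    from tendsto_le[OF sequentially_bot this 1 eventually_subseq[OF k drv[OF st]]]
    show "norm (y t - y s - (\<Sum>i<N. (V i t - V i s) *\<^sub>R (B i *v y s))) \<le> K * (t - s)\<^sup>2"
      by (simp add: shift)
  qed
  ultimately show ?thesis using that k y by blast
qed

lemma extremal_shift:
  assumes "extremal N B K v x" shows "extremal N B K v (\<lambda>t. x (t + c))"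
proof -
  obtain U where U: "controls N U" "driven N B K U x" using assms by (auto simp: extremal_def)
  have "controls N (\<lambda>i t. U i (t + c))"
    using controls_mono[OF U(1)] controls_sum[OF U(1)] by (simp add: controls_def)
  moreover have "driven N B K (\<lambda>i t. U i (t + c)) (\<lambda>t. x (t + c))" unfolding driven_def
  proof (intro allI impI)
    fix s t :: real assume "s \<le> t"
    then have "s + c \<le> t + c" by simp
    with U(2) have "norm (x (t + c) - x (s + c) - (\<Sum>i<N. (U i (t + c) - U i (s + c)) *\<^sub>R (B i *v x (s + c))))
       \<le> K * ((t + c) - (s + c))\<^sup>2" unfolding driven_def by blast
    then show "norm (x (t + c) - x (s + c) - (\<Sum>i<N. (U i (t + c) - U i (s + c)) *\<^sub>R (B i *v x (s + c)))) \<le> K * (t - s)\<^sup>2"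
      by simp
  qed
  ultimately show ?thesis using assms by (auto simp: extremal_def)
qed

lemma extremal_smult:
  assumes x: "extremal N B K v x" and v: "cseminorm v" and c: "cmod c = 1"
  shows "extremal N B K v (\<lambda>t. c *s x t)"
proof -
  obtain U where U: "controls N U" "driven N B K U x" using x by (auto simp: extremal_def)
  have "driven N B K U (\<lambda>t. c *s x t)" unfolding driven_def
  proof (intro allI impI)
    fix s t :: real assume st: "s \<le> t"
    have "(\<Sum>i<N. (U i t - U i s) *\<^sub>R (B i *v (c *s x s))) = c *s (\<Sum>i<N. (U i t - U i s) *\<^sub>R (B i *v x s))"
      unfolding vec.scale_sum_right
      by (rule sum.cong) (simp_all only: matrix_smult scaleR_eq_smult vector_smult_assoc mult.commute)
    then have "c *s x t - c *s x s - (\<Sum>i<N. (U i t - U i s) *\<^sub>R (B i *v (c *s x s)))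
       = c *s (x t - x s - (\<Sum>i<N. (U i t - U i s) *\<^sub>R (B i *v x s)))"
      by (simp add: vector_ssub_ldistrib)
    then have "norm (c *s x t - c *s x s - (\<Sum>i<N. (U i t - U i s) *\<^sub>R (B i *v (c *s x s))))
       = norm (x t - x s - (\<Sum>i<N. (U i t - U i s) *\<^sub>R (B i *v x s)))" by (simp only: norm_smult c mult_1_left)
    then show "norm (c *s x t - c *s x s - (\<Sum>i<N. (U i t - U i s) *\<^sub>R (B i *v (c *s x s)))) \<le> K * (t - s)\<^sup>2"
      using U(2) st by (simp add: driven_def)
  qed
  then show ?thesis using x U c by (auto simp: extremal_def cseminorm_smult[OF v])
qed

lemma extremal_compact:
  assumes v: "cnorm v" and K: "K \<ge> 0" and x: "\<And>n. extremal N B K v (x n)"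
  obtains k y where "strict_mono (k::nat\<Rightarrow>nat)" "extremal N B K v y" "\<And>t. (\<lambda>n. x (k n) t) \<longlonglongrightarrow> y t"
proof -
  obtain C L where CL: "C > 0" "L > 0" "\<And>n t. norm (x n t) \<le> C" "\<And>n s t. norm (x n t - x n s) \<le> L * \<bar>t - s\<bar>"
    using extremal_Lipschitz[OF v K, of N B] x by metis
  have "\<exists>U. controls N U \<and> driven N B K U (x n)" for n using x by (simp add: extremal_def)
  then obtain U where U: "\<And>n. controls N (U n)" "\<And>n. driven N B K (U n) (x n)" by metis
  \<comment> \<open>Integrated controls are determined up to constants; fixing their value at time 0
    makes the sequence bounded at every time.\<close>
  define W where "W n i t = U n i t - U n i 0" for n i t
  obtain k y V where k: "strict_mono (k::nat\<Rightarrow>nat)" "\<And>t. (\<lambda>n. x (k n) t) \<longlonglongrightarrow> y t" "controls N V" "driven N B K V y"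
  proof (rule limit_driven[of x C N W L "\<lambda>_. 0" "\<lambda>_. 0" 0 B K B])
    fix n i t assume i: "i < N"
    show "\<bar>W n i t\<bar> \<le> \<bar>t\<bar> + 1"
      using controls_mono[OF U(1) i, of 0 t n] controls_mono[OF U(1) i, of t 0 n]
        controls_le[OF U(1) i, of 0 t n] controls_le[OF U(1) i, of t 0 n] by (cases "0 \<le> t") (auto simp: W_def)
  next
    fix s t :: real assume st: "s \<le> t"
    show "\<forall>\<^sub>F n in sequentially. norm (x n t - x n s) \<le> L * (t - s) + 0 * (1 + (t - s))"
      using CL(4)[of _ t s] st by simp
    show "\<forall>\<^sub>F n in sequentially. \<forall>i<N. W n i s \<le> W n i t \<and> W n i t - W n i s \<le> t - s + 0 * (1 + (t - s))"
      using controls_mono[OF U(1) _ st] controls_le[OF U(1) _ st] by (simp add: W_def)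
    show "\<forall>\<^sub>F n in sequentially. \<bar>(\<Sum>i<N. W n i t - W n i s) - (t - s)\<bar> \<le> 0 * (1 + (t - s))"
      using controls_sum[OF U(1)] by (simp add: W_def)
    show "\<forall>\<^sub>F n in sequentially. norm (x n t - x n s - (\<Sum>i<N. (W n i t - W n i s) *\<^sub>R (B i *v x n s - 0 *\<^sub>R x n s)))
        \<le> K * (t - s)\<^sup>2 + 0 * (1 + (t - s))"
      using U(2) st by (simp add: W_def driven_def)
  qed (use CL in auto)
  have "v (y t) = 1" for t
  proof -
    have sv: "cseminorm v" using v by (simp add: cnorm_def)
    have "isCont v (y t)" using cseminorm_continuous[OF sv, of UNIV] by (simp add: continuous_on_eq_continuous_at)
    from isCont_tendsto_compose[OF this k(2)] have "(\<lambda>n. v (x (k n) t)) \<longlonglongrightarrow> v (y t)" .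
    moreover have "v (x (k n) t) = 1" for n using x by (simp add: extremal_def)
    ultimately show ?thesis by (simp add: LIMSEQ_const_iff)
  qed
  then show ?thesis using that k by (auto simp: extremal_def)
qed

section \<open>Existence of extremal trajectories\<close>

text \<open>Take a Euclidean unit vector where \<open>v\<close> is minimal: \<open>M 0\<close>
  reduces its Euclidean norm by at most \<open>h * R\<close>. This yields the positive lower bound
  on rates that the search for nearly extremal words requires.\<close>

lemma dominated_lower_bound:
  assumes R: "\<And>y. norm (A 0 *v y) \<le> R * norm y" and h: "h \<ge> 0" and N: "N > 0"
    and M: "\<And>i y. M i *v y = y + h *\<^sub>R (A i *v y)" and v: "cnorm v" and d: "dominated N M l v"
  shows "1 - h * R \<le> l"
proof -
  have sv: "cseminorm v" and dv: "\<And>x. v x = 0 \<Longrightarrow> x = 0" using v by (auto simp: cnorm_def)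
  have ne: "sphere (0::complex^2) 1 \<noteq> {}" by (simp add: sphere_empty)
  obtain x0 where x0: "x0 \<in> sphere 0 1" "\<And>x. x \<in> sphere 0 1 \<Longrightarrow> v x0 \<le> v x"
    using continuous_attains_inf[OF compact_sphere ne cseminorm_continuous[OF sv]] by blast
  have nx0: "norm x0 = 1" using x0(1) by simp
  have v0: "v x0 > 0" using dv[of x0] nx0 cseminorm_nonneg[OF sv, of x0] by force
  have hom: "v x0 * norm y \<le> v y" for y
  proof (cases "y = 0")
    case False
    then have "v x0 \<le> v ((1 / norm y) *\<^sub>R y)" by (intro x0(2)) simp
    then show ?thesis using False by (simp add: cseminorm_scaleR[OF sv] field_simps)
  qed (simp add: cseminorm_0[OF sv])
  have "norm (h *\<^sub>R (A 0 *v x0)) \<le> h * R" using R[of x0] h nx0 by (simp add: mult_left_mono)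
  then have "1 - h * R \<le> norm (M 0 *v x0)"
    unfolding M using norm_diff_ineq[of x0 "h *\<^sub>R (A 0 *v x0)"] nx0 by linarith
  then have "v x0 * (1 - h * R) \<le> v x0 * norm (M 0 *v x0)" using v0 by (intro mult_left_mono) auto
  also have "\<dots> \<le> v (M 0 *v x0)" by (rule hom)
  also have "\<dots> \<le> l * v x0" using d N by (simp add: dominated_def)
  finally have "v x0 * (1 - h * R) \<le> v x0 * l" by (simp add: mult.commute)
  then show ?thesis using v0 by simp
qed

text \<open>A finite approximation of an extremal trajectory. The prefixes of a nearly extremal
  word, applied to a vector and divided by powers of the rate, form an Euler polygon of the shifted
  system along which \<open>v\<close> hardly drops.\<close>

lemma discrete_extremal:
  assumes N: "N > 0" and nG: "\<not> GUES N A"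
    and R: "R > 0" "\<And>i y. i < N \<Longrightarrow> norm (A i *v y) \<le> R * norm y"
    and \<eta>: "0 < \<eta>" "\<eta> < 1"
  shows "\<exists>r \<sigma> v (z :: nat \<Rightarrow> complex^2) w p. 0 \<le> r \<and> r \<le> R + 1 \<and> 0 < \<sigma> \<and> \<sigma> \<le> \<eta> \<and> cnorm v \<and> (\<forall>x. v x \<le> norm x) \<and>
     (\<exists>x. norm x = 1 \<and> v x = 1) \<and>
     (\<forall>i<N. \<forall>x. \<forall>s\<ge>0. v x \<le> v (x - s *\<^sub>R (A i *v x - r *\<^sub>R x))) \<and>
     (\<forall>k. w k < N) \<and> real p * \<sigma> \<ge> 1 / \<eta> \<and>
     (\<forall>k<2 * p. z (Suc k) = z k + \<sigma> *\<^sub>R (A (w k) *v z k - r *\<^sub>R z k)) \<and>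
     (\<forall>k\<le>2 * p. 1 - \<eta> \<le> v (z k) \<and> v (z k) \<le> 1)"
proof -
  \<comment> \<open>Chosen so that \<open>h * R + h = \<eta> / 2\<close>, which bounds
    \<open>h * R\<close> and \<open>h\<close> at the same time.\<close>
  define h where "h = \<eta> / (2 * (R + 1))"
  have h: "h > 0" "h * R < 1 / 2" "h \<le> \<eta> / 2" 
  proof -
    show h0: "h > 0" using R(1) \<eta> by (simp add: h_def)
    have "x / (2 * y) * y = x / 2" if "y \<noteq> 0" for x y :: real using that by simp
    moreover have "R + 1 \<noteq> 0" using R(1) by linarith
    ultimately have "h * (R + 1) = \<eta> / 2" unfolding h_def by blast
    then have e: "h * R + h = \<eta> / 2" by (simp add: distrib_left)
    show "h * R < 1 / 2" using e h0 \<eta> by linarith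
    have "h * R \<ge> 0" using h0 R(1) by simp
    then show "h \<le> \<eta> / 2" using e by linarith
  qed
  define M where "M i = mat 1 + h *\<^sub>R A i" for i
  have M: "M i *v y = y + h *\<^sub>R (A i *v y)" for i y
    by (simp add: M_def vec_eq_iff forall_2 matrix_vector_mult_def sum_2 mat_def algebra_simps)
  have low: "1 - h * R \<le> l" if "cnorm v" "dominated N M l v" for l v
    using dominated_lower_bound[OF R(2)[OF N] _ N M that] h by simp
  have up: "dominated N M (1 + h * R) norm" unfolding dominated_def
  proof (intro allI impI)
    fix i x assume i: "i < N"
    have "norm (h *\<^sub>R (A i *v x)) \<le> h * (R * norm x)" using R(2)[OF i, of x] h by (simp add: mult_left_mono)
    then show "norm (M i *v x) \<le> (1 + h * R) * norm x"
      unfolding M using norm_triangle_ineq[of x "h *\<^sub>R (A i *v x)"] by (simp add: algebra_simps)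
  qed
  \<comment> \<open>The factor 2 pays for the bound \<open>\<sigma> \<ge> h / 2\<close> below. A
    word of length \<open>2 * p\<close> then leaves time at least \<open>1 / \<eta>\<close> on each
    side of its middle.\<close>
  define p where "p = nat \<lceil>2 / (\<eta> * h)\<rceil> + 1"
  have p: "real p \<ge> 2 / (\<eta> * h)" "p > 0" unfolding p_def by linarith+
  have "1 - h * R > 0" "2 * p > 0" using h p by auto
  obtain v0 l ws x0 where v0: "cnorm v0" "dominated N M l v0" "1 - h * R \<le> l" "l \<le> (1 + h * R) + h"
    "length ws = 2 * p" "set ws \<subseteq> {..<N}" "(1 - \<eta>) * l ^ (2 * p) * v0 x0 < v0 (word_app M ws x0)"
  proof (rule near_extremal_word[where \<epsilon> = h and \<delta> = \<eta>])
    show "1 - h * R > 0" "2 * p > 0" by fact+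
  qed (use low up \<eta> h(1) in auto)
  have lpos: "l > 0" using v0(3) h by linarith
  have sv0: "cseminorm v0" and dv0: "\<And>x. v0 x = 0 \<Longrightarrow> x = 0" using v0(1) by (auto simp: cnorm_def)
  define r where "r = (l - 1) / h"
  have lr: "l = 1 + h * r" using h by (simp add: r_def)
  \<comment> \<open>A negative rate would be a contracting norm, that is, exponential
    stability.\<close>
  have r0: "r \<ge> 0"
  proof (rule ccontr)
    assume "\<not> r \<ge> 0"
    then have "GUES N A" using v0(2)
      by (intro GUES_criterion[OF v0(1) h(1), of r]) (auto simp: dominated_def M lr)
    then show False using nG by simp
  qed
  have "h * r \<le> h * (R + 1)" using v0(4) lr by (simp add: algebra_simps)
  then have r1: "r \<le> R + 1" using h(1) by simp
  have ne: "sphere (0::complex^2) 1 \<noteq> {}" by (simp add: sphere_empty)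
  obtain x1 where x1: "x1 \<in> sphere 0 1" "\<And>x. x \<in> sphere 0 1 \<Longrightarrow> v0 x \<le> v0 x1"
    using continuous_attains_sup[OF compact_sphere ne cseminorm_continuous[OF sv0]] by blast
  have nx1: "norm x1 = 1" using x1(1) by simp
  define a where "a = v0 x1"
  have a: "a > 0" using dv0[of x1] nx1 cseminorm_nonneg[OF sv0, of x1] by (force simp: a_def)
  \<comment> \<open>The maximum on the Euclidean sphere becomes 1: the upper bound makes all these
    norms equicontinuous, the attained value keeps their limit from vanishing.\<close>
  define v where "v x = v0 x / a" for x
  have v: "cnorm v" using a dv0 cseminorm_triangle[OF sv0]
    by (auto simp: cnorm_def cseminorm_def v_def cseminorm_smult[OF sv0] add_divide_distrib[symmetric] divide_right_mono)
  have sv: "cseminorm v" using v by (simp add: cnorm_def)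
  have vle: "v x \<le> norm x" for x
  proof (cases "x = 0")
    case False
    then have "v0 ((1 / norm x) *\<^sub>R x) \<le> a" unfolding a_def by (intro x1(2)) simp
    then show ?thesis using False a by (simp add: cseminorm_scaleR[OF sv0] v_def field_simps)
  qed (simp add: cseminorm_0[OF sv])
  have v1: "norm x1 = 1 \<and> v x1 = 1" using nx1 a by (simp add: v_def a_def)
  have dom: "v (x + h *\<^sub>R (A i *v x)) \<le> l * v x" if "i < N" for i x
    using v0(2) that a unfolding dominated_def M v_def by (simp add: divide_right_mono)
  \<comment> \<open>A multiple of \<open>x\<close> is the sum of this backward step and a multiple
    of the Euler step of size \<open>h\<close>. The triangle inequality then gives a bound in which
    \<open>h\<close> no longer occurs.\<close>
  have diss: "v x \<le> v (x - s *\<^sub>R (A i *v x - r *\<^sub>R x))" if i: "i < N" and s: "s \<ge> 0" for i x s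
  proof -
    let ?y = "x - s *\<^sub>R (A i *v x - r *\<^sub>R x)"
    have "(1 + s * r + s / h) *\<^sub>R x = ?y + (s / h) *\<^sub>R (x + h *\<^sub>R (A i *v x))"
      using h by (simp add: algebra_simps)
    then have "v ((1 + s * r + s / h) *\<^sub>R x) \<le> v ?y + v ((s / h) *\<^sub>R (x + h *\<^sub>R (A i *v x)))"
      using cseminorm_triangle[OF sv, of ?y "(s / h) *\<^sub>R (x + h *\<^sub>R (A i *v x))"] by simp
    also have "\<dots> = v ?y + (s / h) * v (x + h *\<^sub>R (A i *v x))"
      using h s by (simp add: cseminorm_scaleR[OF sv])
    also have "\<dots> \<le> v ?y + (s / h) * (l * v x)"
      using dom[OF i, of x] h s by (intro add_left_mono mult_left_mono) auto
    also have "(s / h) * (l * v x) = (s * r + s / h) * v x" using h by (simp add: lr field_simps)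
    finally have "\<bar>1 + s * r + s / h\<bar> * v x \<le> v ?y + (s * r + s / h) * v x"
      by (simp only: cseminorm_scaleR[OF sv])
    moreover have "0 \<le> 1 + s * r + s / h" using s r0 h by simp
    ultimately show ?thesis by (simp add: algebra_simps)
  qed
  \<comment> \<open>Division by \<open>l\<close> turns the step \<open>h\<close> for
    \<open>A\<close> into the step \<open>h / l\<close> for the shifted matrix, because
    \<open>1 - h * r / l = 1 / l\<close>.\<close>
  define \<sigma> where "\<sigma> = h / l"
  have l1: "l \<ge> 1" using lr r0 h by simp
  have l2: "l \<le> 2" using v0(4) h \<eta> by linarith
  have \<sigma>: "0 < \<sigma>" "\<sigma> \<le> \<eta>" "\<sigma> \<ge> h / 2"
  proof -
    show "0 < \<sigma>" using h lpos by (simp add: \<sigma>_def)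
    have "\<sigma> \<le> h" using l1 h by (simp add: \<sigma>_def divide_le_eq)
    then show "\<sigma> \<le> \<eta>" using h \<eta> by linarith
    show "\<sigma> \<ge> h / 2" unfolding \<sigma>_def using h l2 lpos by (intro divide_left_mono) auto
  qed
  have "1 / \<eta> = 2 / (\<eta> * h) * (h / 2)" using h \<eta> by simp
  also have "\<dots> \<le> real p * \<sigma>" using p \<sigma> h by (intro mult_mono) auto
  finally have p\<sigma>: "real p * \<sigma> \<ge> 1 / \<eta>" .
  have vx0: "v x0 > 0"
  proof (rule ccontr)
    assume "\<not> v x0 > 0"
    then have "x0 = 0" using cseminorm_nonneg[OF sv, of x0] v by (auto simp: cnorm_def)
    moreover have "word_app M ws 0 = 0" using word_app_smult[of M ws 0 0] by simp
    ultimately show False using v0(7) by (simp add: cseminorm_0[OF sv0])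
  qed
  define w where "w k = (if k < 2 * p then ws ! k else 0)" for k
  have w: "w k < N" for k
  proof (cases "k < 2 * p")
    case True
    then have "ws ! k \<in> set ws" using v0(5) by (intro nth_mem) simp
    then show ?thesis using v0(6) True by (auto simp: w_def)
  qed (use N in \<open>simp add: w_def\<close>)
  define q where "q = v x0"
  define z where "z k = (1 / (l ^ k * q)) *\<^sub>R word_app M (take k ws) x0" for k
  have wa: "word_app M (us @ [i]) x = M i *v word_app M us x" for us i x
    by (simp add: word_app_def)
  have step: "z (Suc k) = (1 / l) *\<^sub>R (M (w k) *v z k)" if "k < 2 * p" for k
    using that v0(5) lpos by (simp add: z_def take_Suc_conv_app_nth wa w_def matrix_scaleR)
  have step': "z (Suc k) = z k + \<sigma> *\<^sub>R (A (w k) *v z k - r *\<^sub>R z k)" if "k < 2 * p" for k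
  proof -
    have "z k + \<sigma> *\<^sub>R (A (w k) *v z k - r *\<^sub>R z k) = (1 - h * r / l) *\<^sub>R z k + (h / l) *\<^sub>R (A (w k) *v z k)"
      by (simp add: \<sigma>_def algebra_simps)
    also have "1 - h * r / l = 1 / l" using lpos lr by (simp add: field_simps)
    finally show ?thesis unfolding step[OF that] M by (simp add: scaleR_add_right)
  qed
  have dec: "v (z (Suc k)) \<le> v (z k)" if "k < 2 * p" for k
  proof -
    have "v (z (Suc k)) = (1 / l) * v (M (w k) *v z k)"
      unfolding step[OF that] using lpos by (simp add: cseminorm_scaleR[OF sv])
    also have "\<dots> \<le> (1 / l) * (l * v (z k))"
      using dom[OF w, of "z k"] lpos by (intro mult_left_mono) (auto simp: M)
    finally show ?thesis using lpos by simp
  qed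
  have z0: "v (z 0) = 1" using vx0 by (simp add: z_def q_def cseminorm_scaleR[OF sv])
  have "(1 - \<eta>) * l ^ (2 * p) * v x0 < v (word_app M ws x0)"
    using v0(7) a by (simp add: v_def divide_strict_right_mono)
  then have zT: "1 - \<eta> \<le> v (z (2 * p))"
    using vx0 lpos v0(5) by (simp add: z_def q_def cseminorm_scaleR[OF sv] field_simps)
  \<comment> \<open>\<open>v\<close> does not increase along \<open>z\<close>, so the lower bound at
    the last index, where the word is nearly extremal, holds at all indices.\<close>
  have zle: "v (z j) \<le> v (z k)" if "k \<le> j" "j \<le> 2 * p" for j k
    using that
  proof (induction j rule: dec_induct)
    case (step n)
    then show ?case using dec[of n] by simp
  qed simp
  have "1 - \<eta> \<le> v (z k) \<and> v (z k) \<le> 1" if "k \<le> 2 * p" for k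
    using zle[of k "2 * p"] zle[of 0 k] zT z0 that by simp
  moreover have "\<exists>x. norm x = 1 \<and> v x = 1" using v1 by blast
  ultimately show ?thesis
    using r0 r1 \<sigma>(1,2) v vle diss w p\<sigma> step'
    by (intro exI[of _ r] exI[of _ \<sigma>] exI[of _ v] exI[of _ z] exI[of _ w] exI[of _ p] conjI allI impI) simp_all
qed

section \<open>Euler polygons and their integrated controls\<close>

definition word_count :: "(nat \<Rightarrow> nat) \<Rightarrow> nat \<Rightarrow> nat \<Rightarrow> real" where
  "word_count w i j = (\<Sum>k<j. of_bool (w k = i))"

lemma word_count_Suc: "word_count w i (Suc j) = word_count w i j + of_bool (w j = i)"
  by (simp add: word_count_def)

lemma word_count_mono: "j \<le> k \<Longrightarrow> word_count w i j \<le> word_count w i k"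
  unfolding word_count_def by (intro sum_mono2) auto

lemma sum_word_count:
  assumes "\<And>k. w k < N" shows "(\<Sum>i<N. word_count w i j) = real j"
proof (induction j)
  case (Suc j)
  have "(\<Sum>i<N. of_bool (w j = i) :: real) = 1" using assms[of j] by (simp add: of_bool_def)
  then show ?case using Suc by (simp add: word_count_Suc sum.distrib)
qed (simp add: word_count_def)

lemma word_count_diff_le:
  assumes "j \<le> k" shows "word_count w i k - word_count w i j \<le> real k - real j"
  using assms
proof (induction k rule: dec_induct)
  case (step n)
  then show ?case by (simp add: word_count_Suc of_bool_def)
qed simp

text \<open>The discrete form of \<open>driven\<close>, with \<open>\<sigma>\<close> times the
  letter counts as integrated controls. Replacing \<open>z n\<close> by \<open>z j\<close> in a
  single step costs \<open>\<sigma> * R * norm (z n - z j)\<close>, which grows linearly in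
  \<open>n - j\<close> and so sums to a quadratic error.\<close>

lemma euler_estimates:
  fixes A :: "nat \<Rightarrow> complex^2^2"
  assumes step: "\<And>k. k < T \<Longrightarrow> z (Suc k) = z k + \<sigma> *\<^sub>R (A (w k) *v z k - r *\<^sub>R z k)"
    and w: "\<And>k. w k < N" and R: "\<And>i y. i < N \<Longrightarrow> norm (A i *v y - r *\<^sub>R y) \<le> R * norm y" "R \<ge> 0"
    and C: "\<And>k. k \<le> T \<Longrightarrow> norm (z k) \<le> C" and \<sigma>: "\<sigma> \<ge> 0" and jk: "j \<le> k" "k \<le> T"
  shows "norm (z k - z j) \<le> R * C * (\<sigma> * (real k - real j))"
    and "norm (z k - z j - (\<Sum>i<N. (\<sigma> * (word_count w i k - word_count w i j)) *\<^sub>R (A i *v z j - r *\<^sub>R z j)))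
      \<le> R * (R * C) * (\<sigma> * (real k - real j))\<^sup>2"
proof -
  define E where "E i y = A i *v y - r *\<^sub>R y" for i y
  have E: "norm (E i y) \<le> R * norm y" if "i < N" for i y using R(1)[OF that] by (simp add: E_def)
  have st: "z (Suc n) = z n + \<sigma> *\<^sub>R E (w n) (z n)" if "n < T" for n using step[OF that] by (simp add: E_def)
  have C0: "0 \<le> C" using C[of 0] norm_ge_zero[of "z 0"] by linarith
  have 1: "norm (z k - z j) \<le> R * C * (\<sigma> * (real k - real j))" if "j \<le> k" "k \<le> T" for k
    using that
  proof (induction k rule: dec_induct)
    case (step n)
    have "norm (\<sigma> *\<^sub>R E (w n) (z n)) \<le> \<sigma> * (R * C)"
      using order_trans[OF E[OF w, of n "z n"] mult_left_mono[OF C R(2), of n]] step \<sigma> by (simp add: mult_left_mono)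
    moreover have "norm (z n - z j) \<le> R * C * (\<sigma> * (real n - real j))" using step by simp
    moreover have eq: "z (Suc n) - z j = (z n - z j) + \<sigma> *\<^sub>R E (w n) (z n)" using st[of n] step by simp
    ultimately have "norm (z (Suc n) - z j) \<le> R * C * (\<sigma> * (real n - real j)) + \<sigma> * (R * C)"
      unfolding eq using norm_triangle_ineq[of "z n - z j" "\<sigma> *\<^sub>R E (w n) (z n)"] by linarith
    then show ?case by (simp add: algebra_simps)
  qed simp
  show "norm (z k - z j) \<le> R * C * (\<sigma> * (real k - real j))" using 1 jk by blast
  have 2: "norm (z k - z j - (\<Sum>i<N. (\<sigma> * (word_count w i k - word_count w i j)) *\<^sub>R E i (z j)))
      \<le> R * (R * C) * (\<sigma> * (real k - real j))\<^sup>2" if "j \<le> k" "k \<le> T" for k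
    using that
  proof (induction k rule: dec_induct)
    case (step n)
    define S where "S n = (\<Sum>i<N. (\<sigma> * (word_count w i n - word_count w i j)) *\<^sub>R E i (z j))" for n
    have "(\<Sum>i<N. of_bool (w n = i) *\<^sub>R E i (z j)) = (\<Sum>i<N. if i = w n then E i (z j) else 0)"
      by (rule sum.cong) auto
    then have d: "(\<Sum>i<N. of_bool (w n = i) *\<^sub>R E i (z j)) = E (w n) (z j)" using w[of n] by simp
    have "S (Suc n) = S n + \<sigma> *\<^sub>R (\<Sum>i<N. of_bool (w n = i) *\<^sub>R E i (z j))"
      unfolding S_def scaleR_sum_right sum.distrib[symmetric]
      by (rule sum.cong) (simp_all add: word_count_Suc algebra_simps)
    then have "z (Suc n) - z j - S (Suc n) = (z n - z j - S n) + \<sigma> *\<^sub>R (E (w n) (z n) - E (w n) (z j))"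
      using st[of n] step d by (simp add: algebra_simps)
    also have "E (w n) (z n) - E (w n) (z j) = E (w n) (z n - z j)"
    proof -
      have "a - b - (c - d) = a - c - (b - d)" for a b c d :: "complex^2" by simp
      then show ?thesis unfolding E_def matrix_vector_mult_diff_distrib scaleR_diff_right by blast
    qed
    finally have eq: "z (Suc n) - z j - S (Suc n) = (z n - z j - S n) + \<sigma> *\<^sub>R E (w n) (z n - z j)" .
    have "norm (E (w n) (z n - z j)) \<le> R * (R * C * (\<sigma> * (real n - real j)))"
      using order_trans[OF E[OF w] mult_left_mono[OF 1[of n] R(2)]] step by simp
    then have "norm (\<sigma> *\<^sub>R E (w n) (z n - z j)) \<le> \<sigma> * (R * (R * C * (\<sigma> * (real n - real j))))"
      using \<sigma> by (simp add: mult_left_mono)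
    moreover have "norm (z n - z j - S n) \<le> R * (R * C) * (\<sigma> * (real n - real j))\<^sup>2"
      using step by (simp add: S_def)
    ultimately have "norm (z (Suc n) - z j - S (Suc n)) \<le> R * (R * C) * (\<sigma> * (real n - real j))\<^sup>2
        + \<sigma> * (R * (R * C * (\<sigma> * (real n - real j))))"
      unfolding eq using norm_triangle_ineq[of "z n - z j - S n" "\<sigma> *\<^sub>R E (w n) (z n - z j)"] by linarith
    also have "\<dots> = R * (R * C) * \<sigma>\<^sup>2 * ((real n - real j)\<^sup>2 + (real n - real j))"
      by (simp add: power2_eq_square algebra_simps)
    also have "\<dots> \<le> R * (R * C) * \<sigma>\<^sup>2 * (real (Suc n) - real j)\<^sup>2"
      using R(2) C0 step by (intro mult_left_mono) (auto simp: power2_eq_square algebra_simps)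
    also have "\<dots> = R * (R * C) * (\<sigma> * (real (Suc n) - real j))\<^sup>2" by (simp add: power_mult_distrib)
    finally show ?case by (simp add: S_def)
  qed (simp)
  show "norm (z k - z j - (\<Sum>i<N. (\<sigma> * (word_count w i k - word_count w i j)) *\<^sub>R (A i *v z j - r *\<^sub>R z j)))
      \<le> R * (R * C) * (\<sigma> * (real k - real j))\<^sup>2"
    using 2[OF jk] by (simp add: E_def)
qed

(* The hypothesis diss is the form of v (x + h (A x - r x)) \<le> v x that no longer mentions the step h
   and hence survives the limit h \<rightarrow> 0. *)
lemma common_eigenvector:
  assumes v: "cseminorm v" and e: "e \<noteq> 0" "v e = 0" and ne: "\<exists>x. v x \<noteq> 0"
    and le: "\<And>x. v x \<le> norm x"
    and diss: "\<And>x s. s \<ge> 0 \<Longrightarrow> v x \<le> v (x - s *\<^sub>R (A *v x - r *\<^sub>R x))"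
  shows "\<exists>\<alpha>. A *v e = \<alpha> *s e"
proof -
  define E where "E x = A *v x - r *\<^sub>R x" for x
  have Esub: "E (x + s *\<^sub>R y) = E x + s *\<^sub>R E y" for x y s
    by (simp add: E_def matrix_vector_right_distrib matrix_scaleR algebra_simps)
  have bnd: "s * v (E e) \<le> s\<^sup>2 * norm (E (E e))" if s: "s > 0" for s
  proof -
    \<comment> \<open>At this point the first-order terms cancel: the backward step leads to
      \<open>e - s\<^sup>2 *\<^sub>R E (E e)\<close>. Thus \<open>s * v (E e)\<close> is of order
      s^2, and \<open>v (E e)\<close> must be 0.\<close>
    let ?y = "e + s *\<^sub>R E e"
    have "v ?y \<le> v (?y - s *\<^sub>R E ?y)" using diss[of s ?y] s by (simp add: E_def)
    also have "?y - s *\<^sub>R E ?y = e - s\<^sup>2 *\<^sub>R E (E e)" unfolding Esub by (simp add: power2_eq_square algebra_simps)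
    also have "v (e - s\<^sup>2 *\<^sub>R E (E e)) \<le> s\<^sup>2 * v (E (E e))"
      using cseminorm_diff[OF v, of e "s\<^sup>2 *\<^sub>R E (E e)"] by (simp add: e cseminorm_scaleR[OF v])
    also have "\<dots> \<le> s\<^sup>2 * norm (E (E e))" using le by (intro mult_left_mono) auto
    finally have "v ?y \<le> s\<^sup>2 * norm (E (E e))" .
    moreover have "v (s *\<^sub>R E e) \<le> v ?y + v e" using cseminorm_diff[OF v, of ?y e] by simp
    ultimately show ?thesis using s by (simp add: e cseminorm_scaleR[OF v])
  qed
  have "v (E e) = 0"
  proof (rule antisym)
    show "v (E e) \<le> 0"
    proof (rule field_le_epsilon)
      fix d :: real assume d: "d > 0"
      define s where "s = d / (norm (E (E e)) + 1)"
      have pos: "norm (E (E e)) + 1 > 0" using norm_ge_zero[of "E (E e)"] by linarith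
      have s: "s > 0" using d pos by (simp add: s_def)
      have "s * v (E e) \<le> s * (s * norm (E (E e)))" using bnd[OF s] by (simp add: power2_eq_square mult.assoc)
      then have "v (E e) \<le> s * norm (E (E e))" using s by simp
      also have "\<dots> \<le> s * (norm (E (E e)) + 1)" using s by (intro mult_left_mono) auto
      also have "\<dots> = d" using pos by (simp add: s_def)
      finally show "v (E e) \<le> 0 + d" by simp
    qed
  qed (rule cseminorm_nonneg[OF v])
  moreover have "E e = A *v e - of_real r *s e" by (simp add: E_def scaleR_eq_smult)
  ultimately have "v (A *v e) \<le> 0"
    using cseminorm_triangle[OF v, of "E e" "of_real r *s e"] e by (simp add: cseminorm_smult[OF v])
  then have vA: "v (A *v e) = 0" using cseminorm_nonneg[OF v, of "A *v e"] by simp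
  \<comment> \<open>The null space of \<open>v\<close> contains both \<open>e\<close> and
    \<open>A *v e\<close>; were these independent, \<open>v\<close> would vanish
    identically.\<close>
  have "dt e (A *v e) = 0"
  proof (rule ccontr)
    assume d: "dt e (A *v e) \<noteq> 0"
    define f where "f = (1 / dt e (A *v e)) *s (A *v e)"
    have "dt e f = 1" using d by (simp add: f_def dt_simps)
    moreover have "v f = 0" using vA by (simp add: f_def cseminorm_smult[OF v])
    ultimately have "v x \<le> 0" for x
      using dt_expand[of e f x] cseminorm_triangle[OF v, of "dt x f *s e" "dt e x *s f"] e
      by (simp add: cseminorm_smult[OF v])
    then show False using ne cseminorm_nonneg[OF v] by (metis antisym)
  qed
  then show ?thesis using dt_eq_0_parallel[OF e(1)] by metis
qed

text \<open>The discrete approximations converge once the limit \<open>V\<close> of their norms is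
  known to be a norm: the null vectors of \<open>V\<close> are common eigenvectors, which
  \<open>irr\<close> excludes. Only then are the Euler polygons uniformly bounded.\<close>

lemma exists_extremal:
  assumes N: "N > 0" and nG: "\<not> GUES N A"
    and irr: "\<And>e. e \<noteq> 0 \<Longrightarrow> \<exists>i<N. \<forall>\<alpha>. A i *v e \<noteq> \<alpha> *s e"
  obtains \<rho> B v K x where "\<rho> \<ge> 0" "\<And>i y. B i *v y = A i *v y - \<rho> *\<^sub>R y" "cnorm v" "K \<ge> 0"
    "extremal N B K v x"
proof -
  obtain R where R: "R > 0" "\<And>i y. i < N \<Longrightarrow> norm (A i *v y) \<le> R * norm y" using matrices_bounded by blast
  define \<eta> where "\<eta> n = 1 / (real n + 2)" for n
  have \<eta>: "0 < \<eta> n" "\<eta> n < 1" for n by (auto simp: \<eta>_def)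
  have \<eta>0: "\<eta> \<longlonglongrightarrow> 0"
    unfolding \<eta>_def using LIMSEQ_ignore_initial_segment[OF lim_const_over_n[of 1], of 2] by (simp add: add.commute)
  from discrete_extremal[OF N nG R \<eta>] obtain r \<sigma> v z w p where
    H: "\<And>n. 0 \<le> r n" "\<And>n. r n \<le> R + 1" "\<And>n. 0 < \<sigma> n" "\<And>n. \<sigma> n \<le> \<eta> n" "\<And>n. cnorm (v n)" "\<And>n x. v n x \<le> norm x"
     "\<And>n. \<exists>x. norm x = 1 \<and> v n x = 1"
     "\<And>n i x s. i < N \<Longrightarrow> s \<ge> 0 \<Longrightarrow> v n x \<le> v n (x - s *\<^sub>R (A i *v x - r n *\<^sub>R x))"
     "\<And>n k. w n k < N" "\<And>n. real (p n) * \<sigma> n \<ge> 1 / \<eta> n"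
     "\<And>n k. k < 2 * p n \<Longrightarrow> z n (Suc k) = z n k + \<sigma> n *\<^sub>R (A (w n k) *v z n k - r n *\<^sub>R z n k)"
     "\<And>n k. k \<le> 2 * p n \<Longrightarrow> 1 - \<eta> n \<le> v n (z n k)" "\<And>n k. k \<le> 2 * p n \<Longrightarrow> v n (z n k) \<le> 1"
    by metis
  have svn: "cseminorm (v n)" for n using H(5) by (simp add: cnorm_def)
  have vlip: "\<bar>v n x - v n y\<bar> \<le> norm (x - y)" for n x y
    using cseminorm_abs_diff[OF svn] H(6) order_trans by blast
  \<comment> \<open>Unit vectors of \<open>v n\<close>-value 1 are carried along to see that the
    limit seminorm is not zero.\<close>
  obtain xh where xh: "\<And>n. norm (xh n) = 1" "\<And>n. v n (xh n) = 1" using H(7) by metis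
  have "bounded (range (\<lambda>n. (r n, xh n)))"
  proof (rule boundedI)
    fix q assume "q \<in> range (\<lambda>n. (r n, xh n))"
    then obtain n where q: "q = (r n, xh n)" by auto
    have "norm q \<le> norm (r n) + norm (xh n)" unfolding q by (rule norm_Pair_le)
    then show "norm q \<le> (R + 1) + 1" using H(1,2)[of n] xh(1)[of n] by simp
  qed
  then obtain lim k0 where k0: "strict_mono (k0::nat\<Rightarrow>nat)" "((\<lambda>n. (r n, xh n)) \<circ> k0) \<longlonglongrightarrow> lim"
    using bounded_imp_convergent_subsequence by blast
  define \<rho> where "\<rho> = fst lim"
  define xl where "xl = snd lim"
  have r0: "(\<lambda>n. r (k0 n)) \<longlonglongrightarrow> \<rho>" and xl0: "(\<lambda>n. xh (k0 n)) \<longlonglongrightarrow> xl"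
    using tendsto_fst[OF k0(2)] tendsto_snd[OF k0(2)] by (auto simp: \<rho>_def xl_def o_def)
  obtain k1 where k1: "strict_mono (k1::nat\<Rightarrow>nat)" "\<And>i::unit. \<And>x. \<exists>l. (\<lambda>n. v (k0 (k1 n)) x) \<longlonglongrightarrow> l"
  proof (rule pointwise_subsequence[of "\<lambda>n (i::unit) x. v (k0 n) x" "\<lambda>i x. norm x" 1 "\<lambda>_. 0" "\<lambda>_ _. 0"])
    show "norm (v (k0 n) x) \<le> norm x" for n x using H(6) cseminorm_nonneg[OF svn] by simp
    show "\<forall>\<^sub>F n in sequentially. norm (v (k0 n) x - v (k0 n) y) \<le> 1 * dist x y + 0 * 0" for x y
      using vlip by (simp add: dist_norm)
  qed auto
  define k where "k = k0 \<circ> k1"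
  have k: "strict_mono k" using strict_mono_o[OF k0(1) k1(1)] by (simp add: k_def)
  have rk: "(\<lambda>n. r (k n)) \<longlonglongrightarrow> \<rho>" and xk: "(\<lambda>n. xh (k n)) \<longlonglongrightarrow> xl"
    using LIMSEQ_subseq_LIMSEQ[OF r0 k1(1)] LIMSEQ_subseq_LIMSEQ[OF xl0 k1(1)] by (auto simp: k_def o_def)
  obtain V where V: "\<And>x. (\<lambda>n. v (k n) x) \<longlonglongrightarrow> V x" using k1(2) unfolding k_def o_def by metis
  have \<rho>: "\<rho> \<ge> 0" using H(1) by (intro tendsto_lowerbound[OF rk]) auto
  have Vmov: "(\<lambda>n. v (k n) (y n)) \<longlonglongrightarrow> V a" if "y \<longlonglongrightarrow> a" for y a
  proof -
    have "(\<lambda>n. v (k n) (y n) - v (k n) a) \<longlonglongrightarrow> 0"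
    proof (rule Lim_null_comparison)
      show "\<forall>\<^sub>F n in sequentially. norm (v (k n) (y n) - v (k n) a) \<le> norm (y n - a)" using vlip by simp
      show "(\<lambda>n. norm (y n - a)) \<longlonglongrightarrow> 0" using that by (simp add: LIM_zero tendsto_norm_zero)
    qed
    from tendsto_add[OF this V[of a]] show ?thesis by simp
  qed
  have sV: "cseminorm V" unfolding cseminorm_def
  proof (intro conjI allI impI)
    fix x y c
    have "(\<lambda>n. v (k n) x + v (k n) y) \<longlonglongrightarrow> V x + V y" by (intro tendsto_intros V)
    then show "V (x + y) \<le> V x + V y"
      using cseminorm_triangle[OF svn] by (intro tendsto_le[OF sequentially_bot _ V]) auto
    have "(\<lambda>n. cmod c * v (k n) x) \<longlonglongrightarrow> cmod c * V x" by (intro tendsto_intros V)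
    then have "(\<lambda>n. v (k n) (c *s x)) \<longlonglongrightarrow> cmod c * V x" by (simp add: cseminorm_smult[OF svn])
    then show "V (c *s x) = cmod c * V x" using LIMSEQ_unique[OF V] by blast
  qed
  have Vle: "V x \<le> norm x" for x using H(6) by (intro tendsto_upperbound[OF V]) auto
  have "V xl = 1" using Vmov[OF xk] by (simp add: xh(2) LIMSEQ_const_iff)
  then have Vne: "\<exists>x. V x \<noteq> 0" by (metis zero_neq_one)
  have Vdiss: "V x \<le> V (x - s *\<^sub>R (A i *v x - \<rho> *\<^sub>R x))" if "i < N" "s \<ge> 0" for i s x
  proof (rule tendsto_le[OF sequentially_bot _ V])
    show "(\<lambda>n. v (k n) (x - s *\<^sub>R (A i *v x - r (k n) *\<^sub>R x))) \<longlonglongrightarrow> V (x - s *\<^sub>R (A i *v x - \<rho> *\<^sub>R x))"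
      by (intro Vmov tendsto_intros rk)
  qed (use H(8)[OF that] in auto)
  have Vn: "cnorm V" unfolding cnorm_def
  proof (intro conjI sV allI impI)
    fix e assume "V e = 0"
    show "e = 0"
    proof (rule ccontr)
      assume "e \<noteq> 0"
      then have "\<exists>\<alpha>. A i *v e = \<alpha> *s e" if "i < N" for i
        using common_eigenvector[OF sV _ \<open>V e = 0\<close> Vne Vle Vdiss[OF that]] by blast
      then show False using irr[OF \<open>e \<noteq> 0\<close>] by blast
    qed
  qed
  obtain c where c: "c > 0" "\<And>x. c * norm x \<le> V x" using cnorm_lower[OF Vn] by blast
  \<comment> \<open>The norms share a Lipschitz constant, so on the compact unit sphere pointwise
    convergence suffices for a common lower bound, with half of the constant of
    \<open>V\<close>.\<close>
  have "\<forall>\<^sub>F n in sequentially. \<forall>x. c / 2 * norm x \<le> v (k n) x"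
  proof (rule ccontr)
    assume "\<not> ?thesis"
    then have "\<exists>\<^sub>F n in sequentially. \<exists>x. v (k n) x < c / 2 * norm x"
      by (simp add: frequently_def not_less)
    then have "\<forall>m. \<exists>n\<ge>m. \<exists>x. v (k n) x < c / 2 * norm x" by (simp add: frequently_sequentially)
    then obtain f where f: "\<And>m. f m \<ge> m" "\<And>m. \<exists>x. v (k (f m)) x < c / 2 * norm x" by metis
    have "\<exists>x. norm x = 1 \<and> v (k (f m)) x < c / 2" for m
    proof -
      obtain x where x: "v (k (f m)) x < c / 2 * norm x" using f(2) by blast
      then have "x \<noteq> 0" by (auto simp: cseminorm_0[OF svn])
      then show ?thesis using x
        by (intro exI[of _ "(1 / norm x) *\<^sub>R x"]) (simp add: cseminorm_scaleR[OF svn] divide_less_eq)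
    qed
    then obtain x where x: "\<And>m. norm (x m) = 1" "\<And>m. v (k (f m)) (x m) < c / 2" by metis
    have "bounded (range x)" using x(1) by (intro boundedI[of _ 1]) auto
    then obtain a j where j: "strict_mono (j::nat\<Rightarrow>nat)" "(x \<circ> j) \<longlonglongrightarrow> a"
      using bounded_imp_convergent_subsequence by blast
    have fj: "filterlim (f \<circ> j) sequentially sequentially"
      unfolding filterlim_at_top
    proof
      fix m
      have "m \<le> (f \<circ> j) n" if "n \<ge> m" for n
        using f(1)[of "j n"] seq_suble[OF j(1), of n] that by (auto intro: order_trans)
      then show "\<forall>\<^sub>F n in sequentially. m \<le> (f \<circ> j) n" by (auto simp: eventually_sequentially)
    qed
    have na: "norm a = 1" using tendsto_norm[OF j(2)] x(1) by (simp add: o_def LIMSEQ_const_iff)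
    have 1: "(\<lambda>n. v (k (f (j n))) a) \<longlonglongrightarrow> V a" using filterlim_compose[OF V fj] by (simp add: o_def)
    have 2: "(\<lambda>n. c / 2 + norm (a - x (j n))) \<longlonglongrightarrow> c / 2 + norm (a - a)"
      using j(2) by (intro tendsto_intros) (simp add: o_def)
    have "V a \<le> c / 2 + norm (a - a)"
    proof (rule tendsto_le[OF sequentially_bot 2 1], intro always_eventually allI)
      fix n show "v (k (f (j n))) a \<le> c / 2 + norm (a - x (j n))"
        using vlip[of "k (f (j n))" a "x (j n)"] x(2)[of "j n"] by linarith
    qed
    then show False using c(2)[of a] c(1) na by simp
  qed
  then obtain n0 where n0: "\<And>n x. n \<ge> n0 \<Longrightarrow> c / 2 * norm x \<le> v (k n) x" by (auto simp: eventually_sequentially)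
  define m where "m n = k (n + n0)" for n
  have vm: "c / 2 * norm x \<le> v (m n) x" for n x using n0 by (simp add: m_def)
  have Vm: "(\<lambda>n. v (m n) (y n)) \<longlonglongrightarrow> V a" if "y \<longlonglongrightarrow> a" for y a
  proof -
    have "(\<lambda>n. v (m n) (y n) - v (m n) a) \<longlonglongrightarrow> 0"
    proof (rule Lim_null_comparison)
      show "\<forall>\<^sub>F n in sequentially. norm (v (m n) (y n) - v (m n) a) \<le> norm (y n - a)" using vlip by simp
      show "(\<lambda>n. norm (y n - a)) \<longlonglongrightarrow> 0" using that by (simp add: LIM_zero tendsto_norm_zero)
    qed
    from tendsto_add[OF this LIMSEQ_ignore_initial_segment[OF V[of a], of n0]] show ?thesis by (simp add: m_def)
  qed
  have rm: "(\<lambda>n. r (m n)) \<longlonglongrightarrow> \<rho>" unfolding m_def by (rule LIMSEQ_ignore_initial_segment[OF rk])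
  have m_mono: "strict_mono m" using k by (auto simp: m_def strict_mono_def)
  have \<eta>m: "(\<lambda>n. \<eta> (m n)) \<longlonglongrightarrow> 0" using LIMSEQ_subseq_LIMSEQ[OF \<eta>0 m_mono] by (simp add: o_def)
  define C where "C = 2 / c"
  have C0: "C > 0" using c by (simp add: C_def)
  have zC: "norm (z (m n) i) \<le> C" if "i \<le> 2 * p (m n)" for n i
    using vm[of "z (m n) i" n] H(13)[OF that] c(1) by (simp add: C_def field_simps)
  define R' where "R' = 2 * R + 1"
  have R': "norm (A i *v y - r n *\<^sub>R y) \<le> R' * norm y" if "i < N" for i y n
  proof -
    have "norm (r n *\<^sub>R y) \<le> (R + 1) * norm y" using H(1,2)[of n] by (simp add: mult_right_mono)
    then show ?thesis using norm_triangle_ineq4[of "A i *v y" "r n *\<^sub>R y"] R(2)[OF that, of y]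
      by (simp add: R'_def algebra_simps)
  qed
  have R'0: "R' \<ge> 0" using R by (simp add: R'_def)
  \<comment> \<open>The grid index at time \<open>t\<close>. Time 0 sits at the middle index, and
    the clamp to the length of the word is inactive for large \<open>n\<close>, since the available
    time \<open>p * \<sigma>\<close> is at least \<open>1 / \<eta>\<close>.\<close>
  define j where "j n t = nat (max 0 (min (2 * int (p (m n))) (\<lfloor>t / \<sigma> (m n)\<rfloor> + int (p (m n)))))" for n t
  have jle: "j n t \<le> 2 * p (m n)" for n t by (simp add: j_def)
  have jmono: "j n s \<le> j n t" if "s \<le> t" for n s t
  proof -
    have "\<lfloor>s / \<sigma> (m n)\<rfloor> \<le> \<lfloor>t / \<sigma> (m n)\<rfloor>" using that H(3)[of "m n"] by (intro floor_mono divide_right_mono) auto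
    then show ?thesis by (simp add: j_def nat_mono max.coboundedI2 min.coboundedI2)
  qed
  have jeq: "\<forall>\<^sub>F n in sequentially. real (j n t) = of_int \<lfloor>t / \<sigma> (m n)\<rfloor> + real (p (m n))" for t
  proof -
    have "\<forall>\<^sub>F n in sequentially. \<eta> (m n) < 1 / (\<bar>t\<bar> + 1)" using \<eta>m by (intro order_tendstoD(2)) auto
    then show ?thesis
    proof eventually_elim
      case (elim n)
      have "\<bar>t\<bar> + 1 < 1 / \<eta> (m n)" using elim \<eta>[of "m n"] by (simp add: field_simps)
      also have "\<dots> \<le> real (p (m n)) * \<sigma> (m n)" by (rule H(10))
      finally have "\<bar>t\<bar> < real (p (m n)) * \<sigma> (m n)" by simp
      then have "\<bar>t / \<sigma> (m n)\<bar> < real (p (m n))" using H(3)[of "m n"] by (simp add: field_simps)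
      then have "- int (p (m n)) \<le> \<lfloor>t / \<sigma> (m n)\<rfloor>" "\<lfloor>t / \<sigma> (m n)\<rfloor> \<le> int (p (m n))" by linarith+
      then show ?case by (simp add: j_def)
    qed
  qed
  have tau: "\<forall>\<^sub>F n in sequentially. \<bar>\<sigma> (m n) * (real (j n t) - real (j n s)) - (t - s)\<bar> \<le> \<sigma> (m n)" for s t
    using jeq[of s] jeq[of t]
  proof eventually_elim
    case (elim n)
    let ?s = "\<sigma> (m n)"
    have "\<bar>(of_int \<lfloor>t / ?s\<rfloor> - of_int \<lfloor>s / ?s\<rfloor>) - (t / ?s - s / ?s)\<bar> \<le> 1" by linarith
    then have "?s * \<bar>(of_int \<lfloor>t / ?s\<rfloor> - of_int \<lfloor>s / ?s\<rfloor>) - (t / ?s - s / ?s)\<bar> \<le> ?s * 1"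
      using H(3)[of "m n"] by (intro mult_left_mono) auto
    moreover have "?s * \<bar>(of_int \<lfloor>t / ?s\<rfloor> - of_int \<lfloor>s / ?s\<rfloor>) - (t / ?s - s / ?s)\<bar> =
       \<bar>?s * ((of_int \<lfloor>t / ?s\<rfloor> - of_int \<lfloor>s / ?s\<rfloor>) - (t / ?s - s / ?s))\<bar>"
      using H(3)[of "m n"] by (simp only: abs_mult abs_of_pos)
    moreover have "?s * ((of_int \<lfloor>t / ?s\<rfloor> - of_int \<lfloor>s / ?s\<rfloor>) - (t / ?s - s / ?s)) =
       ?s * (real (j n t) - real (j n s)) - (t - s)"
      using H(3)[of "m n"] elim by (simp add: field_simps)
    ultimately show ?case by simp
  qed
  define X where "X n t = z (m n) (j n t)" for n t
  define U where "U n i t = \<sigma> (m n) * (word_count (w (m n)) i (j n t) - word_count (w (m n)) i (p (m n)))" for n i t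
  have Ud: "U n i t - U n i s = \<sigma> (m n) * (word_count (w (m n)) i (j n t) - word_count (w (m n)) i (j n s))" for n i s t
    by (simp add: U_def algebra_simps)
  \<comment> \<open>The three summands absorb the effect of rounding times to the grid in the
    Lipschitz bound, in the controls and, by (d + q)^2 <= d^2 + 3q(1 + d), in the quadratic
    remainder.\<close>
  define Q where "Q = R' * C + 1 + 3 * (R' * (R' * C))"
  have RC: "0 \<le> R' * C" "0 \<le> R' * (R' * C)" using R'0 C0 by simp_all
  have \<sigma>1: "\<sigma> n < 1" for n using H(4)[of n] \<eta>(2)[of n] by linarith
  have Q\<sigma>: "q * \<sigma> (m n) \<le> Q * \<sigma> (m n) * (1 + (t - s))" if "q \<le> Q" "q \<ge> 0" "s \<le> t" for q n s t
  proof -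
    have "q * \<sigma> (m n) \<le> Q * \<sigma> (m n) * 1" using that H(3)[of "m n"] by (simp add: mult_right_mono)
    also have "\<dots> \<le> Q * \<sigma> (m n) * (1 + (t - s))" using that H(3)[of "m n"] by (intro mult_left_mono) auto
    finally show ?thesis .
  qed
  have Q1: "1 \<le> Q" using RC by (simp add: Q_def)
  define \<epsilon> where "\<epsilon> n = Q * \<sigma> (m n)" for n
  have \<sigma>0: "(\<lambda>n. \<sigma> (m n)) \<longlonglongrightarrow> 0"
  proof (rule Lim_null_comparison[OF _ \<eta>m])
    show "\<forall>\<^sub>F n in sequentially. norm (\<sigma> (m n)) \<le> \<eta> (m n)" using H(4) less_imp_le[OF H(3)] by simp
  qed
  have \<epsilon>0: "\<epsilon> \<longlonglongrightarrow> 0" unfolding \<epsilon>_def using tendsto_mult_right_zero[OF \<sigma>0] by simp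
  define B where "B i = A i - mat (complex_of_real \<rho>)" for i
  have B: "B i *v y = A i *v y - \<rho> *\<^sub>R y" for i and y :: "complex^2"
    by (simp add: B_def vec_eq_iff forall_2 matrix_vector_mult_def sum_2 mat_def algebra_simps scaleR_conv_of_real[where 'a=complex])
  have ee1: "norm (z (m n) b - z (m n) a) \<le> R' * C * (\<sigma> (m n) * (real b - real a))"
    and ee2: "norm (z (m n) b - z (m n) a - (\<Sum>i<N. (\<sigma> (m n) * (word_count (w (m n)) i b - word_count (w (m n)) i a)) *\<^sub>R
        (A i *v z (m n) a - r (m n) *\<^sub>R z (m n) a))) \<le> R' * (R' * C) * (\<sigma> (m n) * (real b - real a))\<^sup>2"
    if ab: "a \<le> b" "b \<le> 2 * p (m n)" for n a b
    using H(3)[of "m n"]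
    by (auto intro!: euler_estimates[where T = "2 * p (m n)"] H(11) H(9) R' R'0 zC ab less_imp_le[OF H(3)])
  obtain k2 y W where k2: "strict_mono (k2::nat\<Rightarrow>nat)" "\<And>t. (\<lambda>n. X (k2 n) t) \<longlonglongrightarrow> y t" "controls N W"
    "driven N B (R' * (R' * C)) W y"
  proof (rule limit_driven[of X C N U "R' * C" \<epsilon> "\<lambda>n. r (m n)" \<rho> A "R' * (R' * C)" B])
    show "norm (X n t) \<le> C" for n t unfolding X_def by (rule zC[OF jle])
    show "R' * C \<ge> 0" by (rule RC)
    fix s t :: real assume st: "s \<le> t"
    show "\<forall>\<^sub>F n in sequentially. norm (X n t - X n s) \<le> R' * C * (t - s) + \<epsilon> n * (1 + (t - s))"
      using tau[of t s]
    proof eventually_elim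
      case (elim n)
      have "norm (X n t - X n s) \<le> R' * C * (\<sigma> (m n) * (real (j n t) - real (j n s)))"
        unfolding X_def by (rule ee1[OF jmono[OF st] jle])
      also have "\<dots> \<le> R' * C * ((t - s) + \<sigma> (m n))" using elim RC by (intro mult_left_mono) auto
      also have "\<dots> \<le> R' * C * (t - s) + \<epsilon> n * (1 + (t - s))"
        using Q\<sigma>[of "R' * C" s t n] RC st by (simp add: Q_def \<epsilon>_def algebra_simps)
      finally show ?case .
    qed
    show "\<forall>\<^sub>F n in sequentially. \<forall>i<N. U n i s \<le> U n i t \<and> U n i t - U n i s \<le> t - s + \<epsilon> n * (1 + (t - s))"
      using tau[of t s]
    proof eventually_elim
      case (elim n)
      have "U n i s \<le> U n i t \<and> U n i t - U n i s \<le> t - s + \<epsilon> n * (1 + (t - s))" for i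
      proof -
        have "0 \<le> U n i t - U n i s" unfolding Ud using word_count_mono[OF jmono[OF st]] H(3)[of "m n"] by simp
        moreover have "U n i t - U n i s \<le> \<sigma> (m n) * (real (j n t) - real (j n s))"
          unfolding Ud using word_count_diff_le[OF jmono[OF st]] H(3)[of "m n"] by simp
        ultimately show ?thesis using elim Q\<sigma>[of 1 s t n] Q1 st by (simp add: \<epsilon>_def)
      qed
      then show ?case by blast
    qed
    have Us: "(\<Sum>i<N. U n i t - U n i s) = \<sigma> (m n) * (real (j n t) - real (j n s))" for n
      unfolding Ud by (simp add: sum_distrib_left[symmetric] sum_subtractf sum_word_count[OF H(9)])
    show "\<forall>\<^sub>F n in sequentially. \<bar>(\<Sum>i<N. U n i t - U n i s) - (t - s)\<bar> \<le> \<epsilon> n * (1 + (t - s))"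
      using tau[of t s] unfolding Us
    proof eventually_elim
      case (elim n)
      then show ?case using Q\<sigma>[of 1 s t n] Q1 st by (simp add: \<epsilon>_def)
    qed
    show "\<forall>\<^sub>F n in sequentially. norm (X n t - X n s - (\<Sum>i<N. (U n i t - U n i s) *\<^sub>R (A i *v X n s - r (m n) *\<^sub>R X n s)))
        \<le> R' * (R' * C) * (t - s)\<^sup>2 + \<epsilon> n * (1 + (t - s))"
      using tau[of t s]
    proof eventually_elim
      case (elim n)
      define \<tau> where "\<tau> = \<sigma> (m n) * (real (j n t) - real (j n s))"
      have \<tau>: "0 \<le> \<tau>" "\<tau> \<le> (t - s) + \<sigma> (m n)"
        using elim jmono[OF st, of n] H(3)[of "m n"] by (auto simp: \<tau>_def)
      have "norm (X n t - X n s - (\<Sum>i<N. (U n i t - U n i s) *\<^sub>R (A i *v X n s - r (m n) *\<^sub>R X n s))) \<le> R' * (R' * C) * \<tau>\<^sup>2"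
        unfolding X_def Ud \<tau>_def by (rule ee2[OF jmono[OF st] jle])
      also have "\<tau>\<^sup>2 \<le> ((t - s) + \<sigma> (m n))\<^sup>2" using \<tau> by (intro power_mono) auto
      also have "\<dots> \<le> (t - s)\<^sup>2 + 3 * \<sigma> (m n) * (1 + (t - s))"
      proof -
        have "(d + q)\<^sup>2 \<le> d\<^sup>2 + 3 * q * (1 + d)" if "0 \<le> q" "q \<le> 1" "0 \<le> d" for d q :: real
        proof -
          have "q * q \<le> q * 1" "0 \<le> q * d" using that mult_left_mono[of q 1 q] by auto
          moreover have "(d + q)\<^sup>2 = d\<^sup>2 + 2 * (q * d) + q * q" "3 * q * (1 + d) = 3 * q + 3 * (q * d)"
            by (simp_all add: power2_eq_square algebra_simps)
          ultimately show ?thesis using that by linarith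
        qed
        then show ?thesis using H(3)[of "m n"] \<sigma>1[of "m n"] st by simp
      qed
      finally have "norm (X n t - X n s - (\<Sum>i<N. (U n i t - U n i s) *\<^sub>R (A i *v X n s - r (m n) *\<^sub>R X n s)))
          \<le> R' * (R' * C) * ((t - s)\<^sup>2 + 3 * \<sigma> (m n) * (1 + (t - s)))" using RC by (simp add: mult_left_mono)
      also have "\<dots> = R' * (R' * C) * (t - s)\<^sup>2 + (3 * (R' * (R' * C))) * \<sigma> (m n) * (1 + (t - s))"
        by (simp add: algebra_simps)
      also have "(3 * (R' * (R' * C))) * \<sigma> (m n) * (1 + (t - s)) \<le> Q * \<sigma> (m n) * (1 + (t - s))"
        using RC H(3)[of "m n"] st by (intro mult_right_mono) (auto simp: Q_def)
      finally show ?case by (simp add: \<epsilon>_def)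
    qed
  next
    fix n i t assume i: "i < N"
    have "\<bar>word_count (w (m n)) i (j n t) - word_count (w (m n)) i (p (m n))\<bar> \<le> \<bar>real (j n t) - real (p (m n))\<bar>"
      using word_count_diff_le[of "j n t" "p (m n)" "w (m n)" i] word_count_diff_le[of "p (m n)" "j n t" "w (m n)" i]
        word_count_mono[of "j n t" "p (m n)" "w (m n)" i] word_count_mono[of "p (m n)" "j n t" "w (m n)" i]
      by (cases "j n t \<le> p (m n)") auto
    also have "\<bar>real (j n t) - real (p (m n))\<bar> \<le> \<bar>t / \<sigma> (m n)\<bar> + 1"
    proof -
      have "\<bar>int (j n t) - int (p (m n))\<bar> \<le> \<bar>\<lfloor>t / \<sigma> (m n)\<rfloor>\<bar>" by (auto simp: j_def max_def min_def)
      then have "\<bar>real (j n t) - real (p (m n))\<bar> \<le> \<bar>of_int \<lfloor>t / \<sigma> (m n)\<rfloor>\<bar>" by linarith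
      then show ?thesis by linarith
    qed
    finally have "\<sigma> (m n) * \<bar>word_count (w (m n)) i (j n t) - word_count (w (m n)) i (p (m n))\<bar> \<le> \<sigma> (m n) * (\<bar>t / \<sigma> (m n)\<bar> + 1)"
      using H(3)[of "m n"] by (intro mult_left_mono) auto
    then have "\<bar>U n i t\<bar> \<le> \<sigma> (m n) * (\<bar>t / \<sigma> (m n)\<bar> + 1)" using H(3)[of "m n"] by (simp add: U_def abs_mult)
    also have "\<dots> = \<bar>t\<bar> + \<sigma> (m n)" using H(3)[of "m n"] by (simp add: field_simps)
    finally show "\<bar>U n i t\<bar> \<le> \<bar>t\<bar> + 1" using \<sigma>1[of "m n"] by simp
  qed (use \<epsilon>0 rm B in auto)
  have "V (y t) = 1" for t
  proof -
    have "(\<lambda>n. v (m n) (X n t)) \<longlonglongrightarrow> 1"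
    proof (rule real_tendsto_sandwich)
      have "(\<lambda>n. 1 - \<eta> (m n)) \<longlonglongrightarrow> 1 - 0" by (intro tendsto_intros \<eta>m)
      then show "(\<lambda>n. 1 - \<eta> (m n)) \<longlonglongrightarrow> 1" by simp
    qed (use H(12,13) jle in \<open>auto simp: X_def\<close>)
    from LIMSEQ_subseq_LIMSEQ[OF this k2(1)] have 1: "(\<lambda>n. v (m (k2 n)) (X (k2 n) t)) \<longlonglongrightarrow> 1" by (simp add: o_def)
    have "(\<lambda>n. v (m (k2 n)) (y t)) \<longlonglongrightarrow> V (y t)"
      using LIMSEQ_subseq_LIMSEQ[OF Vm[OF tendsto_const[of "y t"]] k2(1)] by (simp add: o_def)
    moreover have "(\<lambda>n. v (m (k2 n)) (X (k2 n) t) - v (m (k2 n)) (y t)) \<longlonglongrightarrow> 0"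
    proof (rule Lim_null_comparison)
      show "\<forall>\<^sub>F n in sequentially. norm (v (m (k2 n)) (X (k2 n) t) - v (m (k2 n)) (y t)) \<le> norm (X (k2 n) t - y t)"
        using vlip by simp
      show "(\<lambda>n. norm (X (k2 n) t - y t)) \<longlonglongrightarrow> 0" using k2(2)[of t] by (simp add: LIM_zero tendsto_norm_zero)
    qed
    ultimately have "(\<lambda>n. v (m (k2 n)) (X (k2 n) t)) \<longlonglongrightarrow> 0 + V (y t)" using tendsto_add by fastforce
    with 1 show ?thesis using LIMSEQ_unique by fastforce
  qed
  then have "extremal N B (R' * (R' * C)) V y" using k2 by (auto simp: extremal_def)
  then show ?thesis using that \<rho> B Vn RC by blast
qed

section \<open>Recurrence\<close>

definition omega_limit :: "(real \<Rightarrow> 'a::metric_space) \<Rightarrow> 'a set" where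
  "omega_limit x = (\<Inter>n::nat. closure (x ` {real n..}))"

lemma omega_limit_iff: "y \<in> omega_limit x \<longleftrightarrow> (\<forall>e>0. \<forall>T. \<exists>t\<ge>T. dist (x t) y < e)"
proof
  assume y: "y \<in> omega_limit x"
  show "\<forall>e>0. \<forall>T. \<exists>t\<ge>T. dist (x t) y < e"
  proof (intro allI impI)
    fix e T :: real assume e: "e > 0"
    obtain n :: nat where n: "T \<le> real n" using real_arch_simple by blast
    have "y \<in> closure (x ` {real n..})" using y by (auto simp: omega_limit_def)
    then obtain z where "z \<in> x ` {real n..}" "dist z y < e" using e closure_approachable by blast
    then obtain t where "t \<ge> real n" "dist (x t) y < e" by auto
    then show "\<exists>t\<ge>T. dist (x t) y < e" using n by (intro exI[of _ t]) simp
  qed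
next
  assume H: "\<forall>e>0. \<forall>T. \<exists>t\<ge>T. dist (x t) y < e"
  have "y \<in> closure (x ` {real n..})" for n
    unfolding closure_approachable
  proof (intro allI impI)
    fix e :: real assume "e > 0"
    then obtain t where "t \<ge> real n" "dist (x t) y < e" using H by blast
    then show "\<exists>z\<in>x ` {real n..}. dist z y < e" by blast
  qed
  then show "y \<in> omega_limit x" unfolding omega_limit_def by blast
qed

text \<open>Weak invariance: trajectories through a point are not unique, and only one of them is
  asked to stay in \<open>S\<close>.\<close>

definition viable :: "((real \<Rightarrow> 'a::metric_space) \<Rightarrow> bool) \<Rightarrow> 'a set \<Rightarrow> bool" where
  "viable E S \<longleftrightarrow> S \<noteq> {} \<and> closed S \<and> (\<forall>y\<in>S. \<exists>x. E x \<and> x 0 = y \<and> (\<forall>t. x t \<in> S))"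

text \<open>Shifts of \<open>x\<close> by times tending to infinity converge along a subsequence to
  a curve of the class, and all its values are limits of \<open>x\<close> at large times. Shifts by
  times at which \<open>x\<close> approaches \<open>y\<close> give a curve through
  \<open>y\<close>.\<close>

lemma viable_omega_limit:
  fixes x :: "real \<Rightarrow> 'a::metric_space"
  assumes x: "E x" and shift: "\<And>x c. E x \<Longrightarrow> E (\<lambda>t. x (t + c))"
    and cpt: "\<And>X :: nat \<Rightarrow> real \<Rightarrow> 'a. (\<And>n. E (X n)) \<Longrightarrow> \<exists>k y. strict_mono (k::nat\<Rightarrow>nat) \<and> E y \<and> (\<forall>t. (\<lambda>n. X (k n) t) \<longlonglongrightarrow> y t)"
  shows "viable E (omega_limit x)"
  unfolding viable_def
proof (intro conjI ballI)
  have "\<exists>q. E q \<and> (\<forall>t. q t \<in> omega_limit x)"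
  proof -
    obtain k y where k: "strict_mono (k::nat\<Rightarrow>nat)" "E y" "\<And>t. (\<lambda>n. x (t + real (k n))) \<longlonglongrightarrow> y t"
      using cpt[of "\<lambda>n t. x (t + real n)"] shift[OF x] by blast
    have "y t \<in> omega_limit x" for t unfolding omega_limit_iff
    proof (intro allI impI)
      fix e T :: real assume e: "e > 0"
      obtain n1 where n1: "\<And>n. n \<ge> n1 \<Longrightarrow> dist (x (t + real (k n))) (y t) < e"
        using metric_LIMSEQ_D[OF k(3) e] by blast
      obtain n2 :: nat where n2: "T - t \<le> real n2" using real_arch_simple by blast
      have "real n2 \<le> real (k (max n1 n2))" using seq_suble[OF k(1), of "max n1 n2"] by simp
      then have "t + real (k (max n1 n2)) \<ge> T" using n2 by linarith
      then show "\<exists>r\<ge>T. dist (x r) (y t) < e" using n1[of "max n1 n2"] by auto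
    qed
    then show ?thesis using k(2) by blast
  qed
  then show "omega_limit x \<noteq> {}" by blast
  show "closed (omega_limit x)" unfolding omega_limit_def by blast
  fix y assume y: "y \<in> omega_limit x"
  have "\<exists>t\<ge>real n. dist (x t) y < 1 / (real n + 1)" for n using y unfolding omega_limit_iff by simp
  then obtain s where s: "\<And>n. s n \<ge> real n" "\<And>n. dist (x (s n)) y < 1 / (real n + 1)" by metis
  obtain k q where k: "strict_mono (k::nat\<Rightarrow>nat)" "E q" "\<And>t. (\<lambda>n. x (t + s (k n))) \<longlonglongrightarrow> q t"
    using cpt[of "\<lambda>n t. x (t + s n)"] shift[OF x] by blast
  have "(\<lambda>n. x (s n)) \<longlonglongrightarrow> y"
  proof (rule metric_tendsto_imp_tendsto)
    show "(\<lambda>n. 1 / (real n + 1)) \<longlonglongrightarrow> 0" using LIMSEQ_Suc[OF lim_1_over_n[where 'a=real]] by (simp add: add.commute)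
    show "\<forall>\<^sub>F n in sequentially. dist (x (s n)) y \<le> dist (1 / (real n + 1)) 0"
      using s(2) by (intro always_eventually allI) (simp add: less_imp_le)
  qed
  from LIMSEQ_subseq_LIMSEQ[OF this k(1)] have "(\<lambda>n. x (s (k n))) \<longlonglongrightarrow> y" by (simp add: o_def)
  from LIMSEQ_unique[OF this] have q0: "q 0 = y" using k(3)[of 0] by simp
  have "q t \<in> omega_limit x" for t unfolding omega_limit_iff
  proof (intro allI impI)
    fix e T :: real assume e: "e > 0"
    obtain n1 where n1: "\<And>n. n \<ge> n1 \<Longrightarrow> dist (x (t + s (k n))) (q t) < e"
      using metric_LIMSEQ_D[OF k(3) e] by blast
    obtain n2 :: nat where n2: "T - t \<le> real n2" using real_arch_simple by blast
    have "real n2 \<le> real (k (max n1 n2))" using seq_suble[OF k(1), of "max n1 n2"] by simp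
    then have "t + s (k (max n1 n2)) \<ge> T" using n2 s(1)[of "k (max n1 n2)"] by linarith
    then show "\<exists>r\<ge>T. dist (x r) (q t) < e" using n1[of "max n1 n2"] by auto
  qed
  then show "\<exists>q. E q \<and> q 0 = y \<and> (\<forall>t. q t \<in> omega_limit x)" using q0 k(2) by blast
qed

(* A minimal viable set is reached greedily: each basic open set is discarded as soon as some
   viable subset avoids it, so no transfinite induction is needed. *)
lemma recurrent_curve:
  fixes E :: "(real \<Rightarrow> 'a::{metric_space,second_countable_topology}) \<Rightarrow> bool"
  assumes x0: "E x0" and shift: "\<And>x c. E x \<Longrightarrow> E (\<lambda>t. x (t + c))"
    and cpt: "\<And>X :: nat \<Rightarrow> real \<Rightarrow> 'a. (\<And>n. E (X n)) \<Longrightarrow> \<exists>k y. strict_mono (k::nat\<Rightarrow>nat) \<and> E y \<and> (\<forall>t. (\<lambda>n. X (k n) t) \<longlonglongrightarrow> y t)"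
  obtains x where "E x" "\<And>e T. e > 0 \<Longrightarrow> \<exists>t\<ge>T. dist (x t) (x 0) < e"
proof -
  obtain \<B> :: "'a set set" where \<B>: "countable \<B>" "topological_basis \<B>" using ex_countable_basis by blast
  have Bne: "\<B> \<noteq> {}" using topological_basisE[OF \<B>(2) open_UNIV UNIV_I] by blast
  define b where "b = from_nat_into \<B>"
  have brange: "\<exists>n. b n = S" if "S \<in> \<B>" for S
    using that \<B>(1) from_nat_into_surj unfolding b_def by metis
  have seq_closed: "y \<in> S" if "closed S" "\<And>n. n \<ge> m \<Longrightarrow> X n \<in> S" "X \<longlonglongrightarrow> y" for S X y and m :: nat
    using Lim_in_closed_set[OF that(1) _ sequentially_bot that(3)] that(2) by (auto simp: eventually_sequentially)
  define Q where "Q n S S' \<longleftrightarrow> S' \<subseteq> S \<and> (S' \<inter> b n = {} \<or> \<not> (\<exists>S''. viable E S'' \<and> S'' \<subseteq> S \<and> S'' \<inter> b n = {}))"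
    for n :: nat and S S'
  have "\<exists>F. \<forall>n. viable E (F n) \<and> Q n (F n) (F (Suc n))"
  proof (rule dependent_nat_choice)
    show "\<exists>S. viable E S" using viable_omega_limit[OF x0 shift cpt] by blast
    fix S n assume "viable E S"
    then show "\<exists>S'. viable E S' \<and> Q n S S'" unfolding Q_def by blast
  qed
  then obtain F where F: "\<And>n. viable E (F n)" "\<And>n. Q n (F n) (F (Suc n))" by blast
  have dec: "F n \<subseteq> F m" if "m \<le> n" for m n
    using that by (induction rule: dec_induct) (use F(2) in \<open>auto simp: Q_def\<close>)
  define G where "G = (\<Inter>n. F n)"
  have Fc: "closed (F n)" for n using F(1) by (simp add: viable_def)
  have "\<exists>x. E x \<and> (\<forall>t. x t \<in> F n)" for n using F(1)[of n] unfolding viable_def by blast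
  then obtain X where X: "\<And>n. E (X n)" "\<And>n t. X n t \<in> F n" by metis
  obtain k y where k: "strict_mono (k::nat\<Rightarrow>nat)" "E y" "\<And>t. (\<lambda>n. X (k n) t) \<longlonglongrightarrow> y t"
    using cpt[of X] X(1) by blast
  have yG: "y t \<in> G" for t unfolding G_def
  proof (rule INT_I)
    fix m
    show "y t \<in> F m"
    proof (rule seq_closed[OF Fc _ k(3)])
      fix n assume "m \<le> n"
      then have "m \<le> k n" using seq_suble[OF k(1), of n] by linarith
      then show "X (k n) t \<in> F m" using X(2) dec by blast
    qed
  qed
  have Om: "omega_limit y \<subseteq> G"
  proof
    fix z assume z: "z \<in> omega_limit y"
    have "closed G" unfolding G_def using Fc by blast
    moreover have "z \<in> closure (y ` {real 0..})" using z unfolding omega_limit_def by blast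
    moreover have "y ` {real 0..} \<subseteq> G" using yG by blast
    ultimately show "z \<in> G" using closure_minimal by blast
  qed
  have vO: "viable E (omega_limit y)" using viable_omega_limit[OF k(2) shift cpt] by blast
  \<comment> \<open>A basic set meeting \<open>G\<close> but missing the viable set
    \<open>omega_limit y\<close> would have been discarded at its own step. Hence \<open>y 0\<close>
    lies in its own limit set.\<close>
  have GO: "G \<subseteq> omega_limit y"
  proof
    fix z assume z: "z \<in> G"
    show "z \<in> omega_limit y"
    proof (rule ccontr)
      assume "z \<notin> omega_limit y"
      then have "z \<in> - omega_limit y" "open (- omega_limit y)" using vO by (auto simp: viable_def)
      then obtain S where S: "S \<in> \<B>" "z \<in> S" "S \<subseteq> - omega_limit y" using topological_basisE[OF \<B>(2)] by metis
      obtain n where n: "b n = S" using brange[OF S(1)] by blast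
      have "omega_limit y \<subseteq> F n" "omega_limit y \<inter> b n = {}" using Om S(3) n by (auto simp: G_def)
      then have "F (Suc n) \<inter> b n = {}" using F(2)[of n] vO unfolding Q_def by blast
      then show False using z S(2) n by (auto simp: G_def)
    qed
  qed
  then have "y 0 \<in> omega_limit y" using yG by blast
  then show ?thesis using that k(2) unfolding omega_limit_iff by blast
qed

lemma recurrent_extremal:
  assumes v: "cnorm v" and K: "K \<ge> 0" and x0: "extremal N B K v x0"
  obtains x where "extremal N B K v x" "\<And>e T. e > 0 \<Longrightarrow> \<exists>t\<ge>T. dist (x t) (x 0) < e"
proof (rule recurrent_curve[of "extremal N B K v"])
  fix X assume X: "\<And>n :: nat. extremal N B K v (X n)"
  obtain k y where "strict_mono (k::nat\<Rightarrow>nat)" "extremal N B K v y" "\<And>t. (\<lambda>n. X (k n) t) \<longlonglongrightarrow> y t"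
    using extremal_compact[of v K N B X, OF v K X] by blast
  then show "\<exists>k y. strict_mono (k::nat\<Rightarrow>nat) \<and> extremal N B K v y \<and> (\<forall>t. (\<lambda>n. X (k n) t) \<longlonglongrightarrow> y t)"
    by blast
qed (use x0 extremal_shift that in \<open>blast+\<close>)

section \<open>The parity argument\<close>

text \<open>Values of \<open>g\<close> differ by multiples of 2 pi i, so \<open>g\<close> has
  discrete range on a connected interval. Every comparison of branches below goes through
  this.\<close>

lemma exp_const_imp_const:
  fixes g :: "real \<Rightarrow> complex"
  assumes cont: "continuous_on {u..v} g" and e: "\<And>t. u \<le> t \<Longrightarrow> t \<le> v \<Longrightarrow> exp (g t) = k" and uv: "u \<le> v"
  shows "g u = g v"
proof -
  have "g constant_on {u..v}"
  proof (rule continuous_discrete_range_constant[OF _ cont])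
    fix s assume s: "s \<in> {u..v}"
    have "2 * pi \<le> norm (g t - g s)" if t: "t \<in> {u..v}" "g t \<noteq> g s" for t
    proof -
      have "exp (g t) = exp (g s)" using e s t by auto
      then obtain n :: int where n: "g t = g s + of_int (2 * n) * pi * \<i>" unfolding exp_eq by blast
      then have "n \<noteq> 0" using t(2) by auto
      then have "1 \<le> \<bar>real_of_int n\<bar>" by linarith
      moreover have "norm (g t - g s) = 2 * pi * \<bar>real_of_int n\<bar>" by (simp add: n norm_mult abs_mult)
      ultimately show ?thesis using pi_gt_zero by simp
    qed
    then show "\<exists>e>0. \<forall>t. t \<in> {u..v} \<and> g t \<noteq> g s \<longrightarrow> e \<le> norm (g t - g s)"
      by (intro exI[of _ "2 * pi"]) auto
  qed simp
  then show ?thesis using uv unfolding constant_on_def by force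
qed

text \<open>Along the segment both \<open>Ln (w t)\<close> and \<open>Ln (w t / p)\<close> stay
  within the principal branch, so their difference is constant and no multiple of 2 pi i
  appears.\<close>

lemma Ln_divide_segment:
  assumes "\<And>t. 0 \<le> t \<Longrightarrow> t \<le> 1 \<Longrightarrow> p + of_real t * (q - p) \<notin> \<real>\<^sub>\<le>\<^sub>0"
  shows "q / p \<notin> \<real>\<^sub>\<le>\<^sub>0" "Ln (q / p) = Ln q - Ln p"
proof -
  define w where "w t = p + of_real t * (q - p)" for t :: real
  have w: "w t \<notin> \<real>\<^sub>\<le>\<^sub>0" if "0 \<le> t" "t \<le> 1" for t using assms that by (simp add: w_def)
  have p: "p \<notin> \<real>\<^sub>\<le>\<^sub>0" "p \<noteq> 0" using w[of 0] by (auto simp: w_def)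
  have nz: "w t \<noteq> 0" if "0 \<le> t" "t \<le> 1" for t using w[OF that] by auto
  have d: "w t / p \<notin> \<real>\<^sub>\<le>\<^sub>0" if t: "0 \<le> t" "t \<le> 1" for t
  proof
    \<comment> \<open>A negative ratio would put 0 between \<open>p\<close> and \<open>w t\<close>
      on the segment, and 0 is itself excluded.\<close>
    assume "w t / p \<in> \<real>\<^sub>\<le>\<^sub>0"
    then obtain k where k: "w t / p = - of_real k" "k \<ge> 0"
      unfolding complex_nonpos_Reals_iff
      by (intro that[of "- Re (w t / p)"]) (auto simp: complex_eq_iff)
    then have "w t = - of_real k * p" using p(2) by (simp add: field_simps)
    then have "of_real t * (q - p) = - of_real (1 + k) * p" by (simp add: w_def algebra_simps)
    moreover have "t / (1 + k) \<le> 1" "0 \<le> t / (1 + k)" using t k(2) by (auto simp: field_simps)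
    ultimately have "w (t / (1 + k)) = p + (- of_real (1 + k) * p) / of_real (1 + k)" 
      by (simp add: w_def)
    also have "\<dots> = 0" using k(2) by (simp add: add_nonneg_eq_0_iff del: of_real_add)
    finally show False using nz[of "t / (1 + k)"] \<open>t / (1 + k) \<le> 1\<close> \<open>0 \<le> t / (1 + k)\<close> by blast
  qed
  have w1: "w 1 = q" by (simp add: w_def)
  show "q / p \<notin> \<real>\<^sub>\<le>\<^sub>0" using d[of 1] w1 by simp
  have cw: "continuous_on {0..1} w" unfolding w_def by (intro continuous_intros)
  have "Ln (w 0) - Ln (w 0 / p) = Ln (w 1) - Ln (w 1 / p)"
  proof (rule exp_const_imp_const)
    show "continuous_on {0..1} (\<lambda>t. Ln (w t) - Ln (w t / p))"
      using w d p by (intro continuous_intros cw) auto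
    show "exp (Ln (w t) - Ln (w t / p)) = p" if "0 \<le> t" "t \<le> 1" for t
      using nz[OF that] p(2) by (simp add: exp_diff exp_Ln)
  qed simp
  then show "Ln (q / p) = Ln q - Ln p" using p(2) w1 by (simp add: w_def algebra_simps)
qed

(* T1 and T2 are passages near the base passage T0; F t s = det (x t, x s) up to a constant. In the
   windows of radius \<eta> around them F factors through the chart z, and \<nu> measures the argument of the
   secants there. The condition free makes \<nu> b - \<nu> a twice an odd multiple of pi * i. *)
lemma turning_contradiction:
  fixes x :: "real \<Rightarrow> complex^2" and T :: "real set"
  assumes cx: "continuous_on UNIV x" and ef: "dt e f = 1" and c: "c \<noteq> 0"
    and indep: "\<And>t s. t < s \<Longrightarrow> dt (x t) (x s) \<noteq> 0"
    and \<eta>: "\<eta> > 0" and T: "T = {T0, T1, T2}" "T0 + 2 * \<eta> < T1" "T1 + 2 * \<eta> < T2"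
    and \<psi>: "\<And>t. \<psi> t = dt (x t) f" and z: "\<And>t. z t = dt e (x t) / (\<psi> t * c)"
    and \<psi>0: "\<And>a t. a \<in> T \<Longrightarrow> \<bar>t - a\<bar> \<le> \<eta> \<Longrightarrow> \<psi> t \<noteq> 0"
    and W: "\<And>a b h h' w. a \<in> T \<Longrightarrow> b \<in> T \<Longrightarrow> 0 \<le> h \<Longrightarrow> h \<le> \<eta> \<Longrightarrow> 0 \<le> h' \<Longrightarrow> h' \<le> \<eta> \<Longrightarrow> h = \<eta> \<or> h' = \<eta> \<Longrightarrow>
       cmod w \<le> 2 * \<epsilon> \<Longrightarrow> z (a + h) - z (b - h') + w \<notin> \<real>\<^sub>\<le>\<^sub>0"
    and small: "\<And>a. a \<in> T \<Longrightarrow> cmod (z a) \<le> \<epsilon>"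
    and free: "\<And>a b s. a \<in> T \<Longrightarrow> b \<in> T \<Longrightarrow> a < b \<Longrightarrow> a + \<eta> \<le> s \<Longrightarrow> s \<le> b - \<eta> \<Longrightarrow>
       \<psi> s \<noteq> 0 \<Longrightarrow> z s \<notin> closed_segment (z a) (z b)"
  shows False
proof -
  have \<epsilon>: "\<epsilon> \<ge> 0" using order_trans[OF norm_ge_zero small[of T0]] T by simp
  have W0: "z (a + h) - z (b - h') \<notin> \<real>\<^sub>\<le>\<^sub>0" if "a \<in> T" "b \<in> T" "0 \<le> h" "h \<le> \<eta>" "0 \<le> h'" "h' \<le> \<eta>" "h = \<eta> \<or> h' = \<eta>" for a b h h'
    using W[of a b h h' 0] that \<epsilon> by simp
  define F where "F t s = dt (x t) (x s) / c" for t s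
  have c\<psi>: "continuous_on S \<psi>" for S
    unfolding \<psi> dt_def using continuous_on_subset[OF cx, of S] by (intro continuous_intros) auto
  have c\<phi>: "continuous_on S (\<lambda>t. dt e (x t))" for S
    unfolding dt_def using continuous_on_subset[OF cx, of S] by (intro continuous_intros) auto
  have dtx: "dt (x t) (x s) = \<psi> t * dt e (x s) - dt e (x t) * \<psi> s" for t s
  proof -
    have fe: "dt f e = - 1" using ef by (simp add: dt_def algebra_simps)
    show ?thesis
      by (subst dt_expand[OF ef, of "x t"], subst dt_expand[OF ef, of "x s"]) (simp add: dt_simps ef fe \<psi> algebra_simps)
  qed
  have F0: "F t s \<noteq> 0" if "t < s" for t s using indep[OF that] c by (simp add: F_def)
  have Fz: "F t s = \<psi> t * \<psi> s * (z s - z t)" if "\<psi> t \<noteq> 0" "\<psi> s \<noteq> 0" for t s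
    using that c by (simp add: F_def dtx z field_simps)
  \<comment> \<open>On the convex set of pairs t < s the determinant has no zero, hence it has one
    continuous logarithm there; this single function compares all secants of the curve.\<close>
  define Tri where "Tri = {p :: real \<times> real. fst p < snd p}"
  have "convex Tri" unfolding Tri_def
  proof (rule convexI)
    fix p q :: "real \<times> real" and u v :: real
    assume "p \<in> {p. fst p < snd p}" "q \<in> {p. fst p < snd p}" "0 \<le> u" "0 \<le> v" "u + v = 1"
    then show "u *\<^sub>R p + v *\<^sub>R q \<in> {p. fst p < snd p}"
      using convex_bound_lt[of "fst p - snd p" 0 "fst q - snd q" u v] by (simp add: algebra_simps)
  qed
  then have "contractible Tri" by (rule convex_imp_contractible)
  moreover have "continuous_on Tri (\<lambda>p. F (fst p) (snd p))"
    unfolding F_def dtx using c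
    by (intro continuous_intros continuous_on_compose2[OF c\<psi>[of UNIV]] continuous_on_compose2[OF c\<phi>[of UNIV]]) auto
  ultimately obtain \<Theta> where \<Theta>c: "continuous_on Tri \<Theta>" and \<Theta>e: "\<And>p. p \<in> Tri \<Longrightarrow> F (fst p) (snd p) = exp (\<Theta> p)"
    using continuous_logarithm_on_contractible[of Tri "\<lambda>p. F (fst p) (snd p)"] F0 by (metis (no_types, lifting) Tri_def mem_Collect_eq)
  have \<Theta>: "exp (\<Theta> (t, s)) = F t s" if "t < s" for t s using \<Theta>e[of "(t,s)"] that by (simp add: Tri_def)
  have \<Theta>cont: "continuous_on S (\<lambda>r. \<Theta> (p r, q r))"
    if "continuous_on S p" "continuous_on S q" "\<And>r. r \<in> S \<Longrightarrow> p r < q r" for S :: "real set" and p q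
    using that by (intro continuous_on_compose2[OF \<Theta>c] continuous_intros) (auto simp: Tri_def)
  have "\<exists>l. continuous_on {a - \<eta>..a + \<eta>} l \<and> (\<forall>t\<in>{a - \<eta>..a + \<eta>}. \<psi> t = exp (l t))" if "a \<in> T" for a
  proof -
    have "contractible {a - \<eta>..a + \<eta>}" by (rule convex_imp_contractible) simp
    moreover have "\<psi> t \<noteq> 0" if "t \<in> {a - \<eta>..a + \<eta>}" for t using \<psi>0[OF \<open>a \<in> T\<close>, of t] that by (auto simp: abs_le_iff)
    ultimately show ?thesis using continuous_logarithm_on_contractible[OF c\<psi>] by metis
  qed
  then obtain L where Lc: "\<And>a. a \<in> T \<Longrightarrow> continuous_on {a - \<eta>..a + \<eta>} (L a)"
    and Le: "\<And>a t. a \<in> T \<Longrightarrow> a - \<eta> \<le> t \<Longrightarrow> t \<le> a + \<eta> \<Longrightarrow> exp (L a t) = \<psi> t" by (metis atLeastAtMost_iff)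
  have zc: "continuous_on S z" if "\<And>t. t \<in> S \<Longrightarrow> \<psi> t \<noteq> 0" for S
    unfolding z using that c by (intro continuous_intros c\<psi> c\<phi>) auto
  have Lcomp: "continuous_on S (\<lambda>r. L a (p r))"
    if "a \<in> T" "continuous_on S p" "\<And>r. r \<in> S \<Longrightarrow> a - \<eta> \<le> p r \<and> p r \<le> a + \<eta>" for a p and S :: "real set"
    using that by (intro continuous_on_compose2[OF Lc[OF that(1)]]) auto
  have zcomp: "continuous_on S (\<lambda>r. z (p r))"
    if "a \<in> T" "continuous_on S p" "\<And>r. r \<in> S \<Longrightarrow> a - \<eta> \<le> p r \<and> p r \<le> a + \<eta>" for a p and S :: "real set"
    using that \<psi>0[OF that(1)]
    by (intro continuous_on_compose2[OF zc[of "{a - \<eta>..a + \<eta>}"]]) (auto simp: abs_le_iff)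
  have \<psi>w: "\<psi> t \<noteq> 0" if "a \<in> T" "a - \<eta> \<le> t" "t \<le> a + \<eta>" for a t using \<psi>0[OF that(1), of t] that by (auto simp: abs_le_iff)
  define \<nu> where "\<nu> a = \<Theta> (a, a + \<eta>) - L a a - L a (a + \<eta>) - Ln (z (a + \<eta>) - z a)" for a
  \<comment> \<open>The forward and the backward secant are both extended to the secant over the
    whole window. By \<open>W\<close> the chart differences stay off the negative axis, so
    \<open>Ln\<close> is continuous throughout.\<close>
  have bwd: "\<Theta> (a - \<eta>, a) - L a (a - \<eta>) - L a a - Ln (z a - z (a - \<eta>)) = \<nu> a" if a: "a \<in> T" for a
  proof -
    have e1: "exp (\<Theta> (t, s) - L a t - L a s - Ln (z s - z t)) = 1"
      if "a - \<eta> \<le> t" "t < s" "s \<le> a + \<eta>" "z s - z t \<notin> \<real>\<^sub>\<le>\<^sub>0" for t s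
    proof -
      have "z s - z t \<noteq> 0" using that(4) by auto
      then show ?thesis using that a Fz[of t s] \<psi>w[OF a, of t] \<psi>w[OF a, of s]
        by (simp add: exp_diff \<Theta> Le exp_Ln)
    qed
    have "\<Theta> (a - \<eta>, a + 0) - L a (a - \<eta>) - L a (a + 0) - Ln (z (a + 0) - z (a - \<eta>)) =
        \<Theta> (a - \<eta>, a + \<eta>) - L a (a - \<eta>) - L a (a + \<eta>) - Ln (z (a + \<eta>) - z (a - \<eta>))"
    proof (rule exp_const_imp_const[where g = "\<lambda>h. \<Theta> (a - \<eta>, a + h) - L a (a - \<eta>) - L a (a + h) - Ln (z (a + h) - z (a - \<eta>))"])
      show "continuous_on {0..\<eta>} (\<lambda>h. \<Theta> (a - \<eta>, a + h) - L a (a - \<eta>) - L a (a + h) - Ln (z (a + h) - z (a - \<eta>)))"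
        using \<eta> a W0 by (intro continuous_intros \<Theta>cont Lcomp zcomp[OF a]) auto
      show "exp (\<Theta> (a - \<eta>, a + h) - L a (a - \<eta>) - L a (a + h) - Ln (z (a + h) - z (a - \<eta>))) = 1" if "0 \<le> h" "h \<le> \<eta>" for h
        using \<eta> a W0 that by (intro e1) auto
    qed (use \<eta> in auto)
    moreover have "\<Theta> (a - 0, a + \<eta>) - L a (a - 0) - L a (a + \<eta>) - Ln (z (a + \<eta>) - z (a - 0)) =
        \<Theta> (a - \<eta>, a + \<eta>) - L a (a - \<eta>) - L a (a + \<eta>) - Ln (z (a + \<eta>) - z (a - \<eta>))"
    proof (rule exp_const_imp_const[where g = "\<lambda>h. \<Theta> (a - h, a + \<eta>) - L a (a - h) - L a (a + \<eta>) - Ln (z (a + \<eta>) - z (a - h))"])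
      show "continuous_on {0..\<eta>} (\<lambda>h. \<Theta> (a - h, a + \<eta>) - L a (a - h) - L a (a + \<eta>) - Ln (z (a + \<eta>) - z (a - h)))"
        using \<eta> a W0 by (intro continuous_intros \<Theta>cont Lcomp zcomp[OF a]) auto
      show "exp (\<Theta> (a - h, a + \<eta>) - L a (a - h) - L a (a + \<eta>) - Ln (z (a + \<eta>) - z (a - h))) = 1" if "0 \<le> h" "h \<le> \<eta>" for h
        using \<eta> a W0 that by (intro e1) auto
    qed (use \<eta> in auto)
    ultimately show ?thesis unfolding \<nu>_def add_0_right diff_0_right by (rule trans[OF _ sym])
  qed
  have pair: "\<exists>m. exp m = -1 \<and> \<nu> b - \<nu> a = 2 * m" if a: "a \<in> T" and b: "b \<in> T" and ab: "a + 2 * \<eta> < b" for a b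
  proof -
    \<comment> \<open>For points in two different windows it is \<open>z t - z s\<close> that is
      known to avoid the negative axis, opposite in sign to the difference in \<open>F\<close>;
      therefore the exponential is -1.\<close>
    define l where "l t s = \<Theta> (t, s) - L a t - L b s - Ln (z t - z s)" for t s
    have e1: "exp (l t s) = -1"
      if "a - \<eta> \<le> t" "t \<le> a + \<eta>" "b - \<eta> \<le> s" "s \<le> b + \<eta>" "z t - z s \<notin> \<real>\<^sub>\<le>\<^sub>0" for t s
    proof -
      have "z t - z s \<noteq> 0" using that(5) by auto
      then have "(z s - z t) / (z t - z s) = -1" by (simp add: field_simps)
      moreover have "t < s" using that ab by linarith
      ultimately show ?thesis using that a b Fz[of t s] \<psi>w[OF a, of t] \<psi>w[OF b, of s] \<open>z t - z s \<noteq> 0\<close>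
        by (simp add: l_def exp_diff \<Theta> Le exp_Ln)
    qed
    have "l (a + 0) (b - \<eta>) = l (a + \<eta>) (b - \<eta>)"
    proof (rule exp_const_imp_const[where g = "\<lambda>h. l (a + h) (b - \<eta>)"])
      show "continuous_on {0..\<eta>} (\<lambda>h. l (a + h) (b - \<eta>))"
        unfolding l_def using \<eta> a b W0 ab by (intro continuous_intros \<Theta>cont Lcomp zcomp[OF a]) auto
      show "exp (l (a + h) (b - \<eta>)) = -1" if "0 \<le> h" "h \<le> \<eta>" for h
        using \<eta> a b W0 that by (intro e1) auto
    qed (use \<eta> in auto)
    moreover have "l (a + \<eta>) (b - 0) = l (a + \<eta>) (b - \<eta>)"
    proof (rule exp_const_imp_const[where g = "\<lambda>h. l (a + \<eta>) (b - h)"])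
      show "continuous_on {0..\<eta>} (\<lambda>h. l (a + \<eta>) (b - h))"
        unfolding l_def using \<eta> a b W0 ab by (intro continuous_intros \<Theta>cont Lcomp zcomp[OF b]) auto
      show "exp (l (a + \<eta>) (b - h)) = -1" if "0 \<le> h" "h \<le> \<eta>" for h
        using \<eta> a b W0 that by (intro e1) auto
    qed (use \<eta> in auto)
    ultimately have leq: "l a (b - \<eta>) = l (a + \<eta>) b" by simp
    \<comment> \<open>In the chart this is \<open>(z s - z b) / (z s - z a)\<close>, which is real
      and nonpositive exactly on the chord. Written through \<open>F\<close> it makes sense also
      where \<open>\<psi> s = 0\<close>, that is, where \<open>z s\<close> would be
      infinite.\<close>
    define Z where "Z s = - (F s b / \<psi> b) / (F a s / \<psi> a)" for s
    have \<psi>a: "\<psi> a \<noteq> 0" and \<psi>b: "\<psi> b \<noteq> 0" using \<psi>w[OF a, of a] \<psi>w[OF b, of b] \<eta> by auto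
    have Zn: "Z s \<notin> \<real>\<^sub>\<le>\<^sub>0" if s: "a + \<eta> \<le> s" "s \<le> b - \<eta>" for s
    proof
      assume "Z s \<in> \<real>\<^sub>\<le>\<^sub>0"
      then obtain k where k: "Z s = - of_real k" "k \<ge> 0"
        unfolding complex_nonpos_Reals_iff
        by (intro that[of "- Re (Z s)"]) (auto simp: complex_eq_iff)
      have as: "F a s \<noteq> 0" using F0[of a s] s \<eta> by simp
      define y where "y = dt e (x s) / c"
      have Fb: "F s b / \<psi> b = \<psi> s * z b - y" using \<psi>b c by (simp add: F_def dtx z y_def field_simps)
      have Fa: "F a s / \<psi> a = y - z a * \<psi> s" using \<psi>a c by (simp add: F_def dtx z y_def field_simps)
      have nz: "y - z a * \<psi> s \<noteq> 0" using as \<psi>a Fa by (metis divide_eq_0_iff)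
      have "- (\<psi> s * z b - y) = - of_real k * (y - z a * \<psi> s)"
        using k(1) nz unfolding Z_def Fa Fb by (simp add: field_simps)
      then have eq: "y * of_real (1 + k) = (z b + of_real k * z a) * \<psi> s" by (simp add: algebra_simps)
      have k1: "of_real (1 + k) \<noteq> (0 :: complex)" unfolding of_real_eq_0_iff using k(2) by linarith
      have \<psi>s: "\<psi> s \<noteq> 0"
      proof
        assume "\<psi> s = 0"
        then have "y = 0" using eq k1 by simp
        then show False using nz \<open>\<psi> s = 0\<close> by simp
      qed
      then have "z s = (z b + of_real k * z a) / of_real (1 + k)" 
      proof -
        have "z s = y / \<psi> s" by (simp add: z y_def)
        also have "\<dots> = (z b + of_real k * z a) / of_real (1 + k)"
          using eq \<psi>s k1 by (simp add: frac_eq_eq)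
        finally show ?thesis .
      qed
      also have "\<dots> = (1 - 1 / (1 + k)) *\<^sub>R z a + (1 / (1 + k)) *\<^sub>R z b"
      proof -
        have "1 - 1 / (1 + k) = k / (1 + k)" using k(2) by (simp add: field_simps)
        then show ?thesis by (simp add: scaleR_conv_of_real add_divide_distrib)
      qed
      finally have "z s \<in> closed_segment (z a) (z b)"
        unfolding in_segment using k(2) by (intro exI[of _ "1 / (1 + k)"]) auto
      then show False using free[OF a b _ s \<psi>s] ab \<eta> by simp
    qed
    \<comment> \<open>A continuous logarithm of -1 on the stretch between the windows, hence
      constant; its values at the two ends tie \<open>\<nu> a\<close> to
      \<open>\<nu> b\<close>.\<close>
    define m where "m s = \<Theta> (s, b) - \<Theta> (a, s) - L b b + L a a - Ln (Z s)" for s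
    have em: "exp (m s) = -1" if s: "a + \<eta> \<le> s" "s \<le> b - \<eta>" for s
    proof -
      have "Z s \<noteq> 0" using Zn[OF s] by auto
      moreover have "a < s" "s < b" using s \<eta> by auto
      ultimately show ?thesis using F0[of a s] F0[of s b] \<psi>a \<psi>b a b \<eta>
        by (simp add: m_def exp_diff exp_add \<Theta> Le exp_Ln Z_def field_simps)
    qed
    have meq: "m (a + \<eta>) = m (b - \<eta>)"
    proof (rule exp_const_imp_const)
      have "continuous_on {a + \<eta>..b - \<eta>} Z"
        unfolding Z_def F_def dtx
      proof (intro continuous_intros c\<psi> c\<phi> ballI)
        fix s assume "s \<in> {a + \<eta>..b - \<eta>}"
        then have "F a s \<noteq> 0" using F0[of a s] \<eta> by simp
        then show "(\<psi> a * dt e (x s) - dt e (x a) * \<psi> s) / c / \<psi> a \<noteq> 0" using \<psi>a unfolding F_def dtx by simp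
      qed (use \<psi>a \<psi>b c in auto)
      then show "continuous_on {a + \<eta>..b - \<eta>} m"
        unfolding m_def using Zn \<eta> by (intro continuous_intros \<Theta>cont) auto
    qed (use em ab in auto)
    \<comment> \<open>The admissible perturbation \<open>w\<close> is used to slide one base point
      to the other along their chord.\<close>
    have Wa: "z (a + \<eta>) - z b + w \<notin> \<real>\<^sub>\<le>\<^sub>0" and Wb: "z a - z (b - \<eta>) + w \<notin> \<real>\<^sub>\<le>\<^sub>0" if "cmod w \<le> 2 * \<epsilon>" for w
      using W[of a b \<eta> 0 w] W[of a b 0 \<eta> w] a b \<eta> that by auto
    have zab: "cmod (z b - z a) \<le> 2 * \<epsilon>" using small[OF a] small[OF b] norm_triangle_ineq4[of "z b" "z a"] by linarith
    have tz: "cmod (of_real t * (z b - z a)) \<le> 2 * \<epsilon>" if "0 \<le> t" "t \<le> 1" for t :: real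
    proof -
      have "t * cmod (z b - z a) \<le> 1 * cmod (z b - z a)" using that by (intro mult_right_mono) auto
      then show ?thesis using zab that by (simp add: norm_mult)
    qed
    have La: "Ln ((z (a + \<eta>) - z b) / (z (a + \<eta>) - z a)) = Ln (z (a + \<eta>) - z b) - Ln (z (a + \<eta>) - z a)"
    proof (rule Ln_divide_segment(2))
      fix t :: real assume t: "0 \<le> t" "t \<le> 1"
      have eq: "(z (a + \<eta>) - z a) + of_real t * ((z (a + \<eta>) - z b) - (z (a + \<eta>) - z a))
         = z (a + \<eta>) - z b + of_real (1 - t) * (z b - z a)" by (simp add: algebra_simps)
      show "(z (a + \<eta>) - z a) + of_real t * ((z (a + \<eta>) - z b) - (z (a + \<eta>) - z a)) \<notin> \<real>\<^sub>\<le>\<^sub>0"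
        unfolding eq by (rule Wa[OF tz]) (use t in auto)
    qed
    have Lb: "Ln ((z b - z (b - \<eta>)) / (z a - z (b - \<eta>))) = Ln (z b - z (b - \<eta>)) - Ln (z a - z (b - \<eta>))"
    proof (rule Ln_divide_segment(2))
      fix t :: real assume t: "0 \<le> t" "t \<le> 1"
      have "(z a - z (b - \<eta>)) + of_real t * ((z b - z (b - \<eta>)) - (z a - z (b - \<eta>)))
         = z a - z (b - \<eta>) + of_real t * (z b - z a)" by (simp add: algebra_simps)
      then show "(z a - z (b - \<eta>)) + of_real t * ((z b - z (b - \<eta>)) - (z a - z (b - \<eta>))) \<notin> \<real>\<^sub>\<le>\<^sub>0"
        using Wb[OF tz[of t]] t by simp
    qed
    have Z1: "Z (a + \<eta>) = (z (a + \<eta>) - z b) / (z (a + \<eta>) - z a)"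
    proof -
      have "\<psi> (a + \<eta>) \<noteq> 0" using \<psi>w[OF a, of "a + \<eta>"] \<eta> by simp
      then show ?thesis using \<psi>a \<psi>b by (simp add: Z_def Fz mult.assoc minus_divide_left)
    qed
    have Z2: "Z (b - \<eta>) = (z b - z (b - \<eta>)) / (z a - z (b - \<eta>))"
    proof -
      have "\<psi> (b - \<eta>) \<noteq> 0" using \<psi>w[OF b, of "b - \<eta>"] \<eta> by simp
      then have "F (b - \<eta>) b / \<psi> b = \<psi> (b - \<eta>) * (z b - z (b - \<eta>))"
        "F a (b - \<eta>) / \<psi> a = \<psi> (b - \<eta>) * (z (b - \<eta>) - z a)" using \<psi>a \<psi>b by (simp_all add: Fz)
      moreover have "- (p * u) / (p * w) = - (u / w)" if "p \<noteq> 0" for p u w :: complex using that by simp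
      ultimately have "Z (b - \<eta>) = - ((z b - z (b - \<eta>)) / (z (b - \<eta>) - z a))"
        using \<open>\<psi> (b - \<eta>) \<noteq> 0\<close> unfolding Z_def by metis
      also have "\<dots> = (z b - z (b - \<eta>)) / (z a - z (b - \<eta>))"
        unfolding minus_divide_right minus_diff_eq ..
      finally show ?thesis .
    qed
    \<comment> \<open>The cross term \<open>l\<close> is the same at both ends and cancels, while
      \<open>m\<close> enters with opposite signs and is therefore counted twice in the
      difference.\<close>
    have "\<nu> a = l (a + \<eta>) b - m (a + \<eta>)" unfolding m_def Z1 La l_def \<nu>_def by simp
    moreover have "\<nu> b = m (b - \<eta>) + l a (b - \<eta>)"
      unfolding m_def Z2 Lb l_def bwd[OF b, symmetric] by simp
    ultimately have "\<nu> b - \<nu> a = 2 * m (a + \<eta>)" using leq meq by simp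
    then show ?thesis using em[of "a + \<eta>"] ab by (intro exI[of _ "m (a + \<eta>)"]) auto
  qed
  obtain m1 m2 m3 where m: "exp m1 = -1" "exp m2 = -1" "exp m3 = -1"
    "\<nu> T1 - \<nu> T0 = 2 * m1" "\<nu> T2 - \<nu> T1 = 2 * m2" "\<nu> T2 - \<nu> T0 = 2 * m3"
    using pair[of T0 T1] pair[of T1 T2] pair[of T0 T2] T \<eta> by force
  \<comment> \<open>Additivity of \<open>\<nu>\<close> along the three passages gives
    \<open>m3 = m1 + m2\<close>, but the exponentials of the two sides are -1 and 1.\<close>
  then have "2 * m3 = 2 * (m1 + m2)" by (simp add: algebra_simps)
  then have "m3 = m1 + m2" unfolding mult_cancel_left by simp
  then show False using m(1-3) by (simp add: exp_add)
qed

section \<open>Transversality\<close>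

(* Upper bound 0 for the one-sided directional derivative of v at x0 in direction y, where v x0 = 1. *)
definition subtangent :: "(complex^2 \<Rightarrow> real) \<Rightarrow> complex^2 \<Rightarrow> complex^2 \<Rightarrow> bool" where
  "subtangent v x0 y \<longleftrightarrow> (\<forall>\<epsilon>>0. \<exists>d>0. \<forall>s. 0 < s \<and> s \<le> d \<longrightarrow> v (x0 + s *\<^sub>R y) \<le> 1 + \<epsilon> * s)"

lemma subtangentD:
  assumes "subtangent v x0 y" "\<epsilon> > 0"
  shows "\<exists>d>0. \<forall>s. 0 < s \<longrightarrow> s \<le> d \<longrightarrow> v (x0 + s *\<^sub>R y) \<le> 1 + \<epsilon> * s"
  using assms(1)[unfolded subtangent_def, rule_format, OF assms(2)] by auto

lemma cseminorm_between:
  assumes v: "cseminorm v" and s: "0 \<le> s" "s \<le> m" "m > 0"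
  shows "v (x0 + s *\<^sub>R y) \<le> (1 - s / m) * v x0 + (s / m) * v (x0 + m *\<^sub>R y)"
proof -
  have "x0 + s *\<^sub>R y = (1 - s / m) *\<^sub>R x0 + (s / m) *\<^sub>R (x0 + m *\<^sub>R y)" using s by (simp add: algebra_simps)
  then have "v (x0 + s *\<^sub>R y) \<le> v ((1 - s / m) *\<^sub>R x0) + v ((s / m) *\<^sub>R (x0 + m *\<^sub>R y))"
    using cseminorm_triangle[OF v, of "(1 - s / m) *\<^sub>R x0" "(s / m) *\<^sub>R (x0 + m *\<^sub>R y)"] by simp
  moreover have "0 \<le> 1 - s / m" "0 \<le> s / m" using s by auto
  ultimately show ?thesis by (simp only: cseminorm_scaleR[OF v] abs_of_nonneg)
qed

text \<open>By convexity a single secant of length \<open>m n\<close> and small slope controls all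
  shorter ones in the same direction, and the directions \<open>y n\<close> converge to
  \<open>a\<close>.\<close>

lemma subtangent_limit:
  assumes v: "cseminorm v" and x0: "v x0 = 1" and m: "m \<longlonglongrightarrow> 0" "\<And>n. m n > 0" and y: "y \<longlonglongrightarrow> a"
    and le: "\<And>n. v (x0 + m n *\<^sub>R y n) \<le> 1 + Q * (m n)\<^sup>2"
  shows "subtangent v x0 a"
  unfolding subtangent_def
proof (intro allI impI)
  fix \<epsilon> :: real assume \<epsilon>: "\<epsilon> > 0"
  obtain L where L: "L > 0" "\<And>x. v x \<le> L * norm x" using cseminorm_bounded[OF v] by blast
  have "(\<lambda>n. Q * m n + L * norm (a - y n)) \<longlonglongrightarrow> Q * 0 + L * norm (a - a)" by (intro tendsto_intros m y)
  then have "\<forall>\<^sub>F n in sequentially. Q * m n + L * norm (a - y n) < \<epsilon>" using \<epsilon> by (intro order_tendstoD(2)) auto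
  then obtain n where n: "Q * m n + L * norm (a - y n) < \<epsilon>" by (auto simp: eventually_sequentially)
  show "\<exists>d>0. \<forall>s. 0 < s \<and> s \<le> d \<longrightarrow> v (x0 + s *\<^sub>R a) \<le> 1 + \<epsilon> * s"
  proof (intro exI[of _ "m n"] conjI allI impI m(2))
    fix s assume s: "0 < s \<and> s \<le> m n"
    have "v (x0 + s *\<^sub>R y n) \<le> (1 - s / m n) * v x0 + (s / m n) * v (x0 + m n *\<^sub>R y n)"
      using s m(2) by (intro cseminorm_between[OF v]) auto
    also have "\<dots> \<le> (1 - s / m n) * 1 + (s / m n) * (1 + Q * (m n)\<^sup>2)"
      using le[of n] s m(2)[of n] x0 by (intro add_mono mult_left_mono) auto
    also have "\<dots> = 1 + s * (Q * m n)" using m(2)[of n] by (simp add: field_simps power2_eq_square)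
    finally have 1: "v (x0 + s *\<^sub>R y n) \<le> 1 + s * (Q * m n)" .
    have "x0 + s *\<^sub>R a = (x0 + s *\<^sub>R y n) + s *\<^sub>R (a - y n)" by (simp add: algebra_simps)
    then have "v (x0 + s *\<^sub>R a) \<le> v (x0 + s *\<^sub>R y n) + s * v (a - y n)"
      using cseminorm_triangle[OF v, of "x0 + s *\<^sub>R y n" "s *\<^sub>R (a - y n)"] s
      by (simp only: cseminorm_scaleR[OF v] abs_of_pos)
    also have "\<dots> \<le> 1 + s * (Q * m n) + s * (L * norm (a - y n))"
      using 1 L(2) s by (intro add_mono mult_left_mono) auto
    also have "\<dots> = 1 + s * (Q * m n + L * norm (a - y n))" by (simp add: algebra_simps)
    also have "\<dots> \<le> 1 + \<epsilon> * s" using n s mult_left_mono[of "Q * m n + L * norm (a - y n)" \<epsilon> s] by (simp add: mult.commute)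
    finally show "v (x0 + s *\<^sub>R a) \<le> 1 + \<epsilon> * s" .
  qed
qed

lemma subtangent_scaleR:
  assumes "subtangent v x0 y" "v x0 = 1" "c \<ge> 0" shows "subtangent v x0 (c *\<^sub>R y)"
proof (cases "c = 0")
  case True
  then show ?thesis using assms(2) unfolding subtangent_def by (auto intro: exI[of _ 1])
next
  case False
  then have c: "c > 0" using assms(3) by simp
  show ?thesis unfolding subtangent_def
  proof (intro allI impI)
    fix \<epsilon> :: real assume "\<epsilon> > 0"
    then have "\<epsilon> / c > 0" using c by simp
    then obtain d where d: "d > 0" "\<And>s. 0 < s \<Longrightarrow> s \<le> d \<Longrightarrow> v (x0 + s *\<^sub>R y) \<le> 1 + \<epsilon> / c * s"
      using subtangentD[OF assms(1)] by blast
    show "\<exists>d>0. \<forall>s. 0 < s \<and> s \<le> d \<longrightarrow> v (x0 + s *\<^sub>R (c *\<^sub>R y)) \<le> 1 + \<epsilon> * s"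
    proof (intro exI[of _ "d / c"] conjI allI impI)
      fix s assume "0 < s \<and> s \<le> d / c"
      then have "v (x0 + (s * c) *\<^sub>R y) \<le> 1 + \<epsilon> / c * (s * c)" using c by (intro d(2)) (auto simp: field_simps)
      then show "v (x0 + s *\<^sub>R (c *\<^sub>R y)) \<le> 1 + \<epsilon> * s" using c by simp
    qed (use c d in auto)
  qed
qed

text \<open>Convexity read outwards: the value 1 - Q m^2 at a small distance m along a ray forces at
  least 1 - Q m s at distance s, and m tends to 0.\<close>

lemma supertangent_limit:
  assumes v: "cseminorm v" and x0: "v x0 = 1" and m: "m \<longlonglongrightarrow> 0" "\<And>n. m n > 0" and y: "y \<longlonglongrightarrow> a"
    and ge: "\<And>n. 1 - Q * (m n)\<^sup>2 \<le> v (x0 + m n *\<^sub>R y n)" and s: "s \<ge> 0"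
  shows "1 \<le> v (x0 + s *\<^sub>R a)"
proof (cases "s = 0")
  case False
  then have s: "s > 0" using s by simp
  have c: "isCont v (x0 + s *\<^sub>R a)"
    using cseminorm_continuous[OF v, of UNIV] by (simp add: continuous_on_eq_continuous_at)
  have lim: "(\<lambda>n. v (x0 + s *\<^sub>R y n)) \<longlonglongrightarrow> v (x0 + s *\<^sub>R a)"
    by (rule isCont_tendsto_compose[OF c]) (intro tendsto_intros y)
  have "(\<lambda>n. 1 - Q * m n * s) \<longlonglongrightarrow> 1 - Q * 0 * s" by (intro tendsto_intros m)
  then have "(\<lambda>n. 1 - Q * m n * s) \<longlonglongrightarrow> 1" by simp
  moreover have "\<forall>\<^sub>F n in sequentially. 1 - Q * m n * s \<le> v (x0 + s *\<^sub>R y n)"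
  proof -
    have "\<forall>\<^sub>F n in sequentially. m n < s" using m(1) s by (intro order_tendstoD(2))
    then show ?thesis
    proof eventually_elim
      case (elim n)
      have "v (x0 + m n *\<^sub>R y n) \<le> (1 - m n / s) * v x0 + (m n / s) * v (x0 + s *\<^sub>R y n)"
        using elim m(2)[of n] s by (intro cseminorm_between[OF v]) auto
      then have "1 - Q * (m n)\<^sup>2 \<le> (1 - m n / s) + (m n / s) * v (x0 + s *\<^sub>R y n)" using ge[of n] x0 by simp
      then have "(m n / s) * (1 - Q * m n * s) \<le> (m n / s) * v (x0 + s *\<^sub>R y n)"
        using s by (simp add: field_simps power2_eq_square)
      moreover have "m n / s > 0" using m(2)[of n] s by simp
      ultimately show ?case by (simp only: mult_le_cancel_left_pos)
    qed
  qed
  ultimately show ?thesis by (intro tendsto_le[OF sequentially_bot lim])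
qed (use x0 in simp)

text \<open>The point at distance s/3 in direction \<open>y0\<close> is the mean of the points at
  distance s in the directions \<open>\<mu> *s x0\<close>, \<open>y1\<close>, \<open>y2\<close>. If
  \<open>Re \<mu>\<close> were negative, the first would lie inside the unit ball to first order and
  the others outside it by at most a small multiple of s.\<close>

lemma tangent_Re_nonneg:
  assumes v: "cseminorm v" and x0: "v x0 = 1"
    and y0: "\<And>s. s \<ge> 0 \<Longrightarrow> 1 \<le> v (x0 + s *\<^sub>R y0)" and y1: "subtangent v x0 y1" and y2: "subtangent v x0 y2"
    and eq: "y0 = \<mu> *s x0 + y1 + y2"
  shows "Re \<mu> \<ge> 0"
proof (rule ccontr)
  assume "\<not> Re \<mu> \<ge> 0"
  then have neg: "Re \<mu> < 0" by simp
  \<comment> \<open>The contraction rate \<open>\<kappa>\<close> below is then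
    \<open>4 * \<epsilon>\<close>, more than the two errors \<open>\<epsilon> * s\<close> together
    can offset.\<close>
  define \<epsilon> where "\<epsilon> = - Re \<mu> / 8"
  have \<epsilon>: "\<epsilon> > 0" using neg by (simp add: \<epsilon>_def)
  obtain d1 where d1: "d1 > 0" "\<And>s. 0 < s \<Longrightarrow> s \<le> d1 \<Longrightarrow> v (x0 + s *\<^sub>R y1) \<le> 1 + \<epsilon> * s"
    using subtangentD[OF y1 \<epsilon>] by blast
  obtain d2 where d2: "d2 > 0" "\<And>s. 0 < s \<Longrightarrow> s \<le> d2 \<Longrightarrow> v (x0 + s *\<^sub>R y2) \<le> 1 + \<epsilon> * s"
    using subtangentD[OF y2 \<epsilon>] by blast
  define \<kappa> where "\<kappa> = - Re \<mu> / 2"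
  have \<kappa>: "\<kappa> > 0" using neg by (simp add: \<kappa>_def)
  define s where "s = min (min d1 d2) (min (1 / \<kappa>) (2 * \<kappa> / (cmod \<mu>)\<^sup>2))"
  have \<mu>0: "cmod \<mu> > 0" using neg by auto
  have s: "s > 0" "s \<le> d1" "s \<le> d2" using d1(1) d2(1) \<kappa> \<mu>0 by (auto simp: s_def)
  have "s \<le> 1 / \<kappa>" "s \<le> 2 * \<kappa> / (cmod \<mu>)\<^sup>2" by (auto simp: s_def)
  then have s2: "s * \<kappa> \<le> 1" "s * (cmod \<mu>)\<^sup>2 \<le> 2 * \<kappa>" using \<kappa> \<mu>0 by (auto simp: field_simps)
  have "x0 + (s / 3) *\<^sub>R y0 = (1 / 3) *\<^sub>R (x0 + of_real s *s (\<mu> *s x0)) + (1 / 3) *\<^sub>R (x0 + s *\<^sub>R y1) + (1 / 3) *\<^sub>R (x0 + s *\<^sub>R y2)"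
  proof -
    have "x + (s / 3) *\<^sub>R (a + b + c) = (1 / 3) *\<^sub>R (x + s *\<^sub>R a) + (1 / 3) *\<^sub>R (x + s *\<^sub>R b) + (1 / 3) *\<^sub>R (x + s *\<^sub>R c)"
      for x a b c :: "complex^2"
      by (simp add: vec_eq_iff scaleR_conv_of_real[where 'a=complex] algebra_simps)
    then show ?thesis unfolding eq scaleR_eq_smult[of s "\<mu> *s x0", symmetric] by blast
  qed
  also have "x0 + of_real s *s (\<mu> *s x0) = (1 + of_real s * \<mu>) *s x0"
    by (simp add: vector_smult_assoc vector_sadd_rdistrib)
  finally have eq3: "x0 + (s / 3) *\<^sub>R y0 = (1 / 3) *\<^sub>R ((1 + of_real s * \<mu>) *s x0) + (1 / 3) *\<^sub>R (x0 + s *\<^sub>R y1) + (1 / 3) *\<^sub>R (x0 + s *\<^sub>R y2)" .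
  have "1 \<le> v (x0 + (s / 3) *\<^sub>R y0)" using y0 s by simp
  also have "\<dots> \<le> v ((1 / 3) *\<^sub>R ((1 + of_real s * \<mu>) *s x0)) + v ((1 / 3) *\<^sub>R (x0 + s *\<^sub>R y1)) + v ((1 / 3) *\<^sub>R (x0 + s *\<^sub>R y2))"
    unfolding eq3 using cseminorm_triangle[OF v] by (meson add_right_mono order_trans)
  also have "\<dots> = (1 / 3) * cmod (1 + of_real s * \<mu>) + (1 / 3) * v (x0 + s *\<^sub>R y1) + (1 / 3) * v (x0 + s *\<^sub>R y2)"
  proof -
    have "v ((1 / 3) *\<^sub>R y) = (1 / 3) * v y" for y by (simp add: cseminorm_scaleR[OF v])
    then show ?thesis by (simp only: cseminorm_smult[OF v] x0 mult_1_right)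
  qed
  also have "\<dots> \<le> (1 / 3) * (1 - s * \<kappa>) + (1 / 3) * (1 + \<epsilon> * s) + (1 / 3) * (1 + \<epsilon> * s)"
    using contraction_bound[OF \<kappa>, of \<mu> "cmod \<mu>" s] s s2 d1 d2 by (intro add_mono mult_left_mono) (auto simp: \<kappa>_def)
  also have "\<dots> = 1 - s * \<kappa> / 3 + 2 * (\<epsilon> * s) / 3" by (simp add: field_simps)
  finally have "s * \<kappa> \<le> 2 * (\<epsilon> * s)" by simp
  moreover have "\<kappa> = 4 * \<epsilon>" by (simp add: \<kappa>_def \<epsilon>_def)
  ultimately show False using s(1) \<epsilon> by (simp add: algebra_simps)
qed

section \<open>Velocities of extremal trajectories at a point\<close>

lemma extremal_expand:
  assumes v: "cnorm v" and K: "K \<ge> 0"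
  obtains Q where "Q \<ge> 0"
    "\<And>q h. extremal N B K v q \<Longrightarrow> h \<ge> 0 \<Longrightarrow> \<exists>a. (\<forall>i<N. 0 \<le> a i) \<and> (\<Sum>i<N. a i) = h \<and>
        norm (q h - q 0 - (\<Sum>i<N. a i *\<^sub>R (B i *v q 0))) \<le> Q * h\<^sup>2"
    "\<And>q h. extremal N B K v q \<Longrightarrow> h \<ge> 0 \<Longrightarrow> \<exists>a. (\<forall>i<N. 0 \<le> a i) \<and> (\<Sum>i<N. a i) = h \<and>
        norm (q (- h) - q 0 + (\<Sum>i<N. a i *\<^sub>R (B i *v q 0))) \<le> Q * h\<^sup>2"
proof -
  obtain R where R: "R > 0" "\<And>i y. i < N \<Longrightarrow> norm (B i *v y) \<le> R * norm y" using matrices_bounded by blast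
  obtain C L where L: "L > 0" "\<And>x s t. extremal N B K v x \<Longrightarrow> norm (x t - x s) \<le> L * \<bar>t - s\<bar>"
    using extremal_Lipschitz[OF v K, of N B] by metis
  have two: "\<exists>U. controls N U \<and> (\<forall>t. norm (q t - q 0 - (\<Sum>i<N. (U i t - U i 0) *\<^sub>R (B i *v q 0))) \<le> (K + R * L) * t\<^sup>2)"
    if q: "extremal N B K v q" for q
  proof -
    obtain U where U: "controls N U" "driven N B K U q" using q by (auto simp: extremal_def)
    have "norm (q t - q 0 - (\<Sum>i<N. (U i t - U i 0) *\<^sub>R (B i *v q 0))) \<le> (K + R * L) * (t - 0)\<^sup>2" for t
      by (rule driven_two_sided[OF R(2) less_imp_le[OF R(1)] L(2)[OF q] U])
    then show ?thesis using U by auto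
  qed
  show ?thesis
  proof (rule that)
    show "K + R * L \<ge> 0" using K R L by simp
    fix q and h :: real assume q: "extremal N B K v q" and h: "h \<ge> 0"
    obtain U where U: "controls N U" "\<And>t. norm (q t - q 0 - (\<Sum>i<N. (U i t - U i 0) *\<^sub>R (B i *v q 0))) \<le> (K + R * L) * t\<^sup>2"
      using two[OF q] by blast
    show "\<exists>a. (\<forall>i<N. 0 \<le> a i) \<and> (\<Sum>i<N. a i) = h \<and>
        norm (q h - q 0 - (\<Sum>i<N. a i *\<^sub>R (B i *v q 0))) \<le> (K + R * L) * h\<^sup>2"
      using U(2)[of h] controls_mono[OF U(1), of _ 0 h] controls_sum[OF U(1), of h 0] h
      by (intro exI[of _ "\<lambda>i. U i h - U i 0"]) auto
    have eq: "q (- h) - q 0 + (\<Sum>i<N. (U i 0 - U i (- h)) *\<^sub>R (B i *v q 0)) = q (- h) - q 0 - (\<Sum>i<N. (U i (- h) - U i 0) *\<^sub>R (B i *v q 0))"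
      by (simp add: scaleR_diff_left sum_subtractf)
    show "\<exists>a. (\<forall>i<N. 0 \<le> a i) \<and> (\<Sum>i<N. a i) = h \<and>
        norm (q (- h) - q 0 + (\<Sum>i<N. a i *\<^sub>R (B i *v q 0))) \<le> (K + R * L) * h\<^sup>2"
      using U(2)[of "- h"] controls_mono[OF U(1), of _ "- h" 0] controls_sum[OF U(1), of 0 "- h"] h
      by (intro exI[of _ "\<lambda>i. U i 0 - U i (- h)"]) (auto simp: eq)
  qed
qed

text \<open>Rescaling the weights to sum 1 gives a constant law of \<open>A\<close> with eigenvector
  \<open>x0\<close> and eigenvalue \<open>\<mu> / t + \<rho>\<close>. Its real part is negative, and
  \<open>\<rho>\<close> is nonnegative.\<close>

lemma no_central_direction:
  assumes PAS: "periodically_asymptotically_stable N A" and \<rho>: "\<rho> \<ge> 0"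
    and shift: "\<And>i y. B i *v y = A i *v y - \<rho> *\<^sub>R y"
    and a: "\<And>i. i < N \<Longrightarrow> 0 \<le> a i" "(\<Sum>i<N. a i) > 0" and x0: "x0 \<noteq> 0"
    and eq: "(\<Sum>i<N. a i *\<^sub>R (B i *v x0)) = \<mu> *s x0"
  shows "Re \<mu> < 0"
proof -
  define t where "t = (\<Sum>i<N. a i)"
  have t: "t > 0" using a by (simp add: t_def)
  have "(\<Sum>i<N. (a i / t) *\<^sub>R (A i *v x0)) = (1 / t) *\<^sub>R (\<Sum>i<N. a i *\<^sub>R (A i *v x0))"
    by (simp add: scaleR_sum_right)
  also have "(\<Sum>i<N. a i *\<^sub>R (A i *v x0)) = (\<Sum>i<N. a i *\<^sub>R (B i *v x0)) + t *\<^sub>R (\<rho> *\<^sub>R x0)"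
    unfolding t_def scaleR_sum_left sum.distrib[symmetric] by (simp add: shift scaleR_diff_right)
  finally have "(\<Sum>i<N. (a i / t) *\<^sub>R (A i *v x0)) = (of_real (1 / t) * \<mu> + of_real \<rho>) *s x0"
    using t by (simp add: eq scaleR_add_right) (simp add: scaleR_eq_smult vector_smult_assoc vector_sadd_rdistrib)
  moreover have "(\<Sum>i<N. a i / t) = 1" using t by (simp add: sum_divide_distrib[symmetric] t_def)
  ultimately have "Re (of_real (1 / t) * \<mu> + of_real \<rho>) < 0"
    using a t by (intro PAS_constant[OF PAS, of "\<lambda>i. a i / t" x0]) (auto simp: x0)
  then show ?thesis using t \<rho> by (simp add: field_simps) (smt (verit) mult_nonneg_nonneg)
qed

(* Affine coordinate on the complement of the line of f in the projective line; 0 on that line. *)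
definition chart :: "complex^2 \<Rightarrow> complex^2 \<Rightarrow> complex \<Rightarrow> complex^2 \<Rightarrow> complex" where
  "chart e f c y = dt e y / (dt y f * c)"

section \<open>Transversality in an affine chart of the projective line\<close>

lemma chart_smult: "k \<noteq> 0 \<Longrightarrow> chart e f c (k *s y) = chart e f c y"
  by (simp add: chart_def dt_simps)

lemma dt_tendsto:
  assumes "X \<longlonglongrightarrow> a" shows "(\<lambda>n. dt (X n) f) \<longlonglongrightarrow> dt a f" "(\<lambda>n. dt e (X n)) \<longlonglongrightarrow> dt e a"
  unfolding dt_def by (intro tendsto_intros assms tendsto_vec_nth)+

lemma chart_tendsto:
  assumes "X \<longlonglongrightarrow> a" "dt a f \<noteq> 0" "c \<noteq> 0"
  shows "(\<lambda>n. chart e f c (X n)) \<longlonglongrightarrow> chart e f c a"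
  unfolding chart_def using assms by (intro tendsto_intros dt_tendsto[OF assms(1)]) auto

lemma tendsto_of_quadratic:
  fixes p :: "nat \<Rightarrow> complex^2"
  assumes m: "m \<longlonglongrightarrow> 0" "\<And>n. m n > 0" and le: "\<And>n. norm (p n - m n *\<^sub>R y n) \<le> Q * (m n)\<^sup>2"
    and y: "y \<longlonglongrightarrow> a"
  shows "(\<lambda>n. (1 / m n) *\<^sub>R p n) \<longlonglongrightarrow> a"
proof -
  have "(\<lambda>n. (1 / m n) *\<^sub>R p n - y n) \<longlonglongrightarrow> 0"
  proof (rule Lim_null_comparison)
    show "\<forall>\<^sub>F n in sequentially. norm ((1 / m n) *\<^sub>R p n - y n) \<le> Q * m n"
    proof (intro always_eventually allI)
      fix n
      have "(1 / m n) *\<^sub>R p n - y n = (1 / m n) *\<^sub>R (p n - m n *\<^sub>R y n)" using m(2)[of n] by (simp add: algebra_simps)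
      then have "norm ((1 / m n) *\<^sub>R p n - y n) = (1 / m n) * norm (p n - m n *\<^sub>R y n)" using m(2)[of n] by simp
      also have "\<dots> \<le> (1 / m n) * (Q * (m n)\<^sup>2)" using le[of n] m(2)[of n] by (intro mult_left_mono) auto
      also have "\<dots> = Q * m n" using m(2)[of n] by (simp add: power2_eq_square)
      finally show "norm ((1 / m n) *\<^sub>R p n - y n) \<le> Q * m n" .
    qed
    have "(\<lambda>n. Q * m n) \<longlonglongrightarrow> Q * 0" by (intro tendsto_intros m)
    then show "(\<lambda>n. Q * m n) \<longlonglongrightarrow> 0" by simp
  qed
  from tendsto_add[OF this y] show ?thesis by simp
qed

lemma coefficients_subsequence:
  fixes a :: "nat \<Rightarrow> nat \<Rightarrow> real"
  assumes "\<And>n i. i < N \<Longrightarrow> 0 \<le> a n i" "\<And>n. (\<Sum>i<N. a n i) \<le> 1"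
  obtains k \<alpha> where "strict_mono (k::nat\<Rightarrow>nat)" "\<And>i. i < N \<Longrightarrow> (\<lambda>n. a (k n) i) \<longlonglongrightarrow> \<alpha> i" "\<And>i. i < N \<Longrightarrow> 0 \<le> \<alpha> i"
proof -
  obtain k where k: "strict_mono (k::nat\<Rightarrow>nat)" "\<And>i. i \<in> {..<N} \<Longrightarrow> \<exists>l. (\<lambda>n. a (k n) i) \<longlonglongrightarrow> l"
  proof (rule function_convergent_subsequence[of "{..<N}" a 1])
    show "norm (a n i) \<le> 1" if "i \<in> {..<N}" for n i
      using assms(1)[of i n] assms(2)[of n] member_le_sum[of i "{..<N}" "a n"] assms(1) that by fastforce
  qed auto
  then obtain \<alpha> where \<alpha>: "\<And>i. i < N \<Longrightarrow> (\<lambda>n. a (k n) i) \<longlonglongrightarrow> \<alpha> i" by (metis lessThan_iff)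
  moreover have "0 \<le> \<alpha> i" if "i < N" for i using assms(1)[OF that] by (intro tendsto_lowerbound[OF \<alpha>[OF that]]) auto
  ultimately show ?thesis using that k(1) by blast
qed

text \<open>The direction is a limit of backward difference quotients. Were it
  \<open>\<mu> *s x0\<close>, convexity of \<open>v\<close> would give
  \<open>Re \<mu> \<ge> 0\<close> and the corresponding constant law \<open>Re \<mu> < 0\<close>.
  Its determinant with \<open>x0\<close> is used to scale and rotate the chart.\<close>

lemma extremal_direction:
  assumes PAS: "periodically_asymptotically_stable N A" and \<rho>: "\<rho> \<ge> 0"
    and shift: "\<And>i y. B i *v y = A i *v y - \<rho> *\<^sub>R y"
    and v: "cnorm v" and K: "K \<ge> 0" and x: "extremal N B K v x" and x0: "x 0 = x0"
  obtains \<beta> where "\<And>i. i < N \<Longrightarrow> 0 \<le> \<beta> i" "(\<Sum>i<N. \<beta> i) = 1"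
    "subtangent v x0 (- (\<Sum>i<N. \<beta> i *\<^sub>R (B i *v x0)))" "dt x0 (\<Sum>i<N. \<beta> i *\<^sub>R (B i *v x0)) \<noteq> 0"
proof -
  have sv: "cseminorm v" using v by (simp add: cnorm_def)
  have vx0: "v x0 = 1" using x x0 by (auto simp: extremal_def)
  have x0nz: "x0 \<noteq> 0" using vx0 cseminorm_0[OF sv] by auto
  obtain L where L: "L > 0" "\<And>x. v x \<le> L * norm x" using cseminorm_bounded[OF sv] by blast
  obtain Q where Q: "Q \<ge> 0" "\<And>q h. extremal N B K v q \<Longrightarrow> h \<ge> 0 \<Longrightarrow> \<exists>a. (\<forall>i<N. 0 \<le> a i) \<and> (\<Sum>i<N. a i) = h \<and>
        norm (q (- h) - q 0 + (\<Sum>i<N. a i *\<^sub>R (B i *v q 0))) \<le> Q * h\<^sup>2"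
    by (rule extremal_expand[OF v K, of N B]) blast
  define m where "m n = 1 / (real n + 1)" for n
  have m: "m n > 0" for n by (simp add: m_def)
  have m0: "m \<longlonglongrightarrow> 0" unfolding m_def using LIMSEQ_Suc[OF lim_1_over_n[where 'a=real]] by (simp add: add.commute)
  have ex: "\<exists>a. (\<forall>i<N. 0 \<le> a i) \<and> (\<Sum>i<N. a i) = m n \<and> norm (x (- m n) - x0 + (\<Sum>i<N. a i *\<^sub>R (B i *v x0))) \<le> Q * (m n)\<^sup>2" for n
    using Q(2)[OF x less_imp_le[OF m]] x0 by simp
  have "\<exists>b. \<forall>n. (\<forall>i<N. 0 \<le> b n i) \<and> (\<Sum>i<N. b n i) = m n \<and> norm (x (- m n) - x0 + (\<Sum>i<N. b n i *\<^sub>R (B i *v x0))) \<le> Q * (m n)\<^sup>2"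
    by (intro choice allI ex)
  then obtain b where b: "\<And>n i. i < N \<Longrightarrow> 0 \<le> b n i" "\<And>n. (\<Sum>i<N. b n i) = m n"
     "\<And>n. norm (x (- m n) - x0 + (\<Sum>i<N. b n i *\<^sub>R (B i *v x0))) \<le> Q * (m n)\<^sup>2" by auto
  have sum1: "(\<Sum>i<N. b n i / m n) = 1" for n using b(2)[of n] m[of n] by (simp add: sum_divide_distrib[symmetric])
  obtain k \<beta> where k: "strict_mono (k::nat\<Rightarrow>nat)" "\<And>i. i < N \<Longrightarrow> (\<lambda>n. b (k n) i / m (k n)) \<longlonglongrightarrow> \<beta> i" "\<And>i. i < N \<Longrightarrow> 0 \<le> \<beta> i"
  proof (rule coefficients_subsequence[of N "\<lambda>n i. b n i / m n"])
    show "0 \<le> b n i / m n" if "i < N" for n i using b(1)[OF that] m[of n] by (simp add: less_imp_le)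
    show "(\<Sum>i<N. b n i / m n) \<le> 1" for n using sum1 by simp
  qed blast
  have "(\<lambda>n. \<Sum>i<N. b (k n) i / m (k n)) \<longlonglongrightarrow> (\<Sum>i<N. \<beta> i)" using k(2) by (intro tendsto_sum) auto
  then have \<beta>1: "(\<Sum>i<N. \<beta> i) = 1" by (simp add: sum1 LIMSEQ_const_iff)
  define w where "w = (\<Sum>i<N. \<beta> i *\<^sub>R (B i *v x0))"
  have st: "subtangent v x0 (- w)"
  proof (rule subtangent_limit[OF sv vx0])
    show "(\<lambda>n. m (k n)) \<longlonglongrightarrow> 0" using LIMSEQ_subseq_LIMSEQ[OF m0 k(1)] by (simp add: o_def)
    show "(\<lambda>n. - (\<Sum>i<N. (b (k n) i / m (k n)) *\<^sub>R (B i *v x0))) \<longlonglongrightarrow> - w"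
      unfolding w_def using k(2) by (intro tendsto_intros) auto
    fix n
    define y where "y = (\<Sum>i<N. b (k n) i *\<^sub>R (B i *v x0))"
    have "m (k n) *\<^sub>R - (\<Sum>i<N. (b (k n) i / m (k n)) *\<^sub>R (B i *v x0)) = - y"
      using m[of "k n"] by (simp add: y_def scaleR_sum_right)
    then have "v (x0 + m (k n) *\<^sub>R - (\<Sum>i<N. (b (k n) i / m (k n)) *\<^sub>R (B i *v x0))) = v (x (- m (k n)) - (x (- m (k n)) - x0 + y))"
      by simp
    also have "\<dots> \<le> v (x (- m (k n))) + v (x (- m (k n)) - x0 + y)" by (rule cseminorm_diff[OF sv])
    also have "\<dots> \<le> 1 + L * (Q * (m (k n))\<^sup>2)"
      using x L(2)[of "x (- m (k n)) - x0 + y"] b(3)[of "k n"] L(1) mult_left_mono[of _ "Q * (m (k n))\<^sup>2" L]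
      unfolding extremal_def y_def by (smt (verit))
    finally show "v (x0 + m (k n) *\<^sub>R - (\<Sum>i<N. (b (k n) i / m (k n)) *\<^sub>R (B i *v x0))) \<le> 1 + (L * Q) * (m (k n))\<^sup>2" by simp
  qed (use m in auto)
  have "dt x0 w \<noteq> 0"
  proof
    assume "dt x0 w = 0"
    then obtain \<mu> where \<mu>: "w = \<mu> *s x0" using dt_eq_0_parallel[OF x0nz] by blast
    have st0: "subtangent v x0 0" unfolding subtangent_def using vx0 by (auto intro: exI[of _ 1])
    have "Re \<mu> \<ge> 0"
    proof (rule tangent_Re_nonneg[OF sv vx0 _ st st0])
      show "0 = \<mu> *s x0 + - w + 0" by (simp add: \<mu>)
      show "1 \<le> v (x0 + s *\<^sub>R 0)" for s by (simp add: vx0)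
    qed
    moreover have "Re \<mu> < 0"
      by (rule no_central_direction[OF PAS \<rho> shift, of \<beta> x0]) (use k(3) \<beta>1 x0nz \<mu> in \<open>auto simp: w_def\<close>)
    ultimately show False by simp
  qed
  then show ?thesis using that k(3) \<beta>1 st unfolding w_def by blast
qed

text \<open>If this failed for arbitrarily short times, the rescaled limits of the displacements
  would satisfy \<open>Y0 + Y1 + \<gamma> *\<^sub>R w = \<mu> *s x0\<close> with
  \<open>\<gamma> \<ge> 0\<close>. Then \<open>v\<close> forces \<open>Re \<mu> \<ge> 0\<close>,
  while the constant law with these weights forces \<open>Re \<mu> < 0\<close>. Two curves occur
  because different passages may have different limits.\<close>

lemma local_transversality:
  assumes PAS: "periodically_asymptotically_stable N A" and \<rho>: "\<rho> \<ge> 0"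
    and shift: "\<And>i y. B i *v y = A i *v y - \<rho> *\<^sub>R y"
    and v: "cnorm v" and K: "K \<ge> 0" and x: "extremal N B K v x" and x0: "x 0 = x0" and f: "dt x0 f = 1"
  obtains c \<eta> where "c \<noteq> 0" "\<eta> > 0"
    "\<And>q r h h'. extremal N B K v q \<Longrightarrow> extremal N B K v r \<Longrightarrow> q 0 = x0 \<Longrightarrow> r 0 = x0 \<Longrightarrow>
       0 \<le> h \<Longrightarrow> h \<le> \<eta> \<Longrightarrow> 0 \<le> h' \<Longrightarrow> h' \<le> \<eta> \<Longrightarrow> h > 0 \<or> h' > 0 \<Longrightarrow>
       dt (q h) f \<noteq> 0 \<and> dt (r (- h')) f \<noteq> 0 \<and> chart x0 f c (q h) - chart x0 f c (r (- h')) \<notin> \<real>\<^sub>\<le>\<^sub>0"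
proof -
  have sv: "cseminorm v" using v by (simp add: cnorm_def)
  have vx0: "v x0 = 1" using x x0 by (auto simp: extremal_def)
  have x0nz: "x0 \<noteq> 0" using vx0 cseminorm_0[OF sv] by auto
  obtain L where L: "L > 0" "\<And>x. v x \<le> L * norm x" using cseminorm_bounded[OF sv] by blast
  obtain \<beta>0 where \<beta>0: "\<And>i. i < N \<Longrightarrow> 0 \<le> \<beta>0 i" "(\<Sum>i<N. \<beta>0 i) = 1"
    "subtangent v x0 (- (\<Sum>i<N. \<beta>0 i *\<^sub>R (B i *v x0)))" "dt x0 (\<Sum>i<N. \<beta>0 i *\<^sub>R (B i *v x0)) \<noteq> 0"
    by (rule extremal_direction[OF PAS \<rho> shift v K x x0]) blast
  define w where "w = (\<Sum>i<N. \<beta>0 i *\<^sub>R (B i *v x0))"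
  define c where "c = dt x0 w"
  have c: "c \<noteq> 0" using \<beta>0(4) by (simp add: c_def w_def)
  obtain Q where Q: "Q \<ge> 0" "\<And>q h. extremal N B K v q \<Longrightarrow> h \<ge> 0 \<Longrightarrow> \<exists>a. (\<forall>i<N. 0 \<le> a i) \<and> (\<Sum>i<N. a i) = h \<and>
        norm (q h - q 0 - (\<Sum>i<N. a i *\<^sub>R (B i *v q 0))) \<le> Q * h\<^sup>2"
    "\<And>q h. extremal N B K v q \<Longrightarrow> h \<ge> 0 \<Longrightarrow> \<exists>a. (\<forall>i<N. 0 \<le> a i) \<and> (\<Sum>i<N. a i) = h \<and>
        norm (q (- h) - q 0 + (\<Sum>i<N. a i *\<^sub>R (B i *v q 0))) \<le> Q * h\<^sup>2"
    by (rule extremal_expand[OF v K, of N B]) blast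
  define bad where "bad q r h h' \<longleftrightarrow> \<not> (dt (q h) f \<noteq> 0 \<and> dt (r (- h')) f \<noteq> 0 \<and> chart x0 f c (q h) - chart x0 f c (r (- h')) \<notin> \<real>\<^sub>\<le>\<^sub>0)"
    for q r :: "real \<Rightarrow> complex^2" and h h'
  have "\<exists>\<eta>>0. \<forall>q r h h'. extremal N B K v q \<longrightarrow> extremal N B K v r \<longrightarrow> q 0 = x0 \<longrightarrow> r 0 = x0 \<longrightarrow>
       0 \<le> h \<longrightarrow> h \<le> \<eta> \<longrightarrow> 0 \<le> h' \<longrightarrow> h' \<le> \<eta> \<longrightarrow> h > 0 \<or> h' > 0 \<longrightarrow> \<not> bad q r h h'"
  proof (rule ccontr)
    assume neg: "\<not> ?thesis"
    define d where "d n = 1 / (real n + 1)" for n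
    have d: "d n > 0" for n by (simp add: d_def)
    have d0: "d \<longlonglongrightarrow> 0" unfolding d_def using LIMSEQ_Suc[OF lim_1_over_n[where 'a=real]] by (simp add: add.commute)
    have "\<exists>q r h h'. extremal N B K v q \<and> extremal N B K v r \<and> q 0 = x0 \<and> r 0 = x0 \<and>
       0 \<le> h \<and> h \<le> d n \<and> 0 \<le> h' \<and> h' \<le> d n \<and> (h > 0 \<or> h' > 0) \<and> bad q r h h'" for n
    proof (rule ccontr)
      assume "\<not> ?thesis"
      then have "\<exists>\<eta>>0. \<forall>q r h h'. extremal N B K v q \<longrightarrow> extremal N B K v r \<longrightarrow> q 0 = x0 \<longrightarrow> r 0 = x0 \<longrightarrow>
         0 \<le> h \<longrightarrow> h \<le> \<eta> \<longrightarrow> 0 \<le> h' \<longrightarrow> h' \<le> \<eta> \<longrightarrow> h > 0 \<or> h' > 0 \<longrightarrow> \<not> bad q r h h'"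
        using d[of n] by (intro exI[of _ "d n"]) blast
      then show False using neg by blast
    qed
    then obtain q r h h' where E: "\<And>n. extremal N B K v (q n)" "\<And>n. extremal N B K v (r n)" "\<And>n. q n 0 = x0" "\<And>n. r n 0 = x0"
      and h: "\<And>n. 0 \<le> h n" "\<And>n. h n \<le> d n" "\<And>n. 0 \<le> h' n" "\<And>n. h' n \<le> d n" "\<And>n. h n > 0 \<or> h' n > 0"
      and bad: "\<And>n. bad (q n) (r n) (h n) (h' n)" by metis
    \<comment> \<open>Scaling by the sum lets either time be 0 and keeps the total of the limiting
      weights equal to 1, so they cannot all vanish.\<close>
    define m where "m n = h n + h' n" for n
    have m: "m n > 0" for n using h(1,3)[of n] h(5)[of n] by (auto simp: m_def)
    have m0: "m \<longlonglongrightarrow> 0"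
    proof (rule Lim_null_comparison)
      show "\<forall>\<^sub>F n in sequentially. norm (m n) \<le> 2 * d n"
      proof (intro always_eventually allI)
        fix n show "norm (m n) \<le> 2 * d n" using h(1-4)[of n] by (simp add: m_def)
      qed
      have "(\<lambda>n. 2 * d n) \<longlonglongrightarrow> 2 * 0" by (intro tendsto_intros d0)
      then show "(\<lambda>n. 2 * d n) \<longlonglongrightarrow> 0" by simp
    qed
    have sq: "Q * (h n)\<^sup>2 \<le> Q * (m n)\<^sup>2" "Q * (h' n)\<^sup>2 \<le> Q * (m n)\<^sup>2" for n
      using h(1,3)[of n] Q(1) by (auto simp: m_def intro!: mult_left_mono power_mono)
    have ex: "\<exists>a. (\<forall>i<N. 0 \<le> a i) \<and> (\<Sum>i<N. a i) = h n \<and> norm (q n (h n) - x0 - (\<Sum>i<N. a i *\<^sub>R (B i *v x0))) \<le> Q * (h n)\<^sup>2" for n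
      using Q(2)[OF E(1)[of n] h(1)[of n]] E(3)[of n] by simp
    have "\<exists>a. \<forall>n. (\<forall>i<N. 0 \<le> a n i) \<and> (\<Sum>i<N. a n i) = h n \<and> norm (q n (h n) - x0 - (\<Sum>i<N. a n i *\<^sub>R (B i *v x0))) \<le> Q * (h n)\<^sup>2"
      by (intro choice allI ex)
    then obtain a where a: "\<And>n i. i < N \<Longrightarrow> 0 \<le> a n i" "\<And>n. (\<Sum>i<N. a n i) = h n"
      "\<And>n. norm (q n (h n) - x0 - (\<Sum>i<N. a n i *\<^sub>R (B i *v x0))) \<le> Q * (h n)\<^sup>2" by auto
    have ex: "\<exists>a. (\<forall>i<N. 0 \<le> a i) \<and> (\<Sum>i<N. a i) = h' n \<and> norm (r n (- h' n) - x0 + (\<Sum>i<N. a i *\<^sub>R (B i *v x0))) \<le> Q * (h' n)\<^sup>2" for n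
      using Q(3)[OF E(2)[of n] h(3)[of n]] E(4)[of n] by simp
    have "\<exists>b. \<forall>n. (\<forall>i<N. 0 \<le> b n i) \<and> (\<Sum>i<N. b n i) = h' n \<and> norm (r n (- h' n) - x0 + (\<Sum>i<N. b n i *\<^sub>R (B i *v x0))) \<le> Q * (h' n)\<^sup>2"
      by (intro choice allI ex)
    then obtain b where b: "\<And>n i. i < N \<Longrightarrow> 0 \<le> b n i" "\<And>n. (\<Sum>i<N. b n i) = h' n"
      "\<And>n. norm (r n (- h' n) - x0 + (\<Sum>i<N. b n i *\<^sub>R (B i *v x0))) \<le> Q * (h' n)\<^sup>2" by auto
    obtain k1 \<alpha> where k1: "strict_mono (k1::nat\<Rightarrow>nat)" "\<And>i. i < N \<Longrightarrow> (\<lambda>n. a (k1 n) i / m (k1 n)) \<longlonglongrightarrow> \<alpha> i" "\<And>i. i < N \<Longrightarrow> 0 \<le> \<alpha> i"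
    proof (rule coefficients_subsequence[of N "\<lambda>n i. a n i / m n"])
      show "0 \<le> a n i / m n" if "i < N" for n i using a(1)[OF that] m[of n] by (simp add: less_imp_le)
      show "(\<Sum>i<N. a n i / m n) \<le> 1" for n
        using a(2)[of n] m[of n] h(3)[of n] by (simp add: sum_divide_distrib[symmetric] m_def divide_le_eq)
    qed blast
    obtain k2 \<beta> where k2: "strict_mono (k2::nat\<Rightarrow>nat)" "\<And>i. i < N \<Longrightarrow> (\<lambda>n. b (k1 (k2 n)) i / m (k1 (k2 n))) \<longlonglongrightarrow> \<beta> i" "\<And>i. i < N \<Longrightarrow> 0 \<le> \<beta> i"
    proof (rule coefficients_subsequence[of N "\<lambda>n i. b (k1 n) i / m (k1 n)"])
      show "0 \<le> b (k1 n) i / m (k1 n)" if "i < N" for n i using b(1)[OF that] m[of "k1 n"] by (simp add: less_imp_le)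
      show "(\<Sum>i<N. b (k1 n) i / m (k1 n)) \<le> 1" for n
        using b(2)[of "k1 n"] m[of "k1 n"] h(1)[of "k1 n"] by (simp add: sum_divide_distrib[symmetric] m_def divide_le_eq)
    qed blast
    define k where "k = k1 \<circ> k2"
    have k: "strict_mono k" using strict_mono_o[OF k1(1) k2(1)] by (simp add: k_def)
    have \<alpha>: "(\<lambda>n. a (k n) i / m (k n)) \<longlonglongrightarrow> \<alpha> i" and \<beta>: "(\<lambda>n. b (k n) i / m (k n)) \<longlonglongrightarrow> \<beta> i" if "i < N" for i
      using LIMSEQ_subseq_LIMSEQ[OF k1(2)[OF that] k2(1)] k2(2)[OF that] by (auto simp: k_def o_def)
    have mk: "(\<lambda>n. m (k n)) \<longlonglongrightarrow> 0" using LIMSEQ_subseq_LIMSEQ[OF m0 k] by (simp add: o_def)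
    have "(\<lambda>n. (\<Sum>i<N. a (k n) i / m (k n)) + (\<Sum>i<N. b (k n) i / m (k n))) \<longlonglongrightarrow> (\<Sum>i<N. \<alpha> i) + (\<Sum>i<N. \<beta> i)"
      using \<alpha> \<beta> by (intro tendsto_intros) auto
    moreover have "(\<Sum>i<N. a (k n) i / m (k n)) + (\<Sum>i<N. b (k n) i / m (k n)) = 1" for n
      using m[of "k n"] a(2)[of "k n"] b(2)[of "k n"]
      by (simp add: sum_divide_distrib[symmetric] add_divide_distrib[symmetric] m_def)
    ultimately have \<alpha>\<beta>: "(\<Sum>i<N. \<alpha> i) + (\<Sum>i<N. \<beta> i) = 1" by (simp add: LIMSEQ_const_iff)
    define Y0 where "Y0 = (\<Sum>i<N. \<alpha> i *\<^sub>R (B i *v x0))"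
    define Y1 where "Y1 = (\<Sum>i<N. \<beta> i *\<^sub>R (B i *v x0))"
    define y0 where "y0 n = (\<Sum>i<N. (a (k n) i / m (k n)) *\<^sub>R (B i *v x0))" for n
    define y1 where "y1 n = (\<Sum>i<N. (b (k n) i / m (k n)) *\<^sub>R (B i *v x0))" for n
    have y0: "y0 \<longlonglongrightarrow> Y0" unfolding y0_def Y0_def using \<alpha> by (intro tendsto_intros) auto
    have y1: "y1 \<longlonglongrightarrow> Y1" unfolding y1_def Y1_def using \<beta> by (intro tendsto_intros) auto
    have my0: "m (k n) *\<^sub>R y0 n = (\<Sum>i<N. a (k n) i *\<^sub>R (B i *v x0))" for n
      unfolding y0_def scaleR_sum_right using m[of "k n"] by (intro sum.cong) auto
    have my1: "m (k n) *\<^sub>R y1 n = (\<Sum>i<N. b (k n) i *\<^sub>R (B i *v x0))" for n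
      unfolding y1_def scaleR_sum_right using m[of "k n"] by (intro sum.cong) auto
    have rem0: "norm (q (k n) (h (k n)) - x0 - m (k n) *\<^sub>R y0 n) \<le> Q * (m (k n))\<^sup>2" for n
      unfolding my0 using a(3)[of "k n"] sq(1)[of "k n"] by linarith
    have rem1: "norm (r (k n) (- h' (k n)) - x0 - m (k n) *\<^sub>R (- y1 n)) \<le> Q * (m (k n))\<^sup>2" for n
      using b(3)[of "k n"] sq(2)[of "k n"] by (simp add: my1)
    have q1: "v (q n t) = 1" "v (r n t) = 1" for n t using E by (auto simp: extremal_def)
    have up: "\<And>s. s \<ge> 0 \<Longrightarrow> 1 \<le> v (x0 + s *\<^sub>R Y0)"
    proof (rule supertangent_limit[OF sv vx0 mk m y0])
      fix n
      have "q (k n) (h (k n)) = (x0 + m (k n) *\<^sub>R y0 n) + (q (k n) (h (k n)) - x0 - m (k n) *\<^sub>R y0 n)" by simp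
      then have "v (q (k n) (h (k n))) \<le> v (x0 + m (k n) *\<^sub>R y0 n) + v (q (k n) (h (k n)) - x0 - m (k n) *\<^sub>R y0 n)"
        using cseminorm_triangle[OF sv, of "x0 + m (k n) *\<^sub>R y0 n" "q (k n) (h (k n)) - x0 - m (k n) *\<^sub>R y0 n"] by simp
      also have "v (q (k n) (h (k n)) - x0 - m (k n) *\<^sub>R y0 n) \<le> L * (Q * (m (k n))\<^sup>2)"
        using L(1) by (intro order_trans[OF L(2) mult_left_mono] rem0) auto
      finally show "1 - (L * Q) * (m (k n))\<^sup>2 \<le> v (x0 + m (k n) *\<^sub>R y0 n)" by (simp add: q1)
    qed
    have sub1: "subtangent v x0 (- Y1)"
    proof (rule subtangent_limit[OF sv vx0 mk m tendsto_minus[OF y1]])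
      fix n
      have "v (x0 + m (k n) *\<^sub>R - y1 n) = v (r (k n) (- h' (k n)) - (r (k n) (- h' (k n)) - x0 - m (k n) *\<^sub>R (- y1 n)))" by simp
      also have "\<dots> \<le> v (r (k n) (- h' (k n))) + v (r (k n) (- h' (k n)) - x0 - m (k n) *\<^sub>R (- y1 n))"
        by (rule cseminorm_diff[OF sv])
      also have "v (r (k n) (- h' (k n)) - x0 - m (k n) *\<^sub>R (- y1 n)) \<le> L * (Q * (m (k n))\<^sup>2)"
        using L(1) by (intro order_trans[OF L(2) mult_left_mono] rem1) auto
      finally show "v (x0 + m (k n) *\<^sub>R - y1 n) \<le> 1 + (L * Q) * (m (k n))\<^sup>2" by (simp add: q1)
    qed
    have d0: "dt x0 x0 = 0" by (simp add: dt_def)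
    have lim0: "(\<lambda>n. (1 / m (k n)) *\<^sub>R (q (k n) (h (k n)) - x0)) \<longlonglongrightarrow> Y0"
      by (rule tendsto_of_quadratic[OF mk m rem0 y0])
    have lim1: "(\<lambda>n. (1 / m (k n)) *\<^sub>R (r (k n) (- h' (k n)) - x0)) \<longlonglongrightarrow> - Y1"
      by (rule tendsto_of_quadratic[OF mk m rem1 tendsto_minus[OF y1]])
    have conv: "X \<longlonglongrightarrow> x0" if "(\<lambda>n. (1 / m (k n)) *\<^sub>R (X n - x0)) \<longlonglongrightarrow> Z" for X Z
    proof -
      have "(\<lambda>n. m (k n) *\<^sub>R ((1 / m (k n)) *\<^sub>R (X n - x0))) \<longlonglongrightarrow> 0 *\<^sub>R Z" by (intro tendsto_intros mk that)
      moreover have "m (k n) *\<^sub>R ((1 / m (k n)) *\<^sub>R (X n - x0)) = X n - x0" for n using m[of "k n"] by simp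
      ultimately show ?thesis by (simp add: LIM_zero_iff)
    qed
    have chlim: "(\<lambda>n. of_real (1 / m (k n)) * chart x0 f c (X n)) \<longlonglongrightarrow> dt x0 Z / c"
      if Z: "(\<lambda>n. (1 / m (k n)) *\<^sub>R (X n - x0)) \<longlonglongrightarrow> Z" for X Z
    proof -
      have "(\<lambda>n. dt x0 ((1 / m (k n)) *\<^sub>R (X n - x0)) / (dt (X n) f * c)) \<longlonglongrightarrow> dt x0 Z / (dt x0 f * c)"
        using f c by (intro tendsto_intros dt_tendsto[OF Z] dt_tendsto[OF conv[OF Z]]) auto
      moreover have "dt x0 ((1 / m (k n)) *\<^sub>R (X n - x0)) / (dt (X n) f * c) = of_real (1 / m (k n)) * chart x0 f c (X n)" for n
        unfolding chart_def dt_scaleR dt_simps(4) d0 by (simp add: scaleR_conv_of_real)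
      ultimately show ?thesis using f by simp
    qed
    have ev: "\<forall>\<^sub>F n in sequentially. dt (X n) f \<noteq> 0" if "(\<lambda>n. (1 / m (k n)) *\<^sub>R (X n - x0)) \<longlonglongrightarrow> Z" for X Z
      using tendsto_imp_eventually_ne[OF dt_tendsto(1)[OF conv[OF that], of f], of 0] f by simp
    let ?g = "\<lambda>n. of_real (1 / m (k n)) * (chart x0 f c (q (k n) (h (k n))) - chart x0 f c (r (k n) (- h' (k n))))"
    have "?g \<longlonglongrightarrow> dt x0 Y0 / c - dt x0 (- Y1) / c"
      unfolding right_diff_distrib by (intro tendsto_diff chlim lim0 lim1)
    moreover have "\<forall>\<^sub>F n in sequentially. ?g n \<in> \<real>\<^sub>\<le>\<^sub>0"
      using ev[OF lim0] ev[OF lim1]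
    proof eventually_elim
      case (elim n)
      then have "chart x0 f c (q (k n) (h (k n))) - chart x0 f c (r (k n) (- h' (k n))) \<in> \<real>\<^sub>\<le>\<^sub>0"
        using bad[of "k n"] by (simp add: bad_def)
      then show ?case using m[of "k n"]
        by (auto simp: complex_nonpos_Reals_iff less_imp_le divide_nonpos_pos)
    qed
    ultimately have lim: "dt x0 Y0 / c - dt x0 (- Y1) / c \<in> \<real>\<^sub>\<le>\<^sub>0"
      by (intro Lim_in_closed_set[OF closed_nonpos_Reals_complex _ sequentially_bot]) auto
    define \<gamma> where "\<gamma> = - Re (dt x0 Y0 / c - dt x0 (- Y1) / c)"
    have \<gamma>: "\<gamma> \<ge> 0" "dt x0 Y0 / c - dt x0 (- Y1) / c = - of_real \<gamma>"
      using lim unfolding complex_nonpos_Reals_iff \<gamma>_def by (auto simp: complex_eq_iff)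
    have "dt x0 (- Y1) = - dt x0 Y1" by (simp add: dt_def)
    then have "(dt x0 Y0 + dt x0 Y1) / c = - of_real \<gamma>" using \<gamma>(2) by (simp add: add_divide_distrib)
    then have "dt x0 Y0 + dt x0 Y1 + of_real \<gamma> * c = 0" using c by (simp add: field_simps)
    then have "dt x0 (Y0 + Y1 + \<gamma> *\<^sub>R w) = 0" unfolding dt_simps(2) dt_scaleR by (simp add: c_def scaleR_conv_of_real)
    then obtain \<mu> where \<mu>: "Y0 + Y1 + \<gamma> *\<^sub>R w = \<mu> *s x0" using dt_eq_0_parallel[OF x0nz] by blast
    have sub2: "subtangent v x0 (\<gamma> *\<^sub>R (- w))" unfolding w_def by (rule subtangent_scaleR[OF \<beta>0(3) vx0 \<gamma>(1)])
    have "Re \<mu> \<ge> 0"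
      by (rule tangent_Re_nonneg[OF sv vx0 up sub1 sub2]) (simp_all add: \<mu>[symmetric])
    moreover have "Re \<mu> < 0"
    proof (rule no_central_direction[OF PAS \<rho> shift, of "\<lambda>i. \<alpha> i + \<beta> i + \<gamma> * \<beta>0 i" x0])
      show "0 \<le> \<alpha> i + \<beta> i + \<gamma> * \<beta>0 i" if "i < N" for i using k1(3)[OF that] k2(3)[OF that] \<beta>0(1)[OF that] \<gamma>(1) by simp
      have "(\<Sum>i<N. \<alpha> i + \<beta> i + \<gamma> * \<beta>0 i) = 1 + \<gamma>"
        using \<alpha>\<beta> \<beta>0(2) by (simp add: sum.distrib sum_distrib_left[symmetric])
      then show "(\<Sum>i<N. \<alpha> i + \<beta> i + \<gamma> * \<beta>0 i) > 0" using \<gamma>(1) by simp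
      show "(\<Sum>i<N. (\<alpha> i + \<beta> i + \<gamma> * \<beta>0 i) *\<^sub>R (B i *v x0)) = \<mu> *s x0"
        unfolding \<mu>[symmetric] Y0_def Y1_def w_def by (simp add: scaleR_add_left sum.distrib scaleR_sum_right)
    qed (rule x0nz)
    ultimately show False by simp
  qed
  then obtain \<eta> where "\<eta> > 0" "\<And>q r h h'. extremal N B K v q \<Longrightarrow> extremal N B K v r \<Longrightarrow> q 0 = x0 \<Longrightarrow> r 0 = x0 \<Longrightarrow>
       0 \<le> h \<Longrightarrow> h \<le> \<eta> \<Longrightarrow> 0 \<le> h' \<Longrightarrow> h' \<le> \<eta> \<Longrightarrow> h > 0 \<or> h' > 0 \<Longrightarrow> \<not> bad q r h h'" by blast
  then show ?thesis using that[OF c] unfolding bad_def by blast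
qed

text \<open>By compactness a sequence of violations has limit curves that start on the line of
  \<open>x0\<close>; phases rotate them to start at \<open>x0\<close>, against the local statement.
  The bound \<open>\<eta>'\<close> keeps the limit times from vanishing together.\<close>

lemma uniform_transversality:
  assumes v: "cnorm v" and K: "K \<ge> 0" and x0: "x0 \<noteq> 0" and vx0: "v x0 = 1" and f: "dt x0 f = 1" and c: "c \<noteq> 0" and \<eta>: "\<eta> > 0"
    and loc: "\<And>q r h h'. extremal N B K v q \<Longrightarrow> extremal N B K v r \<Longrightarrow> q 0 = x0 \<Longrightarrow> r 0 = x0 \<Longrightarrow>
       0 \<le> h \<Longrightarrow> h \<le> \<eta> \<Longrightarrow> 0 \<le> h' \<Longrightarrow> h' \<le> \<eta> \<Longrightarrow> h > 0 \<or> h' > 0 \<Longrightarrow>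
       dt (q h) f \<noteq> 0 \<and> dt (r (- h')) f \<noteq> 0 \<and> chart x0 f c (q h) - chart x0 f c (r (- h')) \<notin> \<real>\<^sub>\<le>\<^sub>0"
    and \<eta>': "0 < \<eta>'"
  obtains \<epsilon> where "\<epsilon> > 0"
    "\<And>q r h h'. extremal N B K v q \<Longrightarrow> extremal N B K v r \<Longrightarrow>
       dt (q 0) f \<noteq> 0 \<Longrightarrow> cmod (chart x0 f c (q 0)) \<le> \<epsilon> \<Longrightarrow> dt (r 0) f \<noteq> 0 \<Longrightarrow> cmod (chart x0 f c (r 0)) \<le> \<epsilon> \<Longrightarrow>
       0 \<le> h \<Longrightarrow> h \<le> \<eta> \<Longrightarrow> 0 \<le> h' \<Longrightarrow> h' \<le> \<eta> \<Longrightarrow> h \<ge> \<eta>' \<or> h' \<ge> \<eta>' \<Longrightarrow>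
       dt (q h) f \<noteq> 0 \<and> dt (r (- h')) f \<noteq> 0 \<and>
       (\<forall>w. cmod w \<le> 2 * \<epsilon> \<longrightarrow> chart x0 f c (q h) - chart x0 f c (r (- h')) + w \<notin> \<real>\<^sub>\<le>\<^sub>0)"
proof -
  have sv: "cseminorm v" using v by (simp add: cnorm_def)
  obtain C L where CL: "C > 0" "L > 0" "\<And>x t. extremal N B K v x \<Longrightarrow> norm (x t) \<le> C"
    "\<And>x s t. extremal N B K v x \<Longrightarrow> norm (x t - x s) \<le> L * \<bar>t - s\<bar>"
    using extremal_Lipschitz[OF v K, of N B] by metis
  let ?z = "chart x0 f c"
  define near where "near \<epsilon> q \<longleftrightarrow> extremal N B K v q \<and> dt (q 0) f \<noteq> 0 \<and> cmod (?z (q 0)) \<le> \<epsilon>" for \<epsilon> and q :: "real \<Rightarrow> complex^2"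
  define bad where "bad \<epsilon> q r h h' \<longleftrightarrow> \<not> (dt (q h) f \<noteq> 0 \<and> dt (r (- h')) f \<noteq> 0 \<and>
       (\<forall>w. cmod w \<le> 2 * \<epsilon> \<longrightarrow> ?z (q h) - ?z (r (- h')) + w \<notin> \<real>\<^sub>\<le>\<^sub>0))" for \<epsilon> and q r :: "real \<Rightarrow> complex^2" and h h'
  have "\<exists>\<epsilon>>0. \<forall>q r h h'. near \<epsilon> q \<longrightarrow> near \<epsilon> r \<longrightarrow> 0 \<le> h \<longrightarrow> h \<le> \<eta> \<longrightarrow> 0 \<le> h' \<longrightarrow> h' \<le> \<eta> \<longrightarrow>
      h \<ge> \<eta>' \<or> h' \<ge> \<eta>' \<longrightarrow> \<not> bad \<epsilon> q r h h'"
  proof (rule ccontr)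
    assume neg: "\<not> ?thesis"
    define d where "d n = 1 / (real n + 1)" for n
    have d: "d n > 0" for n by (simp add: d_def)
    have d0: "d \<longlonglongrightarrow> 0" unfolding d_def using LIMSEQ_Suc[OF lim_1_over_n[where 'a=real]] by (simp add: add.commute)
    have "\<exists>q r h h'. near (d n) q \<and> near (d n) r \<and> 0 \<le> h \<and> h \<le> \<eta> \<and> 0 \<le> h' \<and> h' \<le> \<eta> \<and>
      (h \<ge> \<eta>' \<or> h' \<ge> \<eta>') \<and> bad (d n) q r h h'" for n
    proof (rule ccontr)
      assume "\<not> ?thesis"
      then have "\<exists>\<epsilon>>0. \<forall>q r h h'. near \<epsilon> q \<longrightarrow> near \<epsilon> r \<longrightarrow> 0 \<le> h \<longrightarrow> h \<le> \<eta> \<longrightarrow> 0 \<le> h' \<longrightarrow> h' \<le> \<eta> \<longrightarrow>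
        h \<ge> \<eta>' \<or> h' \<ge> \<eta>' \<longrightarrow> \<not> bad \<epsilon> q r h h'"
        using d[of n] by (intro exI[of _ "d n"]) blast
      then show False using neg by blast
    qed
    then obtain q r h h' where near: "\<And>n. near (d n) (q n)" "\<And>n. near (d n) (r n)"
      and h: "\<And>n. 0 \<le> h n" "\<And>n. h n \<le> \<eta>" "\<And>n. 0 \<le> h' n" "\<And>n. h' n \<le> \<eta>" "\<And>n. h n \<ge> \<eta>' \<or> h' n \<ge> \<eta>'"
      and bad: "\<And>n. bad (d n) (q n) (r n) (h n) (h' n)" by metis
    have qe: "extremal N B K v (q n)" and re: "extremal N B K v (r n)" for n
      using near by (auto simp: near_def)
    obtain k1 q' where k1: "strict_mono (k1::nat\<Rightarrow>nat)" "extremal N B K v q'" "\<And>t. (\<lambda>n. q (k1 n) t) \<longlonglongrightarrow> q' t"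
      using extremal_compact[of v K N B q, OF v K qe] by blast
    obtain k2 r' where k2: "strict_mono (k2::nat\<Rightarrow>nat)" "extremal N B K v r'" "\<And>t. (\<lambda>n. r (k1 (k2 n)) t) \<longlonglongrightarrow> r' t"
      using extremal_compact[of v K N B "\<lambda>n. r (k1 n)", OF v K re] by blast
    have "bounded (range (\<lambda>n. (h (k1 (k2 n)), h' (k1 (k2 n)))))"
    proof (rule boundedI)
      fix p assume "p \<in> range (\<lambda>n. (h (k1 (k2 n)), h' (k1 (k2 n))))"
      then obtain n where p: "p = (h (k1 (k2 n)), h' (k1 (k2 n)))" by auto
      have "norm p \<le> norm (h (k1 (k2 n))) + norm (h' (k1 (k2 n)))" unfolding p by (rule norm_Pair_le)
      then show "norm p \<le> \<eta> + \<eta>" using h(1-4)[of "k1 (k2 n)"] by simp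
    qed
    then obtain lim k3 where k3: "strict_mono (k3::nat\<Rightarrow>nat)" "((\<lambda>n. (h (k1 (k2 n)), h' (k1 (k2 n)))) \<circ> k3) \<longlonglongrightarrow> lim"
      using bounded_imp_convergent_subsequence by blast
    define k where "k n = k1 (k2 (k3 n))" for n
    have k: "strict_mono k" using k1(1) k2(1) k3(1) by (simp add: strict_mono_def k_def)
    define H where "H = fst lim"
    define H' where "H' = snd lim"
    have hk: "(\<lambda>n. h (k n)) \<longlonglongrightarrow> H" and h'k: "(\<lambda>n. h' (k n)) \<longlonglongrightarrow> H'"
      using tendsto_fst[OF k3(2)] tendsto_snd[OF k3(2)] by (auto simp: H_def H'_def k_def o_def)
    have qk: "(\<lambda>n. q (k n) t) \<longlonglongrightarrow> q' t" for t
      using LIMSEQ_subseq_LIMSEQ[OF LIMSEQ_subseq_LIMSEQ[OF k1(3) k2(1)] k3(1)] by (simp add: k_def o_def)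
    have rk: "(\<lambda>n. r (k n) t) \<longlonglongrightarrow> r' t" for t
      using LIMSEQ_subseq_LIMSEQ[OF k2(3) k3(1)] by (simp add: k_def o_def)
    have dk: "(\<lambda>n. d (k n)) \<longlonglongrightarrow> 0" using LIMSEQ_subseq_LIMSEQ[OF d0 k] by (simp add: o_def)
    have move: "(\<lambda>n. p n (s n)) \<longlonglongrightarrow> p' S"
      if p: "\<And>n. extremal N B K v (p n)" "(\<lambda>n. p n S) \<longlonglongrightarrow> p' S" and s: "s \<longlonglongrightarrow> S"
      for p :: "nat \<Rightarrow> real \<Rightarrow> complex^2" and p' s S
    proof -
      have "(\<lambda>n. p n (s n) - p n S) \<longlonglongrightarrow> 0"
      proof (rule Lim_null_comparison)
        show "\<forall>\<^sub>F n in sequentially. norm (p n (s n) - p n S) \<le> L * \<bar>s n - S\<bar>" using CL(4)[OF p(1)] by simp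
        have "(\<lambda>n. L * \<bar>s n - S\<bar>) \<longlonglongrightarrow> L * \<bar>S - S\<bar>" by (intro tendsto_intros s)
        then show "(\<lambda>n. L * \<bar>s n - S\<bar>) \<longlonglongrightarrow> 0" by simp
      qed
      from tendsto_add[OF this p(2)] show ?thesis by simp
    qed
    have qh: "(\<lambda>n. q (k n) (h (k n))) \<longlonglongrightarrow> q' H" by (rule move[of "\<lambda>n. q (k n)" H q' "\<lambda>n. h (k n)", OF qe qk hk])
    have rh: "(\<lambda>n. r (k n) (- h' (k n))) \<longlonglongrightarrow> r' (- H')" by (rule move[of "\<lambda>n. r (k n)" "- H'" r' "\<lambda>n. - h' (k n)", OF re rk tendsto_minus[OF h'k]])
    have H: "0 \<le> H" "H \<le> \<eta>" "0 \<le> H'" "H' \<le> \<eta>"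
      using h by (auto intro!: tendsto_lowerbound[OF hk] tendsto_upperbound[OF hk] tendsto_lowerbound[OF h'k] tendsto_upperbound[OF h'k])
    have HH: "H > 0 \<or> H' > 0"
    proof -
      have "\<eta>' \<le> H + H'"
      proof (rule tendsto_lowerbound[OF tendsto_add[OF hk h'k]])
        show "\<forall>\<^sub>F n in sequentially. \<eta>' \<le> h (k n) + h' (k n)"
        proof (intro always_eventually allI)
          fix n show "\<eta>' \<le> h (k n) + h' (k n)" using h(1,3)[of "k n"] h(5)[of "k n"] by auto
        qed
      qed simp
      then show ?thesis using \<eta>' H by linarith
    qed
    \<comment> \<open>A chart value tending to 0 puts the limit on the complex line of
      \<open>x0\<close>, and equality of the \<open>v\<close>-values makes the scalar
      unimodular.\<close>
    have base: "\<exists>u. cmod u = 1 \<and> p' 0 = u *s x0"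
      if p: "\<And>n. near (d (k n)) (p n)" "(\<lambda>n. p n 0) \<longlonglongrightarrow> p' 0" and p': "extremal N B K v p'" for p p'
    proof -
      have "(\<lambda>n. dt x0 (p n 0)) \<longlonglongrightarrow> 0"
      proof (rule Lim_null_comparison)
        show "\<forall>\<^sub>F n in sequentially. norm (dt x0 (p n 0)) \<le> d (k n) * cmod (dt (p n 0) f * c)"
        proof (intro always_eventually allI)
          fix n
          have "dt (p n 0) f * c \<noteq> 0" "cmod (?z (p n 0)) \<le> d (k n)" using p(1)[of n] c by (auto simp: near_def)
          then show "norm (dt x0 (p n 0)) \<le> d (k n) * cmod (dt (p n 0) f * c)"
            by (simp add: chart_def norm_divide divide_le_eq)
        qed
        have "(\<lambda>n. d (k n) * cmod (dt (p n 0) f * c)) \<longlonglongrightarrow> 0 * cmod (dt (p' 0) f * c)"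
          by (intro tendsto_intros dk dt_tendsto p)
        then show "(\<lambda>n. d (k n) * cmod (dt (p n 0) f * c)) \<longlonglongrightarrow> 0" by simp
      qed
      then have "dt x0 (p' 0) = 0" using LIMSEQ_unique[OF dt_tendsto(2)[OF p(2)]] by simp
      then obtain u where u: "p' 0 = u *s x0" using dt_eq_0_parallel[OF x0] by blast
      have "v (p' 0) = 1" using p' by (simp add: extremal_def)
      then show ?thesis using u vx0 by (auto simp: cseminorm_smult[OF sv])
    qed
    obtain u where u: "cmod u = 1" "q' 0 = u *s x0" using base[of "\<lambda>n. q (k n)" q', OF near(1) qk k1(2)] by blast
    obtain w where w: "cmod w = 1" "r' 0 = w *s x0" using base[of "\<lambda>n. r (k n)" r', OF near(2) rk k2(2)] by blast
    have unz: "u \<noteq> 0" "w \<noteq> 0" using u w by auto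
    define q2 where "q2 t = (1 / u) *s q' t" for t
    define r2 where "r2 t = (1 / w) *s r' t" for t
    have q2: "extremal N B K v q2" "q2 0 = x0"
      using extremal_smult[OF k1(2) sv, of "1 / u"] u unz by (auto simp: q2_def[abs_def] norm_divide vector_smult_assoc)
    have r2: "extremal N B K v r2" "r2 0 = x0"
      using extremal_smult[OF k2(2) sv, of "1 / w"] w unz by (auto simp: r2_def[abs_def] norm_divide vector_smult_assoc)
    have L: "dt (q' H) f \<noteq> 0" "dt (r' (- H')) f \<noteq> 0" "?z (q' H) - ?z (r' (- H')) \<notin> \<real>\<^sub>\<le>\<^sub>0"
      using loc[OF q2(1) r2(1) q2(2) r2(2) H HH] unz by (auto simp: q2_def r2_def dt_simps chart_smult)
    have e1: "\<forall>\<^sub>F n in sequentially. dt (q (k n) (h (k n))) f \<noteq> 0"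
      by (rule tendsto_imp_eventually_ne[OF dt_tendsto(1)[OF qh] L(1)])
    have e2: "\<forall>\<^sub>F n in sequentially. dt (r (k n) (- h' (k n))) f \<noteq> 0"
      by (rule tendsto_imp_eventually_ne[OF dt_tendsto(1)[OF rh] L(2)])
    have ex: "\<exists>y. dt (q (k n) (h (k n))) f \<noteq> 0 \<longrightarrow> dt (r (k n) (- h' (k n))) f \<noteq> 0 \<longrightarrow>
        cmod y \<le> 2 * d (k n) \<and> ?z (q (k n) (h (k n))) - ?z (r (k n) (- h' (k n))) + y \<in> \<real>\<^sub>\<le>\<^sub>0" for n
      using bad[of "k n"] unfolding bad_def by blast
    have "\<exists>y. \<forall>n. dt (q (k n) (h (k n))) f \<noteq> 0 \<longrightarrow> dt (r (k n) (- h' (k n))) f \<noteq> 0 \<longrightarrow>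
        cmod (y n) \<le> 2 * d (k n) \<and> ?z (q (k n) (h (k n))) - ?z (r (k n) (- h' (k n))) + y n \<in> \<real>\<^sub>\<le>\<^sub>0"
      by (intro choice allI ex)
    then obtain y where y: "\<And>n. dt (q (k n) (h (k n))) f \<noteq> 0 \<Longrightarrow> dt (r (k n) (- h' (k n))) f \<noteq> 0 \<Longrightarrow>
        cmod (y n) \<le> 2 * d (k n) \<and> ?z (q (k n) (h (k n))) - ?z (r (k n) (- h' (k n))) + y n \<in> \<real>\<^sub>\<le>\<^sub>0" by blast
    have y0: "y \<longlonglongrightarrow> 0"
    proof (rule Lim_null_comparison)
      show "\<forall>\<^sub>F n in sequentially. norm (y n) \<le> 2 * d (k n)"
        using e1 e2 by eventually_elim (use y in blast)
      have "(\<lambda>n. 2 * d (k n)) \<longlonglongrightarrow> 2 * 0" by (intro tendsto_intros dk)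
      then show "(\<lambda>n. 2 * d (k n)) \<longlonglongrightarrow> 0" by simp
    qed
    have "(\<lambda>n. ?z (q (k n) (h (k n))) - ?z (r (k n) (- h' (k n))) + y n) \<longlonglongrightarrow> ?z (q' H) - ?z (r' (- H')) + 0"
      by (intro tendsto_add tendsto_diff chart_tendsto qh rh L c y0)
    moreover have "\<forall>\<^sub>F n in sequentially. ?z (q (k n) (h (k n))) - ?z (r (k n) (- h' (k n))) + y n \<in> \<real>\<^sub>\<le>\<^sub>0"
      using e1 e2 by eventually_elim (use y in blast)
    ultimately have "?z (q' H) - ?z (r' (- H')) + 0 \<in> \<real>\<^sub>\<le>\<^sub>0"
      by (intro Lim_in_closed_set[OF closed_nonpos_Reals_complex _ sequentially_bot]) auto
    then show False using L(3) by simp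
  qed
  then obtain \<epsilon> where "\<epsilon> > 0" "\<And>q r h h'. near \<epsilon> q \<Longrightarrow> near \<epsilon> r \<Longrightarrow> 0 \<le> h \<Longrightarrow> h \<le> \<eta> \<Longrightarrow> 0 \<le> h' \<Longrightarrow> h' \<le> \<eta> \<Longrightarrow>
      h \<ge> \<eta>' \<or> h' \<ge> \<eta>' \<Longrightarrow> \<not> bad \<epsilon> q r h h'" by blast
  then show ?thesis using that[of \<epsilon>] unfolding near_def bad_def by blast
qed

section \<open>Choice of the three passages and conclusion\<close>

lemma compact_attains_min_real:
  fixes D :: "real \<Rightarrow> real"
  assumes "continuous_on UNIV D" "a \<le> b"
  obtains t where "a \<le> t" "t \<le> b" "\<And>s. a \<le> s \<Longrightarrow> s \<le> b \<Longrightarrow> D t \<le> D s"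
  using continuous_attains_inf[OF compact_Icc _ continuous_on_subset[OF assms(1) subset_UNIV], of a b] assms(2)
  by (metis atLeastAtMost_iff atLeastatMost_empty_iff)

theorem theorem3p10:
  fixes N :: nat and A :: "nat \<Rightarrow> complex^2^2"
  assumes "periodically_asymptotically_stable N A"
  shows "GUES N A"
proof (rule ccontr)
  assume nG: "\<not> GUES N A"
  note PAS = assms
  have N: "N > 0"
  proof (rule ccontr)
    assume "\<not> N > 0"
    then have "GUES N A" by (intro GUES_criterion[OF cnorm_norm, of 1 "-1"]) auto
    then show False using nG by simp
  qed
  have irr: "\<exists>i<N. \<forall>\<alpha>. A i *v e \<noteq> \<alpha> *s e" if "e \<noteq> 0" for e
    using reducible_GUES[OF PAS that] nG by blast
  obtain \<rho> B v K xe where \<rho>: "\<rho> \<ge> 0" and shift: "\<And>i y. B i *v y = A i *v y - \<rho> *\<^sub>R y"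
    and v: "cnorm v" and K: "K \<ge> 0" and xe: "extremal N B K v xe"
    using exists_extremal[OF N nG irr] by blast
  have sv: "cseminorm v" using v by (simp add: cnorm_def)
  obtain x where x: "extremal N B K v x" and rec: "\<And>e T. e > 0 \<Longrightarrow> \<exists>t\<ge>T. dist (x t) (x 0) < e"
    using recurrent_extremal[OF v K xe] by blast
  have v1: "v (x t) = 1" for t using x by (simp add: extremal_def)
  have xnz: "x t \<noteq> 0" for t using v1[of t] cseminorm_0[OF sv] by auto
  obtain C L where L: "L > 0" "\<And>s t. norm (x t - x s) \<le> L * \<bar>t - s\<bar>"
    using extremal_Lipschitz[OF v K, of N B] x by metis
  have "L-lipschitz_on UNIV x"
    using L by (intro lipschitz_onI) (auto simp: dist_norm abs_minus_commute)
  then have cx: "continuous_on UNIV x" by (rule lipschitz_on_continuous_on)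
  have indep: "dt (x t) (x s) \<noteq> 0" if ts: "t < s" for t s
  proof
    assume "dt (x t) (x s) = 0"
    then obtain l where "x s = l *s x t" using dt_eq_0_parallel[OF xnz] by blast
    then show False by (rule no_closed_extremal[OF PAS \<rho> shift v K x ts])
  qed
  define x0 where "x0 = x 0"
  have x0nz: "x0 \<noteq> 0" "v x0 = 1" using xnz v1 by (auto simp: x0_def)
  obtain f where f: "dt x0 f = 1" using dt_complement[OF x0nz(1)] by blast
  obtain c \<eta>0 where c: "c \<noteq> 0" and \<eta>0: "\<eta>0 > 0" and
    loc: "\<And>q r h h'. extremal N B K v q \<Longrightarrow> extremal N B K v r \<Longrightarrow> q 0 = x0 \<Longrightarrow> r 0 = x0 \<Longrightarrow>
       0 \<le> h \<Longrightarrow> h \<le> \<eta>0 \<Longrightarrow> 0 \<le> h' \<Longrightarrow> h' \<le> \<eta>0 \<Longrightarrow> h > 0 \<or> h' > 0 \<Longrightarrow>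
       dt (q h) f \<noteq> 0 \<and> dt (r (- h')) f \<noteq> 0 \<and> chart x0 f c (q h) - chart x0 f c (r (- h')) \<notin> \<real>\<^sub>\<le>\<^sub>0"
    using local_transversality[OF PAS \<rho> shift v K x x0_def[symmetric] f] by blast
  \<comment> \<open>Windows of radius \<open>\<eta>\<close> need a zone up to
    \<open>3 * \<eta>\<close> that is free of further passages, and transversality is known up to
    \<open>\<eta>0\<close>.\<close>
  define \<eta> where "\<eta> = \<eta>0 / 3"
  have \<eta>: "\<eta> > 0" using \<eta>0 by (simp add: \<eta>_def)
  have \<eta>3: "\<eta>0 = 3 * \<eta>" by (simp add: \<eta>_def)
  obtain \<epsilon> where \<epsilon>: "\<epsilon> > 0" and uni:
    "\<And>q r h h'. extremal N B K v q \<Longrightarrow> extremal N B K v r \<Longrightarrow>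
       dt (q 0) f \<noteq> 0 \<Longrightarrow> cmod (chart x0 f c (q 0)) \<le> \<epsilon> \<Longrightarrow> dt (r 0) f \<noteq> 0 \<Longrightarrow> cmod (chart x0 f c (r 0)) \<le> \<epsilon> \<Longrightarrow>
       0 \<le> h \<Longrightarrow> h \<le> \<eta>0 \<Longrightarrow> 0 \<le> h' \<Longrightarrow> h' \<le> \<eta>0 \<Longrightarrow> h \<ge> \<eta> \<or> h' \<ge> \<eta> \<Longrightarrow>
       dt (q h) f \<noteq> 0 \<and> dt (r (- h')) f \<noteq> 0 \<and>
       (\<forall>w. cmod w \<le> 2 * \<epsilon> \<longrightarrow> chart x0 f c (q h) - chart x0 f c (r (- h')) + w \<notin> \<real>\<^sub>\<le>\<^sub>0)"
  proof (rule uniform_transversality[OF v K x0nz f c \<eta>0 _ \<eta>, of N B])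
    show "dt (q h) f \<noteq> 0 \<and> dt (r (- h')) f \<noteq> 0 \<and> chart x0 f c (q h) - chart x0 f c (r (- h')) \<notin> \<real>\<^sub>\<le>\<^sub>0"
      if "extremal N B K v q" "extremal N B K v r" "q 0 = x0" "r 0 = x0" "0 \<le> h" "h \<le> \<eta>0" "0 \<le> h'" "h' \<le> \<eta>0" "h > 0 \<or> h' > 0"
      for q r h h' by (rule loc[OF that])
  qed blast
  define \<psi> where "\<psi> t = dt (x t) f" for t
  define z where "z t = chart x0 f c (x t)" for t
  define near where "near t \<longleftrightarrow> \<psi> t \<noteq> 0 \<and> cmod (z t) \<le> \<epsilon>" for t
  have uni': "\<psi> (a + h) \<noteq> 0 \<and> \<psi> (b - h') \<noteq> 0 \<and> (\<forall>w. cmod w \<le> 2 * \<epsilon> \<longrightarrow> z (a + h) - z (b - h') + w \<notin> \<real>\<^sub>\<le>\<^sub>0)"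
    if "near a" "near b" "0 \<le> h" "h \<le> 3 * \<eta>" "0 \<le> h'" "h' \<le> 3 * \<eta>" "h \<ge> \<eta> \<or> h' \<ge> \<eta>" for a b h h'
    using uni[OF extremal_shift[OF x, of a] extremal_shift[OF x, of b], of h h'] that
    by (simp add: near_def \<psi>_def z_def \<eta>3 add.commute[of h a])
  \<comment> \<open>The squared chordal distance to \<open>x0\<close> on the Riemann sphere of the
    chart. Unlike \<open>z\<close> it is continuous where \<open>\<psi>\<close> vanishes, with the
    value 1 there, and elsewhere it is an increasing function of \<open>cmod (z t)\<close>.\<close>
  define D where "D t = (cmod (dt x0 (x t)))\<^sup>2 / ((cmod (dt x0 (x t)))\<^sup>2 + (cmod (\<psi> t * c))\<^sup>2)" for t
  have den: "(cmod (dt x0 y))\<^sup>2 + (cmod (dt y f * c))\<^sup>2 > 0" if "y \<noteq> 0" for y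
  proof (rule ccontr)
    assume "\<not> ?thesis"
    then have "dt x0 y = 0" "dt y f = 0"
      using c by (auto simp: not_less sum_power2_le_zero_iff)
    then show False using dt_expand[OF f, of y] that by simp
  qed
  have cdt: "continuous_on S (\<lambda>y. dt x0 y)" "continuous_on S (\<lambda>y. dt y f)" for S
    unfolding dt_def by (intro continuous_intros)+
  define Dp where "Dp y = (cmod (dt x0 y))\<^sup>2 / ((cmod (dt x0 y))\<^sup>2 + (cmod (dt y f * c))\<^sup>2)" for y
  have cDp: "continuous_on (- {0}) Dp"
    unfolding Dp_def
  proof (intro continuous_intros cdt ballI)
    fix y :: "complex^2" assume "y \<in> - {0}"
    then show "(cmod (dt x0 y))\<^sup>2 + (cmod (dt y f * c))\<^sup>2 \<noteq> 0" using den[of y] by (metis ComplD insertCI less_irrefl)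
  qed
  have DDp: "D t = Dp (x t)" for t by (simp add: D_def Dp_def \<psi>_def)
  have cD: "continuous_on UNIV D"
    unfolding DDp using xnz by (intro continuous_on_compose2[OF cDp cx]) auto
  define G :: "real \<Rightarrow> real" where "G u = u\<^sup>2 / (1 + u\<^sup>2)" for u
  have Gmono: "G u \<le> G w \<longleftrightarrow> u \<le> w" if "0 \<le> u" "0 \<le> w" for u w
  proof -
    have p: "1 + u\<^sup>2 > 0" "1 + w\<^sup>2 > 0" by (auto intro: add_pos_nonneg)
    have "G u \<le> G w \<longleftrightarrow> u\<^sup>2 * (1 + w\<^sup>2) \<le> w\<^sup>2 * (1 + u\<^sup>2)" using p by (simp add: G_def frac_le_eq divide_le_0_iff pos_divide_le_eq pos_le_divide_eq field_simps)
    also have "\<dots> \<longleftrightarrow> u\<^sup>2 \<le> w\<^sup>2" by (simp add: algebra_simps)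
    also have "\<dots> \<longleftrightarrow> u \<le> w" using that by (simp add: power_mono_iff)
    finally show ?thesis .
  qed
  have G1: "G u < 1" for u
  proof -
    have "1 + u\<^sup>2 > 0" by (auto intro: add_pos_nonneg)
    then show ?thesis by (simp add: G_def)
  qed
  have DG: "D t = G (cmod (z t))" if "\<psi> t \<noteq> 0" for t
  proof -
    have "\<psi> t * c \<noteq> 0" using that c by simp
    then have q: "(cmod (\<psi> t * c))\<^sup>2 \<noteq> 0" by simp
    have "cmod (z t) = cmod (dt x0 (x t)) / cmod (\<psi> t * c)" by (simp add: z_def chart_def \<psi>_def norm_divide)
    moreover have "p\<^sup>2 / (p\<^sup>2 + q\<^sup>2) = G (p / q)" if "q\<^sup>2 \<noteq> 0" for p q :: real
    proof -
      have "1 + (p / q)\<^sup>2 = (p\<^sup>2 + q\<^sup>2) / q\<^sup>2" using that by (simp add: power_divide add_divide_distrib)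
      then show ?thesis using that by (simp add: G_def power_divide)
    qed
    ultimately show ?thesis using q by (simp add: D_def)
  qed
  have D1: "D t = 1" if "\<psi> t = 0" for t
    using den[OF xnz[of t]] that by (simp add: D_def \<psi>_def)
  have near_iff: "near t \<longleftrightarrow> D t \<le> G \<epsilon>" for t
    using Gmono[of "cmod (z t)" \<epsilon>] \<epsilon> G1[of \<epsilon>] DG[of t] D1[of t] by (cases "\<psi> t = 0") (auto simp: near_def)
  have near0: "near 0" using f by (simp add: near_def \<psi>_def z_def chart_def x0_def[symmetric] dt_simps(7) \<epsilon> less_imp_le)
  \<comment> \<open>A second passage so soon would make the difference of the two chart values an
    admissible perturbation; cancelling it leaves 0, which lies on the forbidden half-axis.\<close>
  have far: "D (a + h) > G \<epsilon>" if a: "near a" and h: "\<eta> \<le> h" "h \<le> 3 * \<eta>" for a h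
  proof (rule ccontr)
    assume "\<not> ?thesis"
    then have n: "near (a + h)" using near_iff by simp
    have "cmod (- (z (a + h) - z a)) \<le> 2 * \<epsilon>"
      using n a norm_triangle_ineq4[of "z a" "z (a + h)"] by (simp add: near_def)
    then have "z (a + h) - z (a - 0) + - (z (a + h) - z a) \<notin> \<real>\<^sub>\<le>\<^sub>0"
      using uni'[OF a a, of h 0] h \<eta> by auto
    then show False by simp
  qed
  have same: "t = s" if "z t = z s" "\<psi> t \<noteq> 0" "\<psi> s \<noteq> 0" for t s
  proof -
    have "dt (x t) (x s) = 0"
    proof -
      have "dt x0 (x t) * \<psi> s = dt x0 (x s) * \<psi> t"
        using that c by (simp add: z_def chart_def \<psi>_def frac_eq_eq)
      moreover have "dt (x t) (x s) = \<psi> t * dt x0 (x s) - dt x0 (x t) * \<psi> s"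
      proof -
        have fe: "dt f x0 = - 1" using f by (simp add: dt_def algebra_simps)
        show ?thesis
          by (subst dt_expand[OF f, of "x t"], subst dt_expand[OF f, of "x s"]) (simp add: dt_simps f fe \<psi>_def algebra_simps)
      qed
      ultimately show ?thesis by (simp add: mult.commute)
    qed
    moreover have "dt (x s) (x t) = - dt (x t) (x s)" by (simp add: dt_def)
    ultimately show ?thesis using indep[of t s] indep[of s t] by (cases t s rule: linorder_cases) auto
  qed
  have Dpos: "D t > 0" if "t \<noteq> 0" for t
  proof -
    have "dt x0 (x t) \<noteq> 0"
    proof
      assume e: "dt x0 (x t) = 0"
      then have "\<psi> t \<noteq> 0" using den[OF xnz[of t]] by (auto simp: \<psi>_def)
      moreover have "z t = z 0" using e by (simp add: z_def chart_def x0_def[symmetric] dt_simps(7))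
      ultimately show False using same[of t 0] near0 that by (simp add: near_def)
    qed
    then show ?thesis using den[OF xnz[of t]] by (simp add: D_def \<psi>_def)
  qed
  have recD: "\<exists>t\<ge>T. D t < \<delta>" if "\<delta> > 0" for T \<delta>
  proof -
    have "continuous (at x0 within - {0}) Dp" using cDp x0nz by (simp add: continuous_on_eq_continuous_within)
    then have "\<exists>e>0. \<forall>y\<in>- {0}. dist y x0 < e \<longrightarrow> dist (Dp y) (Dp x0) < \<delta>"
      using that unfolding continuous_within_eps_delta by blast
    moreover have "Dp x0 = 0" by (simp add: Dp_def dt_simps(7))
    ultimately obtain e where e: "e > 0" "\<And>y. y \<in> - {0} \<Longrightarrow> dist y x0 < e \<Longrightarrow> dist (Dp y) 0 < \<delta>"
      by auto
    obtain t where "t \<ge> T" "dist (x t) x0 < e" using rec[OF e(1)] unfolding x0_def by blast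
    then show ?thesis using e(2)[of "x t"] xnz[of t] by (auto simp: DDp dist_real_def)
  qed
  have G\<epsilon>: "G \<epsilon> > 0" using \<epsilon> by (simp add: G_def add_pos_nonneg)
  obtain S where S: "S \<ge> 4 * \<eta>" "D S < G \<epsilon>" using recD[OF G\<epsilon>] by blast
  have nS: "near S" using S near_iff by simp
  \<comment> \<open>A closest return over a range reaching beyond the return \<open>S\<close>.
    Applied at 0 and at \<open>S\<close>, \<open>far\<close> keeps the minimiser off both ends;
    applied at \<open>T1\<close>, it extends the minimality to
    \<open>T1 + 3 * \<eta>\<close>.\<close>
  obtain T1 where T1: "\<eta> \<le> T1" "T1 \<le> S + 2 * \<eta>" "\<And>s. \<eta> \<le> s \<Longrightarrow> s \<le> S + 2 * \<eta> \<Longrightarrow> D T1 \<le> D s"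
    using compact_attains_min_real[OF cD, of \<eta> "S + 2 * \<eta>"] S \<eta> by (smt (verit))
  have DT1: "D T1 \<le> D S" using T1(3)[of S] S \<eta> by simp
  have n1: "near T1" using DT1 S near_iff by simp
  have T1a: "T1 > 3 * \<eta>"
  proof (rule ccontr)
    assume "\<not> ?thesis"
    then have "D (0 + T1) > G \<epsilon>" using T1(1) by (intro far[OF near0]) auto
    then show False using n1 near_iff by simp
  qed
  have T1b: "T1 < S + \<eta>"
  proof (rule ccontr)
    assume "\<not> ?thesis"
    then have "D (S + (T1 - S)) > G \<epsilon>" using T1(2) \<eta> by (intro far[OF nS]) auto
    then show False using n1 near_iff by simp
  qed
  have min1: "D T1 \<le> D s" if "\<eta> \<le> s" "s \<le> T1 + 3 * \<eta>" for s
  proof (cases "s \<le> S + 2 * \<eta>")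
    case False
    then have "D (T1 + (s - T1)) > G \<epsilon>" using T1b that by (intro far[OF n1]) auto
    then show ?thesis using n1 near_iff[of T1] by simp
  qed (use T1(3) that in auto)
  \<comment> \<open>Injectivity makes the closest distance positive, so recurrence eventually beats
    it.\<close>
  have "D T1 > 0" using T1(1) \<eta> by (intro Dpos) auto
  then obtain t' where t': "t' \<ge> T1 + 3 * \<eta>" "D t' < D T1" using recD by blast
  \<comment> \<open>Its least element \<open>T2\<close> is the first time, once the zone after
    \<open>T1\<close> has passed, at which the curve is at least as close as at \<open>T1\<close>;
    everything in between is strictly farther.\<close>
  define V where "V = {t \<in> {T1 + 3 * \<eta>..t'}. D t \<le> D T1}"
  have "closed V" unfolding V_def
    using continuous_closed_preimage[OF continuous_on_subset[OF cD subset_UNIV, of "{T1 + 3 * \<eta>..t'}"] closed_atLeastAtMost closed_atMost[of "D T1"]]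
    by (simp add: vimage_def Int_def)
  moreover have "bounded V" by (rule bounded_subset[of "{T1 + 3 * \<eta>..t'}"]) (auto simp: V_def)
  moreover have "t' \<in> V" using t' by (simp add: V_def)
  ultimately obtain T2 where T2: "T2 \<in> V" "\<And>t. t \<in> V \<Longrightarrow> T2 \<le> t"
    using compact_attains_inf[of V] by (auto simp: compact_eq_bounded_closed)
  have T2a: "T2 \<ge> T1 + 3 * \<eta>" "D T2 \<le> D T1" "T2 \<le> t'" using T2(1) by (auto simp: V_def)
  have n2: "near T2" using T2a n1 near_iff by simp
  have min2: "D T1 < D s" if s: "T1 + \<eta> \<le> s" "s < T2" for s
  proof (cases "s \<le> T1 + 3 * \<eta>")
    case True
    then have "D (T1 + (s - T1)) > G \<epsilon>" using s by (intro far[OF n1]) auto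
    then show ?thesis using n1 near_iff[of T1] by simp
  next
    case False
    have "s \<notin> V" using T2(2)[of s] s by auto
    then show ?thesis using False s T2a by (auto simp: V_def)
  qed
  have z0: "z 0 = 0" by (simp add: z_def chart_def x0_def[symmetric] dt_simps(7))
  have nn: "near a" if "a \<in> {0, T1, T2}" for a using that near0 n1 n2 by auto
  have normle: "cmod (z a) \<le> cmod (z b)" if "D a \<le> D b" "\<psi> a \<noteq> 0" "\<psi> b \<noteq> 0" for a b
    using that DG[of a] DG[of b] Gmono[of "cmod (z a)" "cmod (z b)"] by simp
  have \<psi>near: "\<psi> a \<noteq> 0" if "a \<in> {0, T1, T2}" for a using nn[OF that] by (simp add: near_def)
  \<comment> \<open>Since \<open>z 0 = 0\<close>, points of this chord have modulus below that of
    \<open>z b\<close> except at \<open>z b\<close> itself, and injectivity excludes both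
    ends.\<close>
  have from0: "z s \<notin> closed_segment (z 0) (z b)"
    if "b \<in> {0, T1, T2}" "D b \<le> D s" "\<psi> s \<noteq> 0" "s \<noteq> b" "s \<noteq> 0" for s b
  proof
    assume "z s \<in> closed_segment (z 0) (z b)"
    then obtain u where u: "0 \<le> u" "u \<le> 1" "z s = u *\<^sub>R z b" unfolding in_segment by (auto simp: z0)
    have "cmod (z b) \<le> cmod (z s)" using that \<psi>near by (intro normle) auto
    then have "cmod (z b) \<le> u * cmod (z b)" using u by simp
    then have "u = 1 \<or> z b = 0" using u by (simp add: mult_le_cancel_right1) force
    then have "z s = z b \<or> z s = z 0" using u z0 by auto
    then show False using same[of s b] same[of s 0] that \<psi>near by auto
  qed
  have free: "z s \<notin> closed_segment (z a) (z b)"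
    if ab: "a \<in> {0, T1, T2}" "b \<in> {0, T1, T2}" "a < b" and s: "a + \<eta> \<le> s" "s \<le> b - \<eta>" and \<psi>s: "\<psi> s \<noteq> 0" for a b s
  proof -
    have cases: "a = 0 \<and> b = T1 \<or> a = 0 \<and> b = T2 \<or> a = T1 \<and> b = T2"
      using ab T1a T2a \<eta> by auto
    then consider "a = 0" "b = T1" | "a = 0" "b = T2" | "a = T1" "b = T2" by blast
    then show ?thesis
    proof cases
      case 1
      have "z s \<notin> closed_segment (z 0) (z T1)"
        using s \<psi>s 1 \<eta> min1[of s] by (intro from0) auto
      then show ?thesis using 1 by simp
    next
      case 2
      have "D T1 \<le> D s" using min1[of s] min2[of s] s 2 \<eta> by (cases "s \<le> T1 + 3 * \<eta>") auto
      then have "D T2 \<le> D s" using T2a by simp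
      then have "z s \<notin> closed_segment (z 0) (z T2)"
        using s \<psi>s 2 \<eta> by (intro from0) auto
      then show ?thesis using 2 by simp
    next
      \<comment> \<open>\<open>T2\<close> is at least as close as \<open>T1\<close>, so the chord
        lies in the disc of radius \<open>cmod (z T1)\<close>, and in between the curve stays
        outside this disc.\<close>
      case 3
      show ?thesis
      proof
        assume "z s \<in> closed_segment (z a) (z b)"
        then have seg: "z s \<in> closed_segment (z T1) (z T2)" using 3 by simp
        have "cmod (z T2) \<le> cmod (z T1)" using T2a(2) \<psi>near by (intro normle) auto
        then have "closed_segment (z T1) (z T2) \<subseteq> cball 0 (cmod (z T1))"
          by (intro closed_segment_subset) auto
        then have le: "cmod (z s) \<le> cmod (z T1)" using seg by auto
        have "D T1 < D s" using s 3 \<eta> by (intro min2) auto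
        then have "G (cmod (z T1)) < G (cmod (z s))" using DG[OF \<psi>s] DG[of T1] \<psi>near[of T1] by simp
        moreover have "G (cmod (z s)) \<le> G (cmod (z T1))" using le Gmono by simp
        ultimately show False by simp
      qed
    qed
  qed
  show False
  proof (rule turning_contradiction[of x x0 f c \<eta> "{0, T1, T2}" 0 T1 T2 \<psi> z \<epsilon>, OF cx f c indep \<eta> refl _ _ \<psi>_def])
    show "0 + 2 * \<eta> < T1" "T1 + 2 * \<eta> < T2" using T1a T2a \<eta> by auto
    show "z t = dt x0 (x t) / (\<psi> t * c)" for t by (simp add: z_def chart_def \<psi>_def)
    show "\<psi> t \<noteq> 0" if a: "a \<in> {0, T1, T2}" and t: "\<bar>t - a\<bar> \<le> \<eta>" for a t
    proof (cases "t \<ge> a")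
      case True
      then show ?thesis using uni'[OF nn[OF a] nn[OF a], of "t - a" \<eta>] t \<eta> by auto
    next
      case False
      then show ?thesis using uni'[OF nn[OF a] nn[OF a], of \<eta> "a - t"] t \<eta> by auto
    qed
    show "z (a + h) - z (b - h') + w \<notin> \<real>\<^sub>\<le>\<^sub>0"
      if "a \<in> {0, T1, T2}" "b \<in> {0, T1, T2}" "0 \<le> h" "h \<le> \<eta>" "0 \<le> h'" "h' \<le> \<eta>" "h = \<eta> \<or> h' = \<eta>" "cmod w \<le> 2 * \<epsilon>" for a b h h' w
      using uni'[OF nn[OF that(1)] nn[OF that(2)], of h h'] that \<eta> by auto
    show "cmod (z a) \<le> \<epsilon>" if "a \<in> {0, T1, T2}" for a using nn[OF that] by (simp add: near_def)
  qed (use free in blast)+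
qed

end
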